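(* Let $\rho$ be a nontrivial probability measure on $\mathbb{R}$ with Lebesgue decomposition $d\rho=f(x)\,dx+d\rho_s$ into an absolutely continuous and a singular part. Let $\rho$ have diagonal Jacobi coefficients $\{b_n\}_{n=1}^\infty$ and off-diagonal Jacobi coefficients $\{a_n\}_{n=1}^\infty$. Assume that there is an integer $p\ge2$ and a real number $\beta\in(0,\frac1{p-1})$ such that each of the sequences $\{a_n^2-1\}_{n=1}^\infty$, $\{b_n\}_{n=1}^\infty$ can be written in the form $$\sum_{l=1}^\infty c_l e^{-in\phi_l}\gamma_n^{(l)}$$ (with $c_l\in\mathbb{C}$, $\phi_l\in\mathbb{R}$, $\gamma^{(l)}_n\in\mathbb{C}$, which may be different for the two sequences) such that the following conditions hold: (i) $\sup_l\sum_{n=1}^\infty|\gamma_{n+1}^{(l)}-\gamma_n^{(l)}|<\infty$; (ii) $\sum_{n=1}^\infty\left(\sup_l|\gamma_n^{(l)}|\right)^p<\infty$; (iii) $\sum_{l=1}^\infty|c_l|^\beta<\infty$. Then there is a set $S$ of Hausdorff dimension at most $\beta(p-1)$ with $\rho_s((-2,2)\setminus S)=0$, and $f(x)>0$ for Lebesgue-a.e. $x\in(-2,2)$.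
   Context: A probability measure on $\mathbb{R}$ is nontrivial if its support is not a finite set. Its Jacobi coefficients $a_n>0$, $b_n\in\mathbb{R}$ ($n\ge1$) are the coefficients of the recursion $x p_n(x)=a_{n+1}p_{n+1}(x)+b_{n+1}p_n(x)+a_np_{n-1}(x)$ ($n\ge0$, $p_{-1}=0$) for the orthonormal polynomials $p_n$ of $\rho$ (with positive leading coefficients; all moments of $\rho$ are assumed finite). *)

theory Defs
  imports "HOL-Probability.Probability" "HOL-Computational_Algebra.Polynomial"
begin

definition measure_support :: "'a::topological_space measure \<Rightarrow> 'a set" where
  "measure_support M = {x. \<forall>U. open U \<and> x \<in> U \<longrightarrow> emeasure M U > 0}"

definition nontrivial_measure :: "'a::topological_space measure \<Rightarrow> bool" where
  "nontrivial_measure M \<longleftrightarrow> infinite (measure_support M)"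

definition mutually_singular :: "'a measure \<Rightarrow> 'a measure \<Rightarrow> bool" where
  "mutually_singular M N \<longleftrightarrow> sets M = sets N \<and>
     (\<exists>A\<in>sets M. emeasure M A = 0 \<and> emeasure N (space M - A) = 0)"

definition lebesgue_decomposition ::
    "real measure \<Rightarrow> (real \<Rightarrow> real) \<Rightarrow> real measure \<Rightarrow> bool" where
  "lebesgue_decomposition \<rho> f \<rho>s \<longleftrightarrow>
     f \<in> borel_measurable lborel \<and> (AE x in lborel. 0 \<le> f x) \<and>
     mutually_singular lborel \<rho>s \<and>
     (\<forall>A\<in>sets borel.
        emeasure \<rho> A = emeasure (density lborel (\<lambda>x. ennreal (f x))) A + emeasure \<rho>s A)"

definition orthonormal_polynomials :: "real measure \<Rightarrow> (nat \<Rightarrow> real poly) \<Rightarrow> bool" where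
  "orthonormal_polynomials \<rho> P \<longleftrightarrow>
     (\<forall>n. degree (P n) = n \<and> lead_coeff (P n) > 0) \<and>
     (\<forall>m n. (\<integral>x. poly (P m) x * poly (P n) x \<partial>\<rho>) = (if m = n then 1 else 0))"

text \<open>The Jacobi coefficients are indexed from 1; the values \<open>a 0\<close> and \<open>b 0\<close> are irrelevant.
  The conditional below is the convention \<open>p\<^sub>-\<^sub>1 = 0\<close>.\<close>

definition jacobi_coefficients ::
    "real measure \<Rightarrow> (nat \<Rightarrow> real) \<Rightarrow> (nat \<Rightarrow> real) \<Rightarrow> bool" where
  "jacobi_coefficients \<rho> a b \<longleftrightarrow>
     (\<forall>n\<ge>1. a n > 0) \<and>
     (\<exists>P. orthonormal_polynomials \<rho> P \<and>
        (\<forall>n x. x * poly (P n) x =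
           a (n + 1) * poly (P (n + 1)) x + b (n + 1) * poly (P n) x +
           (if n = 0 then 0 else a n * poly (P (n - 1)) x)))"

text \<open>Both indices \<open>l\<close> and \<open>n\<close> start at 1, hence the successors below. The suprema and the sums in
  the first two conditions are taken in \<open>[0, \<infinity>]\<close>, so that \<open>< \<infinity>\<close> also expresses
  boundedness and convergence.\<close>

definition oscillatory_decay :: "nat \<Rightarrow> real \<Rightarrow> (nat \<Rightarrow> real) \<Rightarrow> bool" where
  "oscillatory_decay p \<beta> u \<longleftrightarrow>
     (\<exists>(c :: nat \<Rightarrow> complex) (\<phi> :: nat \<Rightarrow> real) (\<gamma> :: nat \<Rightarrow> nat \<Rightarrow> complex).
        (\<forall>n\<ge>1. (\<lambda>l. c (Suc l) * exp (- \<i> * of_nat n * of_real (\<phi> (Suc l))) * \<gamma> (Suc l) n)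
                  sums complex_of_real (u n)) \<and>
        (SUP l\<in>{1..}. \<Sum>n. ennreal (cmod (\<gamma> l (Suc n + 1) - \<gamma> l (Suc n)))) < \<infinity> \<and>
        (\<Sum>n. (SUP l\<in>{1..}. ennreal (cmod (\<gamma> l (Suc n)))) ^ p) < \<infinity> \<and>
        summable (\<lambda>l. cmod (c (Suc l)) powr \<beta>))"

text \<open>Each covering set \<open>U\<close> contributes \<open>(diam U)\<^sup>s\<close>, where a nonempty set contributes 1 if
  \<open>s = 0\<close> (whereas \<open>0 powr 0 = 0\<close>). Covers consist of bounded sets because \<open>diameter\<close> is
  meaningless on unbounded ones.\<close>

definition hausdorff_premeasure :: "real \<Rightarrow> real \<Rightarrow> 'a::metric_space set \<Rightarrow> ennreal" where
  "hausdorff_premeasure s \<delta> S =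
     (INF U\<in>{U :: nat \<Rightarrow> 'a set. S \<subseteq> (\<Union>i. U i) \<and>
                (\<forall>i. bounded (U i) \<and> diameter (U i) \<le> \<delta>)}.
        \<Sum>i. if U i = {} then 0 else if s = 0 then 1 else ennreal (diameter (U i) powr s))"

definition hausdorff_measure :: "real \<Rightarrow> 'a::metric_space set \<Rightarrow> ennreal" where
  "hausdorff_measure s S = (SUP \<delta>\<in>{0<..}. hausdorff_premeasure s \<delta> S)"

definition hausdorff_dim :: "'a::metric_space set \<Rightarrow> ennreal" where
  "hausdorff_dim S = (INF s\<in>{s. 0 \<le> s \<and> hausdorff_measure s S = 0}. ennreal s)"

end

theory Submission
  imports Defs "HOL-Library.Sublist"
begin

text \<open>At an energy \<open>x = 2 cos \<eta>\<close> all solutions of the Jacobi recursion are bounded as soon as the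
  Riccati equation for the ratio of consecutive values, written in a coordinate of the unit disc in
  which the free evolution is a rotation, has an approximate solution that tends to 0 and whose
  residual is summable. Such a solution is a finite sum of iterated expansions in the oscillating
  terms; the terms of order \<open>j < p\<close> contain \<open>j\<close> small divisors, and they converge unless
  \<open>\<eta>\<close> lies in a set of Hausdorff dimension at most \<open>\<beta> (p - 1)\<close>.

  Where all solutions are bounded, they are stable under perturbations of \<open>x\<close> of order \<open>1 / N\<close>
  for \<open>N\<close> steps. The Christoffel-Darboux kernel then gives \<open>\<rho>(x - \<delta>/N, x + \<delta>/N) = O(1 / N)\<close>,
  which excludes a singular part, and the Weyl solution bounds the Poisson integral of \<open>\<rho>\<close>
  at height \<open>1 / N\<close> from below, which makes the density positive almost everywhere.\<close>

section \<open>Sums over words\<close>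

text \<open>The Riccati map is a Moebius transformation. With its denominator cleared it becomes a
  polynomial relation between w(n) and w(n+1), so a formal solution only needs families of word
  coefficients closed under products, and no series has to be inverted. A shift in n multiplies a
  word by its phase, up to changes of the amplitudes that are summable by (i); hence each word meets
  the divisor phase - exp(-2i\<eta>). Words of at least p letters are summable in n by (ii) and are
  discarded. The obstacle is products of different small divisors. All of them are replaced by the
  worst one, attained on a contiguous subword J, which leaves series c(J) / D(J)^(p-1) over single
  words. By the inclusion of l^\<beta> in l^1 these are controlled by sums of c(J)^\<beta> |\<eta> -
  y(J)|^(-\<beta>(p-1)), which diverge only on a set of dimension at most \<beta>(p-1). The bound
  \<beta> < 1/(p-1) makes this less than 1, so the exceptional set is Lebesgue null, as positivity
  almost everywhere requires. The set S consists of the points of (-2,2) with an unbounded solution.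
  It is Borel for topological reasons; the resonances only have to cover it.\<close>

lemma has_sum_times_abs:
  fixes f :: "'a \<Rightarrow> 'c::{real_normed_field,banach}" and g :: "'b \<Rightarrow> 'c"
  assumes f: "(\<lambda>x. norm (f x)) summable_on A" and g: "(\<lambda>y. norm (g y)) summable_on B"
  shows "(\<lambda>(x, y). norm (f x * g y)) summable_on A \<times> B"
    and "((\<lambda>(x, y). f x * g y) has_sum infsum f A * infsum g B) (A \<times> B)"
proof -
  have gs: "((\<lambda>y. norm (g y)) has_sum (\<Sum>\<^sub>\<infinity>y\<in>B. norm (g y))) B"
    using g by (rule has_sum_infsum)
  show 1: "(\<lambda>(x, y). norm (f x * g y)) summable_on A \<times> B"
    by (rule summable_on_SigmaI[where g = "\<lambda>x. norm (f x) * (\<Sum>\<^sub>\<infinity>y\<in>B. norm (g y))"])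
       (auto simp: norm_mult intro!: has_sum_cmult_right gs summable_on_cmult_left f)
  have 2: "(\<lambda>(x, y). f x * g y) summable_on A \<times> B"
    by (rule abs_summable_summable) (use 1 in \<open>simp add: case_prod_unfold\<close>)
  have fs: "(f has_sum infsum f A) A" and gs: "(g has_sum infsum g B) B"
    using f g by (auto intro!: has_sum_infsum abs_summable_summable)
  show "((\<lambda>(x, y). f x * g y) has_sum infsum f A * infsum g B) (A \<times> B)"
    by (rule has_sum_SigmaI[OF _ _ 2, where g = "\<lambda>x. f x * infsum g B"])
       (auto intro!: has_sum_cmult_right has_sum_cmult_left gs fs)
qed

text \<open>A family of coefficients indexed by words is evaluated multiplicatively, so concatenation of
  words turns products of sums into this convolution.\<close>

definition list_conv :: "('l list \<Rightarrow> 'a::comm_ring_1) \<Rightarrow> ('l list \<Rightarrow> 'a) \<Rightarrow> 'l list \<Rightarrow> 'a" where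
  "list_conv A B I = (\<Sum>k\<le>length I. A (take k I) * B (drop k I))"

abbreviation ell1 :: "('a \<Rightarrow> 'b::real_normed_vector) \<Rightarrow> bool" where
  "ell1 f \<equiv> (\<lambda>x. norm (f x)) summable_on UNIV"

text \<open>A pair of words is one word with a cut position. This reindexes the double series of a
  product as a series over words of finite sums.\<close>

lemma bij_betw_list_splits:
  "bij_betw (\<lambda>(I, k). (take k I, drop k I)) (SIGMA I:UNIV. {..length I}) (UNIV \<times> UNIV)"
  by (rule bij_betw_byWitness[where f' = "\<lambda>(J, K). (J @ K, length J)"]) (auto simp: min_def)

lemma list_conv_has_sum:
  fixes A B :: "'l list \<Rightarrow> 'c::{real_normed_field,banach}"
  assumes A: "ell1 A" and B: "ell1 B"
  shows "ell1 (list_conv A B)"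
    and "(list_conv A B has_sum infsum A UNIV * infsum B UNIV) UNIV"
proof -
  let ?S = "SIGMA I:UNIV. {..length (I :: 'l list)}"
  have "((\<lambda>(x, y). A x * B y) has_sum infsum A UNIV * infsum B UNIV) (UNIV \<times> UNIV)"
    by (rule has_sum_times_abs[OF A B])
  then have "((\<lambda>(I, k). A (take k I) * B (drop k I)) has_sum infsum A UNIV * infsum B UNIV) ?S"
    by (subst (asm) has_sum_reindex_bij_betw[OF bij_betw_list_splits, symmetric]) (simp add: case_prod_unfold)
  then show "(list_conv A B has_sum infsum A UNIV * infsum B UNIV) UNIV"
    by (rule has_sum_SigmaD) (auto simp: list_conv_def intro!: has_sum_finiteI)
  have "(\<lambda>(x, y). norm (A x * B y)) summable_on (UNIV \<times> UNIV)"
    by (rule has_sum_times_abs[OF A B])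
  then have "(\<lambda>(I, k). norm (A (take k I) * B (drop k I))) summable_on ?S"
    by (subst (asm) summable_on_reindex_bij_betw[OF bij_betw_list_splits, symmetric]) (simp add: case_prod_unfold)
  then have "((\<lambda>I. \<Sum>\<^sub>\<infinity>k\<in>{..length I}. norm (A (take k I) * B (drop k I)))) summable_on UNIV"
    by (auto dest!: summable_on_SigmaD)
  then have "((\<lambda>I. \<Sum>k\<in>{..length I}. norm (A (take k I) * B (drop k I)))) summable_on UNIV"
    by simp
  then show "ell1 (list_conv A B)"
    by (rule summable_on_comparison_test) (auto simp: list_conv_def intro!: sum_norm_le)
qed

text \<open>Words are formal products of oscillating terms. A sequence in \<open>n\<close> is
  represented by coefficients independent of \<open>n\<close>, so that products of sequences become
  convolutions of coefficients, and the shift of \<open>n\<close> becomes multiplication by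
  \<open>phase\<close> up to variations of the amplitudes.\<close>

locale word_eval =
  fixes \<phi> :: "'l \<Rightarrow> real" and \<gamma> :: "'l \<Rightarrow> nat \<Rightarrow> complex"
  assumes gamma_le1: "cmod (\<gamma> l n) \<le> 1"
begin

definition weight :: "nat \<Rightarrow> 'l list \<Rightarrow> complex" where
  "weight n I = prod_list (map (\<lambda>l. exp (- \<i> * of_nat n * of_real (\<phi> l)) * \<gamma> l n) I)"

text \<open>The factor that the oscillating part of \<open>weight n I\<close> acquires when
  \<open>n\<close> grows by 1.\<close>

definition phase :: "'l list \<Rightarrow> complex" where
  "phase I = exp (- \<i> * of_real (sum_list (map \<phi> I)))"

definition ev :: "nat \<Rightarrow> ('l list \<Rightarrow> complex) \<Rightarrow> complex" where
  "ev n A = (\<Sum>\<^sub>\<infinity>I. A I * weight n I)"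

lemma norm_phase [simp]: "cmod (phase I) = 1"
  unfolding phase_def by (simp add: norm_exp_eq_Re)

lemma weight_append: "weight n (I @ J) = weight n I * weight n J"
  by (simp add: weight_def)

lemma norm_weight: "cmod (weight n I) = prod_list (map (\<lambda>l. cmod (\<gamma> l n)) I)"
  by (induction I) (simp_all add: weight_def norm_mult norm_exp_eq_Re)

lemma norm_weight_le1: "cmod (weight n I) \<le> 1"
  unfolding norm_weight by (induction I) (auto intro!: mult_le_one gamma_le1 prod_list_nonneg)

lemma summable_weight:
  assumes "ell1 A"
  shows "(\<lambda>I. cmod (A I * weight n I)) summable_on UNIV"
  by (rule summable_on_comparison_test[OF assms]) (auto simp: norm_mult mult_left_le norm_weight_le1)

lemma ev_list_conv:
  assumes A: "ell1 A" and B: "ell1 B"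
  shows "ev n (list_conv A B) = ev n A * ev n B"
proof -
  have "list_conv (\<lambda>I. A I * weight n I) (\<lambda>I. B I * weight n I) I = list_conv A B I * weight n I" for I
  proof -
    have *: "weight n I = weight n (take k I) * weight n (drop k I)" for k
      by (simp flip: weight_append)
    show ?thesis
      unfolding list_conv_def sum_distrib_right by (intro sum.cong refl) (subst *, simp only: mult_ac)
  qed
  then have "list_conv (\<lambda>I. A I * weight n I) (\<lambda>I. B I * weight n I) = (\<lambda>I. list_conv A B I * weight n I)" ..
  with list_conv_has_sum(2)[OF summable_weight[OF A] summable_weight[OF B], of n n]
  have "((\<lambda>I. list_conv A B I * weight n I) has_sum ev n A * ev n B) UNIV"
    by (simp only: ev_def)
  then show ?thesis
    unfolding ev_def[of n "list_conv A B"] by (rule infsumI)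
qed

lemma ev_add:
  assumes A: "ell1 A" and B: "ell1 B"
  shows "ev n (\<lambda>I. A I + B I) = ev n A + ev n B"
  unfolding ev_def distrib_right
  by (rule infsum_add[OF abs_summable_summable[OF summable_weight[OF A]] abs_summable_summable[OF summable_weight[OF B]]])

lemma ev_cmult: "ev n (\<lambda>I. c * A I) = c * ev n A"
  unfolding ev_def by (simp add: mult.assoc infsum_cmult_right')

lemma ev_diff:
  assumes A: "ell1 A" and B: "ell1 B"
  shows "ev n (\<lambda>I. A I - B I) = ev n A - ev n B"
proof -
  have "ev n (\<lambda>I. A I + (-1) * B I) = ev n A + ev n (\<lambda>I. (-1) * B I)"
    by (rule ev_add) (use A B in \<open>simp_all add: norm_mult\<close>)
  then show ?thesis unfolding ev_cmult by simp
qed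

lemma norm_ev_le:
  assumes A: "ell1 A" and le: "\<And>I. A I \<noteq> 0 \<Longrightarrow> cmod (weight n I) \<le> c"
  shows "cmod (ev n A) \<le> (\<Sum>\<^sub>\<infinity>I. cmod (A I)) * c"
proof -
  have "cmod (ev n A) \<le> (\<Sum>\<^sub>\<infinity>I. cmod (A I) * c)"
    unfolding ev_def
  proof (rule order_trans[OF norm_infsum_bound])
    show "(\<lambda>I. cmod (A I * weight n I)) summable_on UNIV" by (rule summable_weight[OF A])
    show "(\<Sum>\<^sub>\<infinity>I. cmod (A I * weight n I)) \<le> (\<Sum>\<^sub>\<infinity>I. cmod (A I) * c)"
      by (intro infsum_mono summable_weight A summable_on_cmult_left)
         (metis le mult_left_mono norm_ge_zero norm_mult norm_zero mult_zero_left order_refl)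
  qed
  then show ?thesis by (simp add: infsum_cmult_left')
qed

text \<open>The amplitudes are exchanged one letter at a time, and all other factors have modulus at
  most 1. Summed over \<open>n\<close>, the right-hand side is at most the length of
  \<open>I\<close> times the variation bound.\<close>

lemma weight_Suc_diff:
  "cmod (weight (Suc n) I - phase I * weight n I) \<le> (\<Sum>l\<leftarrow>I. cmod (\<gamma> l (Suc n) - \<gamma> l n))"
proof (induction I)
  case Nil
  show ?case by (simp add: weight_def phase_def)
next
  case (Cons l I)
  define e where "e = exp (- \<i> * of_nat n * of_real (\<phi> l))"
  define h where "h = exp (- \<i> * of_real (\<phi> l))"
  have e: "cmod e = 1" "cmod h = 1" by (auto simp: e_def h_def norm_exp_eq_Re)
  have w1: "weight (Suc n) (l # I) = h * e * \<gamma> l (Suc n) * weight (Suc n) I"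
    by (simp add: weight_def e_def h_def exp_add[symmetric] algebra_simps)
  have w0: "phase (l # I) * weight n (l # I) = h * e * \<gamma> l n * (phase I * weight n I)"
    by (simp add: weight_def phase_def e_def h_def exp_add[symmetric] algebra_simps)
  have "weight (Suc n) (l # I) - phase (l # I) * weight n (l # I)
      = h * e * (\<gamma> l (Suc n) - \<gamma> l n) * weight (Suc n) I
      + h * e * \<gamma> l n * (weight (Suc n) I - phase I * weight n I)"
    unfolding w1 w0 by (simp add: algebra_simps)
  also have "cmod \<dots> \<le> cmod (\<gamma> l (Suc n) - \<gamma> l n) * cmod (weight (Suc n) I)
       + cmod (\<gamma> l n) * cmod (weight (Suc n) I - phase I * weight n I)"
    by (rule order_trans[OF norm_triangle_ineq]) (simp add: norm_mult e)
  also have "\<dots> \<le> cmod (\<gamma> l (Suc n) - \<gamma> l n) * 1 + 1 * cmod (weight (Suc n) I - phase I * weight n I)"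
    by (intro add_mono mult_left_mono mult_right_mono norm_weight_le1 gamma_le1) auto
  finally show ?case using Cons by simp
qed

end

lemma has_sum_finite_sum:
  fixes f :: "'i \<Rightarrow> 'a \<Rightarrow> 'b::{topological_comm_monoid_add}"
  assumes "\<And>i. i \<in> F \<Longrightarrow> (f i has_sum s i) A"
  shows "((\<lambda>x. \<Sum>i\<in>F. f i x) has_sum (\<Sum>i\<in>F. s i)) A"
  using assms by (induction F rule: infinite_finite_induct) (auto intro: has_sum_add)

lemma norm_summable_diff:
  fixes f g :: "'b \<Rightarrow> complex"
  assumes "(\<lambda>x. cmod (f x)) summable_on A" "(\<lambda>x. cmod (g x)) summable_on A"
  shows "(\<lambda>x. cmod (f x - g x)) summable_on A"
  by (rule summable_on_comparison_test[OF summable_on_add[OF assms]]) (auto intro: norm_triangle_ineq4)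

lemma norm_summable_cmult:
  fixes f :: "'b \<Rightarrow> complex"
  assumes "(\<lambda>x. cmod (f x)) summable_on A"
  shows "(\<lambda>x. cmod (c * f x)) summable_on A"
  unfolding norm_mult by (rule summable_on_cmult_right[OF assms])

section \<open>An approximate solution of the Riccati equation\<close>

text \<open>The equation to be solved is w(n+1) - \<open>\<omega>\<close> w(n) =
  \<open>\<nu>\<close> (Q + P w(n) - Q w(n+1) - P w(n) w(n+1)), where P and Q are series over single
  letters with coefficients \<open>pc\<close> and \<open>qc\<close>. In the application
  \<open>\<omega>\<close> = exp(-2i\<eta>), \<open>\<nu>\<close> = exp(-i\<eta>), \<open>d\<close> =
  p, and Q is the conjugate of P.\<close>

locale riccati_words = word_eval \<phi> \<gamma>
  for \<phi> :: "'l \<Rightarrow> real" and \<gamma> :: "'l \<Rightarrow> nat \<Rightarrow> complex" +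
  fixes pc qc :: "'l \<Rightarrow> complex" and \<kappa> :: "'l \<Rightarrow> real" and \<omega> \<nu> :: complex
    and d :: nat and g :: "nat \<Rightarrow> real" and V :: real
  assumes pc_le: "cmod (pc l) \<le> \<kappa> l" and qc_le: "cmod (qc l) \<le> \<kappa> l"
    and kappa_summable: "\<kappa> summable_on UNIV"
    and omega: "cmod \<omega> = 1" and nu: "cmod \<nu> = 1" and d_pos: "d \<ge> 1"
    and gamma_le: "cmod (\<gamma> l n) \<le> g n" and g_le1: "g n \<le> 1"
    and g_summable: "summable (\<lambda>n. g n ^ d)"
    and gamma_var: "(\<Sum>n<N. cmod (\<gamma> l (Suc n) - \<gamma> l n)) \<le> V"
    and nonresonant: "phase J \<noteq> \<omega>"
    and small_divisors: "i \<ge> 1 \<Longrightarrow> i < d \<Longrightarrow>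
      (\<lambda>J. prod_list (map \<kappa> J) / cmod (phase J - \<omega>) ^ (d - 1)) summable_on {J. length J = i}"
begin

definition kap :: "'l list \<Rightarrow> real" where "kap J = prod_list (map \<kappa> J)"
definition dvs :: "'l list \<Rightarrow> real" where "dvs J = cmod (phase J - \<omega>)"
text \<open>The worst inverse small divisor among contiguous subwords. The floor 1 allows its
  exponent to be raised to \<open>d - 1\<close>.\<close>

definition mdv :: "'l list \<Rightarrow> real" where "mdv I = Max (insert 1 ((\<lambda>J. 1 / dvs J) ` {J. sublist J I}))"

definition letter_fun :: "('l \<Rightarrow> complex) \<Rightarrow> 'l list \<Rightarrow> complex" where
  "letter_fun f I = (case I of [l] \<Rightarrow> f l | _ \<Rightarrow> 0)"

text \<open>The coefficients of the formal solution of the Riccati equation: the factor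
  \<open>phase I - \<omega>\<close> inverts the linear part on the word \<open>I\<close>. They are cut off at words
  of length \<open>d\<close>, because a product of \<open>d\<close> amplitudes is summable in \<open>n\<close>.\<close>

fun W :: "'l list \<Rightarrow> complex" where
  "W [] = 0"
| "W (l # I) = \<nu> / (phase (l # I) - \<omega>) * ((if I = [] then qc l else 0) + pc l * W I
     - qc l * (phase I * W I)
     - pc l * (\<Sum>k\<le>length I. W (take k I) * (phase (drop k I) * W (drop k I))))"

definition Wt :: "'l list \<Rightarrow> complex" where "Wt I = (if length I < d then W I else 0)"
text \<open>Coefficients of the predicted value at \<open>n + 1\<close>: the phases advance and the
  amplitudes stay frozen.\<close>

definition PW :: "'l list \<Rightarrow> complex" where "PW I = phase I * Wt I"

lemma kappa_nonneg: "0 \<le> \<kappa> l"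
  by (rule order_trans[OF norm_ge_zero pc_le])

lemma kap_nonneg: "0 \<le> kap J"
  unfolding kap_def by (induction J) (auto simp: kappa_nonneg)

lemma kap_simps [simp]: "kap [] = 1" "kap (l # J) = \<kappa> l * kap J" "kap (I @ J) = kap I * kap J"
  by (simp_all add: kap_def)

lemma dvs_pos: "0 < dvs J"
  using nonresonant[of J] by (simp add: dvs_def)

lemma dvs_le2: "dvs J \<le> 2"
  unfolding dvs_def using norm_triangle_ineq4[of "phase J" \<omega>] by (simp add: omega)

lemma finite_sublists: "finite {J. sublist J I}"
  by (metis List.finite_set set_sublists_eq)

lemma mdv_ge1: "1 \<le> mdv I"
  unfolding mdv_def by (rule Max_ge) (auto simp: finite_sublists)

lemma mdv_ge: "sublist J I \<Longrightarrow> 1 / dvs J \<le> mdv I"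
  unfolding mdv_def by (rule Max_ge) (auto simp: finite_sublists)

lemma mdv_mono: "sublist J I \<Longrightarrow> mdv J \<le> mdv I"
  unfolding mdv_def by (rule Max_mono) (auto simp: finite_sublists intro: sublist_order.order.trans)

lemma letter_fun_summable:
  assumes "\<And>l. cmod (f l) \<le> \<kappa> l"
  shows "ell1 (letter_fun f)"
proof -
  have "(\<lambda>l. cmod (f l)) summable_on UNIV"
    by (rule summable_on_comparison_test[OF kappa_summable]) (auto simp: assms)
  then have "(\<lambda>I. cmod (letter_fun f I)) summable_on range (\<lambda>l. [l])"
    by (subst summable_on_reindex) (auto simp: inj_on_def o_def letter_fun_def)
  then show ?thesis
    by (rule summable_on_cong_neutral[THEN iffD1, rotated -1]) (auto simp: letter_fun_def split: list.splits)
qed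

lemma list_conv_letter_fun [simp]:
  "list_conv (letter_fun f) A [] = 0" "list_conv (letter_fun f) A (l # I) = f l * A I"
proof -
  show "list_conv (letter_fun f) A [] = 0" by (simp add: list_conv_def letter_fun_def)
  have "list_conv (letter_fun f) A (l # I) = (\<Sum>k\<in>{1}. letter_fun f (take k (l # I)) * A (drop k (l # I)))"
    unfolding list_conv_def
  proof (rule sum.mono_neutral_right)
    show "\<forall>k\<in>{..length (l # I)} - {1}. letter_fun f (take k (l # I)) * A (drop k (l # I)) = 0"
    proof
      fix k assume k: "k \<in> {..length (l # I)} - {1}"
      then have "length (take k (l # I)) \<noteq> 1" by auto
      then have "letter_fun f (take k (l # I)) = 0"
        unfolding letter_fun_def by (cases "take k (l # I)" rule: remdups_adj.cases) auto
      then show "letter_fun f (take k (l # I)) * A (drop k (l # I)) = 0" by simp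
    qed
  qed auto
  then show "list_conv (letter_fun f) A (l # I) = f l * A I" by (simp add: letter_fun_def)
qed

text \<open>Every term on the right-hand side of the Riccati equation, the quadratic one included, carries
  one factor \<open>pc\<close> or \<open>qc\<close>; hence a word of length \<open>j\<close> acquires only \<open>j\<close> small divisors. This
  is what produces the exponent \<open>p - 1\<close> in the dimension bound.\<close>

lemma W_bound: "\<exists>C\<ge>0. \<forall>I. length I \<le> j \<longrightarrow> cmod (W I) \<le> C * kap I * mdv I ^ length I"
proof (induction j)
  case 0
  show ?case by (rule exI[of _ 0]) simp
next
  case (Suc j)
  then obtain C where C: "C \<ge> 0" "\<And>I. length I \<le> j \<Longrightarrow> cmod (W I) \<le> C * kap I * mdv I ^ length I" by blast
  \<comment> \<open>The bracket collects the contributions to a word: 1 for the inhomogeneous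
    letter, \<open>2 * C\<close> for the two linear terms, and \<open>C\<^sup>2\<close> for each of
    the at most \<open>j + 1\<close> splittings in the quadratic term.\<close>
  define C' where "C' = C + (1 + 2 * C + (real j + 1) * C\<^sup>2)"
  have C'C: "C \<le> C'" "1 + 2 * C + (real j + 1) * C\<^sup>2 \<le> C'" using C(1) by (auto simp: C'_def)
  have "cmod (W I) \<le> C' * kap I * mdv I ^ length I" if len: "length I \<le> Suc j" for I
  proof (cases I)
    case Nil
    then show ?thesis using C(1) C'C(1) mdv_ge1[of "[]"] by simp
  next
    case (Cons l J)
    have lJ: "length J \<le> j" using len Cons by simp
    define M where "M = mdv I"
    have M1: "1 \<le> M" by (simp add: M_def mdv_ge1)
    have sJ: "sublist J I" using Cons by (simp add: sublist_Cons_right)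
    have WJ: "cmod (W J) \<le> C * kap J * M ^ length J"
      by (rule order_trans[OF C(2)[OF lJ]])
         (intro mult_left_mono power_mono, use mdv_mono[OF sJ] mdv_ge1[of J] C(1) kap_nonneg[of J] in \<open>auto simp: M_def\<close>)
    define T where "T k = W (take k J) * (phase (drop k J) * W (drop k J))" for k
    have WW: "cmod (T k) \<le> C\<^sup>2 * kap J * M ^ length J" for k
    proof -
      have s1: "sublist (take k J) I" "sublist (drop k J) I"
        using sJ by (auto intro: sublist_order.order.trans[OF _ sJ] sublist_take sublist_drop)
      have 1: "cmod (W (take k J)) \<le> C * kap (take k J) * M ^ length (take k J)"
        by (rule order_trans[OF C(2)], use lJ in simp)
           (intro mult_left_mono power_mono, use mdv_mono[OF s1(1)] mdv_ge1[of "take k J"] C(1) kap_nonneg in \<open>auto simp: M_def\<close>)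
      have 2: "cmod (W (drop k J)) \<le> C * kap (drop k J) * M ^ length (drop k J)"
        by (rule order_trans[OF C(2)], use lJ in simp)
           (intro mult_left_mono power_mono, use mdv_mono[OF s1(2)] mdv_ge1[of "drop k J"] C(1) kap_nonneg in \<open>auto simp: M_def\<close>)
      have "cmod (T k) = cmod (W (take k J)) * cmod (W (drop k J))"
        by (simp add: T_def norm_mult)
      also have "\<dots> \<le> (C * kap (take k J) * M ^ length (take k J)) * (C * kap (drop k J) * M ^ length (drop k J))"
        by (intro mult_mono 1 2) (use C(1) kap_nonneg M1 in auto)
      also have "\<dots> = C\<^sup>2 * (kap (take k J @ drop k J)) * M ^ (length (take k J @ drop k J))"
        by (simp only: kap_simps length_append power_add power2_eq_square mult_ac)
      finally show ?thesis by simp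
    qed
    define Y where "Y = (if J = [] then qc l else 0) + pc l * W J - qc l * (phase J * W J)
       - pc l * (\<Sum>k\<le>length J. T k)"
    define Z where "Z = kap J * M ^ length J"
    have Z0: "0 \<le> Z" using kap_nonneg M1 by (simp add: Z_def)
    have Y1: "cmod (if J = [] then qc l else 0) \<le> \<kappa> l * Z"
      using qc_le[of l] kappa_nonneg[of l] Z0 by (auto simp: Z_def)
    have WJ': "cmod (W J) \<le> C * Z" using WJ by (simp add: Z_def mult_ac)
    have Y2: "cmod (pc l * W J) \<le> \<kappa> l * (C * Z)"
      unfolding norm_mult by (rule mult_mono[OF pc_le WJ' kappa_nonneg]) simp
    have Y3: "cmod (qc l * (phase J * W J)) \<le> \<kappa> l * (C * Z)"
      unfolding norm_mult norm_phase mult_1_left by (rule mult_mono[OF qc_le WJ' kappa_nonneg]) simp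
    have "cmod (\<Sum>k\<le>length J. T k) \<le> (\<Sum>k\<le>length J. C\<^sup>2 * kap J * M ^ length J)"
      by (intro sum_norm_le WW)
    also have "\<dots> = (real (length J) + 1) * (C\<^sup>2 * Z)" by (simp add: Z_def mult_ac add_ac)
    also have "\<dots> \<le> (real j + 1) * (C\<^sup>2 * Z)" using lJ Z0 by (intro mult_right_mono) auto
    finally have Y4: "cmod (pc l * (\<Sum>k\<le>length J. T k)) \<le> \<kappa> l * ((real j + 1) * (C\<^sup>2 * Z))"
      unfolding norm_mult by (rule mult_mono[OF pc_le _ kappa_nonneg]) simp_all
    have "cmod Y \<le> \<kappa> l * Z + \<kappa> l * (C * Z) + \<kappa> l * (C * Z) + \<kappa> l * ((real j + 1) * (C\<^sup>2 * Z))"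
      unfolding Y_def
      by (rule order_trans[OF norm_triangle_ineq4 add_mono[OF order_trans[OF norm_triangle_ineq4
           add_mono[OF order_trans[OF norm_triangle_ineq add_mono[OF Y1 Y2]] Y3]] Y4]])
    also have "\<dots> = (1 + 2 * C + (real j + 1) * C\<^sup>2) * kap I * M ^ length J"
      by (simp add: Cons Z_def algebra_simps)
    also have "\<dots> \<le> C' * kap I * M ^ length J"
      by (intro mult_right_mono C'C) (use kap_nonneg M1 in auto)
    finally have Yle: "cmod Y \<le> C' * kap I * M ^ length J" .
    have "W I = \<nu> / (phase I - \<omega>) * Y" by (simp add: Cons Y_def T_def)
    then have "cmod (W I) = (1 / dvs I) * cmod Y"
      by (simp add: norm_mult norm_divide nu dvs_def)
    also have "\<dots> \<le> M * (C' * kap I * M ^ length J)"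
      by (intro mult_mono Yle) (use mdv_ge[of I I] M1 in \<open>auto simp: M_def\<close>)
    finally show ?thesis by (simp add: Cons M_def mult_ac)
  qed
  then show ?case using C'C(1) C(1) by (intro exI[of _ C']) auto
qed

definition Gf :: "'l list \<Rightarrow> real" where "Gf J = (if length J < d then kap J / dvs J ^ (d - 1) else 0)"
definition Kf :: "'l list \<Rightarrow> real" where "Kf J = (if length J < d then kap J else 0)"

lemma Gf_summable: "Gf summable_on UNIV"
proof -
  have "Gf summable_on {J. length J < m}" if "m \<le> d" for m
    using that
  proof (induction m)
    case (Suc m)
    have "Gf summable_on {J. length J = m}"
    proof (cases "m = 0")
      case False
      then show ?thesis using small_divisors[of m] Suc.prems
        by (subst summable_on_cong[where g = "\<lambda>J. kap J / dvs J ^ (d - 1)"]) (auto simp: Gf_def kap_def dvs_def)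
    qed auto
    moreover have "{J :: 'l list. length J < Suc m} = {J. length J < m} \<union> {J. length J = m}" by auto
    ultimately show ?case using Suc by (auto intro: summable_on_union)
  qed simp
  from this[of d] show ?thesis
    by (rule summable_on_cong_neutral[THEN iffD1, rotated -1]) (auto simp: Gf_def)
qed

lemma Gf_nonneg: "0 \<le> Gf J" and Kf_nonneg: "0 \<le> Kf J"
  using kap_nonneg[of J] dvs_pos[of J] by (auto simp: Gf_def Kf_def)

lemma Kf_summable: "Kf summable_on UNIV"
proof (rule summable_on_comparison_test)
  show "(\<lambda>J. 2 ^ (d - 1) * Gf J) summable_on UNIV" by (intro summable_on_cmult_right Gf_summable)
  show "Kf J \<le> 2 ^ (d - 1) * Gf J" for J
  proof -
    have "kap J * dvs J ^ (d - 1) \<le> kap J * 2 ^ (d - 1)"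
      using dvs_pos[of J] dvs_le2[of J] by (intro mult_left_mono power_mono kap_nonneg) auto
    then show ?thesis using dvs_pos[of J] by (auto simp: Kf_def Gf_def field_simps)
  qed
qed (rule Kf_nonneg)

text \<open>By \<open>W_bound\<close> a word shorter than \<open>d\<close> costs at most
  \<open>d - 1\<close> small divisors, all bounded by the worst one, which sits at a contiguous
  subword \<open>J\<close> of \<open>I = X @ J @ Y\<close>. As \<open>kap\<close> is multiplicative,
  the sum over all such decompositions is a convolution of the three summable families
  \<open>Kf\<close>, \<open>Gf\<close>, \<open>Kf\<close>. Thus a condition on single words controls
  all products of divisors.\<close>

lemma Wt_summable: "ell1 Wt"
proof -
  obtain C where C: "C \<ge> 0" "\<And>I. length I \<le> d \<Longrightarrow> cmod (W I) \<le> C * kap I * mdv I ^ length I"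
    using W_bound by blast
  define B where "B = list_conv Kf (list_conv Gf Kf)"
  have GK: "ell1 (list_conv Gf Kf)"
    using list_conv_has_sum(1)[of Gf Kf] Gf_summable Kf_summable by (simp add: Gf_nonneg Kf_nonneg)
  have B: "ell1 B"
    unfolding B_def by (rule list_conv_has_sum(1)[OF _ GK]) (use Kf_summable in \<open>simp add: Kf_nonneg\<close>)
  have conv_nonneg: "0 \<le> list_conv Gf Kf I" for I
    unfolding list_conv_def by (intro sum_nonneg mult_nonneg_nonneg Gf_nonneg Kf_nonneg)
  have B_nonneg: "0 \<le> B I" for I
    unfolding B_def list_conv_def[of Kf] by (intro sum_nonneg mult_nonneg_nonneg conv_nonneg Kf_nonneg)
  have key: "kap I * mdv I ^ (d - 1) \<le> Kf I + B I" if len: "length I < d" for I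
  proof -
    have "mdv I \<in> insert 1 ((\<lambda>J. 1 / dvs J) ` {J. sublist J I})"
      unfolding mdv_def by (rule Max_in) (auto simp: finite_sublists)
    then consider "mdv I = 1" | J where "sublist J I" "mdv I = 1 / dvs J" by auto
    then show ?thesis
    proof cases
      case 1
      then show ?thesis using len B_nonneg[of I] by (simp add: Kf_def)
    next
      case 2
      then obtain X Y where I: "I = X @ J @ Y" by (auto simp: sublist_def)
      have "Gf J * Kf Y \<le> list_conv Gf Kf (J @ Y)"
        unfolding list_conv_def
        using member_le_sum[of "length J" "{..length (J @ Y)}" "\<lambda>k. Gf (take k (J @ Y)) * Kf (drop k (J @ Y))"]
        by (simp add: Gf_nonneg Kf_nonneg)
      then have "Kf X * (Gf J * Kf Y) \<le> Kf X * list_conv Gf Kf (J @ Y)"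
        by (intro mult_left_mono Kf_nonneg)
      also have "\<dots> \<le> B I"
        unfolding B_def list_conv_def[of Kf] I
        using member_le_sum[of "length X" "{..length (X @ J @ Y)}" "\<lambda>k. Kf (take k (X @ J @ Y)) * list_conv Gf Kf (drop k (X @ J @ Y))"]
        by (simp add: conv_nonneg Kf_nonneg)
      finally have "Kf X * (Gf J * Kf Y) \<le> B I" .
      moreover have "Kf X * (Gf J * Kf Y) = kap I * mdv I ^ (d - 1)"
        using len by (simp add: 2[unfolded I] I Kf_def Gf_def power_one_over)
      ultimately show ?thesis using Kf_nonneg[of I] by simp
    qed
  qed
  show ?thesis
  proof (rule summable_on_comparison_test)
    show "(\<lambda>I. C * (Kf I + B I)) summable_on UNIV"
      using B by (intro summable_on_cmult_right summable_on_add Kf_summable) (simp add: B_nonneg)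
    show "cmod (Wt I) \<le> C * (Kf I + B I)" for I
    proof (cases "length I < d")
      case True
      have "cmod (W I) \<le> C * kap I * mdv I ^ length I" using C(2)[of I] True by simp
      also have "\<dots> \<le> C * kap I * mdv I ^ (d - 1)"
        using True C(1) kap_nonneg[of I] mdv_ge1[of I] by (intro mult_left_mono power_increasing) auto
      also have "\<dots> \<le> C * (Kf I + B I)"
        using mult_left_mono[OF key[OF True] C(1)] by (simp add: mult_ac)
      finally show ?thesis using True by (simp add: Wt_def)
    next
      case False
      then show ?thesis using C(1) B_nonneg[of I] Kf_nonneg[of I] by (simp add: Wt_def)
    qed
  qed simp
qed

lemma PW_summable: "ell1 PW"
  using Wt_summable by (simp add: PW_def norm_mult)

text \<open>The Riccati equation on the level of coefficients, with \<open>PW\<close> in place of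
  the shifted solution.\<close>

definition resid :: "'l list \<Rightarrow> complex" where
  "resid I = ((PW I - \<omega> * Wt I) - \<nu> * letter_fun qc I) - \<nu> * (list_conv (letter_fun pc) Wt I
     - list_conv (letter_fun qc) PW I - list_conv (letter_fun pc) (list_conv Wt PW) I)"

text \<open>The recursion for \<open>W\<close> solves the equation word by word, and the coefficient
  at a word below the cutoff involves only its subwords, which are below the cutoff as well.\<close>

lemma resid_eq_0:
  assumes "length I < d" shows "resid I = 0"
proof (cases I)
  case Nil
  then show ?thesis by (simp add: resid_def PW_def Wt_def letter_fun_def)
next
  case (Cons l J)
  have Wt: "Wt J = W J" "Wt (take k J) = W (take k J)" "Wt (drop k J) = W (drop k J)" "Wt I = W I" for k
    using assms Cons by (auto simp: Wt_def)
  have "phase (l # J) - \<omega> \<noteq> 0" using nonresonant by simp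
  then have *: "(phase (l # J) - \<omega>) * W (l # J) = \<nu> * ((if J = [] then qc l else 0) + pc l * W J
     - qc l * (phase J * W J)
     - pc l * (\<Sum>k\<le>length J. W (take k J) * (phase (drop k J) * W (drop k J))))"
    by simp
  have lf: "letter_fun qc (l # J) = (if J = [] then qc l else 0)"
    by (simp add: letter_fun_def split: list.split)
  have cv: "list_conv Wt PW J = (\<Sum>k\<le>length J. W (take k J) * (phase (drop k J) * W (drop k J)))"
    by (simp only: list_conv_def PW_def Wt)
  have ring: "(a * w - o' * w) - n * q - n * (x - y - z) = (a - o') * w - n * (q + x - y - z)"
    for a w o' n q x y z :: complex by (simp add: algebra_simps)
  have "resid I = (phase (l # J) - \<omega>) * W (l # J) - \<nu> * ((if J = [] then qc l else 0) + pc l * W J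
     - qc l * (phase J * W J)
     - pc l * (\<Sum>k\<le>length J. W (take k J) * (phase (drop k J) * W (drop k J))))"
    unfolding resid_def Cons list_conv_letter_fun lf cv
    unfolding PW_def Wt(1) Wt(4)[unfolded Cons] by (rule ring)
  then show ?thesis using * by simp
qed

lemmas summables = letter_fun_summable[OF pc_le] letter_fun_summable[OF qc_le] Wt_summable PW_summable
  list_conv_has_sum(1)[OF letter_fun_summable[OF pc_le] Wt_summable]
  list_conv_has_sum(1)[OF letter_fun_summable[OF qc_le] PW_summable]
  list_conv_has_sum(1)[OF letter_fun_summable[OF pc_le] list_conv_has_sum(1)[OF Wt_summable PW_summable]]
  list_conv_has_sum(1)[OF Wt_summable PW_summable]

definition Pn :: "nat \<Rightarrow> complex" where "Pn n = ev n (letter_fun pc)"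
definition Qn :: "nat \<Rightarrow> complex" where "Qn n = ev n (letter_fun qc)"
definition wn :: "nat \<Rightarrow> complex" where "wn n = ev n Wt"
definition whn :: "nat \<Rightarrow> complex" where "whn n = ev n PW"

lemma ev_resid:
  "ev n resid = whn n - \<omega> * wn n - \<nu> * (Qn n + Pn n * wn n - Qn n * whn n - Pn n * (wn n * whn n))"
proof -
  note s = summables
  have "ev n resid = ((ev n PW - \<omega> * ev n Wt) - \<nu> * ev n (letter_fun qc)) - \<nu> * (ev n (letter_fun pc) * ev n Wt
     - ev n (letter_fun qc) * ev n PW - ev n (letter_fun pc) * (ev n Wt * ev n PW))"
    unfolding resid_def
    by (simp only: ev_diff ev_cmult ev_list_conv norm_summable_diff norm_summable_cmult s)
  then show ?thesis by (simp add: Pn_def Qn_def wn_def whn_def algebra_simps)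
qed

lemma resid_summable: "ell1 resid"
  unfolding resid_def by (intro norm_summable_diff norm_summable_cmult summables)

lemma g_nonneg: "0 \<le> g n"
  by (rule order_trans[OF norm_ge_zero gamma_le[of undefined]])

lemma norm_weight_le: 
  assumes "m \<le> length I" shows "cmod (weight n I) \<le> g n ^ m"
proof -
  have "cmod (weight n I) \<le> g n ^ length I"
    unfolding norm_weight
    by (induction I) (auto intro!: mult_mono gamma_le g_nonneg prod_list_nonneg)
  also have "\<dots> \<le> g n ^ m" using assms g_nonneg g_le1 by (intro power_decreasing) auto
  finally show ?thesis .
qed

lemma wn_le: "cmod (wn n) \<le> (\<Sum>\<^sub>\<infinity>I. cmod (Wt I)) * g n"
  unfolding wn_def
proof (rule norm_ev_le[OF Wt_summable])
  fix I assume "Wt I \<noteq> 0"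
  then have "1 \<le> length I" by (cases I) (auto simp: Wt_def split: if_splits)
  then show "cmod (weight n I) \<le> g n" using norm_weight_le[of 1 I n] by simp
qed

lemma norm_ev_resid: "cmod (ev n resid) \<le> (\<Sum>\<^sub>\<infinity>I. cmod (resid I)) * g n ^ d"
proof (rule norm_ev_le[OF resid_summable])
  fix I assume "resid I \<noteq> 0"
  then have "d \<le> length I" using resid_eq_0[of I] not_le_imp_less by blast
  then show "cmod (weight n I) \<le> g n ^ d" by (rule norm_weight_le)
qed

lemma norm_ev_le1:
  assumes "ell1 A" shows "cmod (ev n A) \<le> (\<Sum>\<^sub>\<infinity>I. cmod (A I))"
  using norm_ev_le[OF assms, of n 1] norm_weight_le1 by simp

text \<open>The error of the prediction \<open>whn\<close>. For a fixed word its sum over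
  \<open>n\<close> is at most \<open>d * V\<close>, uniformly in the word, so the summability of
  \<open>Wt\<close> permits the exchange of the two sums.\<close>

lemma wn_Suc_summable: "summable (\<lambda>n. cmod (wn (Suc n) - whn n))"
proof (rule summableI_nonneg_bounded)
  define D where "D n I = cmod (Wt I) * cmod (weight (Suc n) I - phase I * weight n I)" for n I
  have V0: "0 \<le> V" using gamma_var[of _ 0] by simp
  have le: "cmod (Wt I) * (\<Sum>n<N. cmod (weight (Suc n) I - phase I * weight n I)) \<le> cmod (Wt I) * (d * V)" for I N
  proof (cases "Wt I = 0")
    case False
    then have len: "length I < d" by (auto simp: Wt_def split: if_splits)
    have "(\<Sum>n<N. cmod (weight (Suc n) I - phase I * weight n I)) \<le> (\<Sum>n<N. \<Sum>l\<leftarrow>I. cmod (\<gamma> l (Suc n) - \<gamma> l n))"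
      by (intro sum_mono weight_Suc_diff)
    also have "\<dots> = (\<Sum>l\<leftarrow>I. \<Sum>n<N. cmod (\<gamma> l (Suc n) - \<gamma> l n))"
      by (induction I) (simp_all add: sum.distrib)
    also have "\<dots> \<le> (\<Sum>l\<leftarrow>I. V)" by (intro sum_list_mono gamma_var)
    also have "\<dots> = length I * V" by (simp add: sum_list_triv)
    also have "\<dots> \<le> d * V" using len V0 by (intro mult_right_mono) auto
    finally show ?thesis by (intro mult_left_mono) auto
  qed simp
  have Dle: "D n I \<le> cmod (Wt I) * (d * V)" for n I
  proof -
    have "D n I \<le> cmod (Wt I) * (\<Sum>m<Suc n. cmod (weight (Suc m) I - phase I * weight m I))"
      unfolding D_def by (intro mult_left_mono) (simp_all add: sum_nonneg)
    then show ?thesis using le[of I "Suc n"] by linarith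
  qed
  have Ds: "D n summable_on UNIV" for n
    by (rule summable_on_comparison_test[OF summable_on_cmult_left[OF Wt_summable]]) (use Dle in \<open>auto simp: D_def\<close>)
  have wd: "cmod (wn (Suc n) - whn n) \<le> infsum (D n) UNIV" for n
  proof -
    have "wn (Suc n) - whn n = (\<Sum>\<^sub>\<infinity>I. Wt I * (weight (Suc n) I - phase I * weight n I))"
    proof -
      have "wn (Suc n) + (-1) * whn n = (\<Sum>\<^sub>\<infinity>I. Wt I * weight (Suc n) I + (-1) * (PW I * weight n I))"
        unfolding wn_def whn_def ev_def infsum_cmult_right'[symmetric]
        by (rule infsum_add[symmetric])
           (intro abs_summable_summable[OF summable_weight[OF Wt_summable]] summable_on_cmult_right abs_summable_summable[OF summable_weight[OF PW_summable]])+
      also have "\<dots> = (\<Sum>\<^sub>\<infinity>I. Wt I * (weight (Suc n) I - phase I * weight n I))"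
        by (intro infsum_cong) (simp add: PW_def algebra_simps)
      finally show ?thesis by simp
    qed
    also have "cmod \<dots> \<le> infsum (D n) UNIV"
      using norm_infsum_bound[of "\<lambda>I. Wt I * (weight (Suc n) I - phase I * weight n I)" UNIV] Ds[of n]
      by (simp add: norm_mult D_def[abs_def])
    finally show ?thesis .
  qed
  show "(\<Sum>n<N. cmod (wn (Suc n) - whn n)) \<le> (\<Sum>\<^sub>\<infinity>I. cmod (Wt I) * (d * V))" for N
  proof -
    have "(\<Sum>n<N. cmod (wn (Suc n) - whn n)) \<le> (\<Sum>n<N. infsum (D n) UNIV)" by (intro sum_mono wd)
    also have "\<dots> = (\<Sum>\<^sub>\<infinity>I. \<Sum>n<N. D n I)" 
      by (rule infsumI[symmetric], rule has_sum_finite_sum) (use Ds in simp)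
    also have "\<dots> \<le> (\<Sum>\<^sub>\<infinity>I. cmod (Wt I) * (d * V))"
      by (intro infsum_mono summable_on_cmult_left Wt_summable has_sum_imp_summable[OF has_sum_finite_sum[OF has_sum_infsum[OF Ds]]])
         (use le in \<open>auto simp: D_def sum_distrib_left\<close>)
    finally show ?thesis .
  qed
qed auto

text \<open>The residual has two sources. The discarded words contribute \<open>g n ^ d\<close>.
  Replacing the prediction \<open>whn n\<close> by the true value \<open>wn (Suc n)\<close>
  contributes their difference times a bounded factor, because the equation is affine in the shifted
  unknown.\<close>

lemma approximate_riccati:
  obtains w where "w \<longlonglongrightarrow> 0"
    and "summable (\<lambda>n. cmod (w (Suc n) - \<omega> * w n
           - \<nu> * (Qn n + Pn n * w n - Qn n * w (Suc n) - Pn n * w n * w (Suc n))))"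
proof
  define R where "R n = wn (Suc n) - \<omega> * wn n - \<nu> * (Qn n + Pn n * wn n - Qn n * wn (Suc n) - Pn n * wn n * wn (Suc n))" for n
  define Kp Kq Kw Kr where "Kp = (\<Sum>\<^sub>\<infinity>I. cmod (letter_fun pc I))" and "Kq = (\<Sum>\<^sub>\<infinity>I. cmod (letter_fun qc I))"
    and "Kw = (\<Sum>\<^sub>\<infinity>I. cmod (Wt I))" and "Kr = (\<Sum>\<^sub>\<infinity>I. cmod (resid I))"
  have P: "cmod (Pn n) \<le> Kp" and Q: "cmod (Qn n) \<le> Kq" and w: "cmod (wn n) \<le> Kw" for n
    unfolding Pn_def Qn_def wn_def Kp_def Kq_def Kw_def by (intro norm_ev_le1 summables)+
  have K0: "0 \<le> Kp" "0 \<le> Kq" "0 \<le> Kw" unfolding Kp_def Kq_def Kw_def by (intro infsum_nonneg norm_ge_zero)+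
  have "(\<lambda>n. g n ^ d) \<longlonglongrightarrow> 0" using g_summable by (rule summable_LIMSEQ_zero)
  then have "(\<lambda>n. root d (g n ^ d)) \<longlonglongrightarrow> root d 0" by (rule tendsto_real_root)
  then have g0: "g \<longlonglongrightarrow> 0" using d_pos g_nonneg by (simp add: real_root_power_cancel)
  show "wn \<longlonglongrightarrow> 0"
    by (rule Lim_null_comparison[OF always_eventually tendsto_mult_right_zero[OF g0, of Kw]])
       (use wn_le in \<open>auto simp: Kw_def\<close>)
  have "cmod (R n)
      \<le> Kr * g n ^ d + cmod (wn (Suc n) - whn n) * (1 + Kq + Kp * Kw)" for n
  proof -
    have eq: "R n
       = ev n resid + (wn (Suc n) - whn n) * (1 + \<nu> * (Qn n + Pn n * wn n))"
      unfolding ev_resid R_def by (simp add: algebra_simps)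
    have "cmod (ev n resid + (wn (Suc n) - whn n) * (1 + \<nu> * (Qn n + Pn n * wn n)))
        \<le> cmod (ev n resid) + cmod (wn (Suc n) - whn n) * cmod (1 + \<nu> * (Qn n + Pn n * wn n))"
      unfolding norm_mult[symmetric] by (rule norm_triangle_ineq)
    also have "\<dots> \<le> Kr * g n ^ d + cmod (wn (Suc n) - whn n) * (1 + (Kq + Kp * Kw))"
    proof (rule add_mono[OF _ mult_left_mono])
      show "cmod (ev n resid) \<le> Kr * g n ^ d" unfolding Kr_def by (rule norm_ev_resid)
      have "cmod (1 + \<nu> * (Qn n + Pn n * wn n)) \<le> 1 + (cmod (Qn n) + cmod (Pn n) * cmod (wn n))"
        using norm_triangle_ineq[of 1 "\<nu> * (Qn n + Pn n * wn n)"] norm_triangle_ineq[of "Qn n" "Pn n * wn n"]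
        by (simp add: norm_mult nu)
      also have "\<dots> \<le> 1 + (Kq + Kp * Kw)"
        by (rule add_left_mono[OF add_mono[OF Q mult_mono[OF P w K0(1) norm_ge_zero]]])
      finally show "cmod (1 + \<nu> * (Qn n + Pn n * wn n)) \<le> 1 + (Kq + Kp * Kw)" .
    qed auto
    finally show ?thesis unfolding eq by (simp only: add.assoc)
  qed
  note le = this
  have "summable (\<lambda>n. Kr * g n ^ d + cmod (wn (Suc n) - whn n) * (1 + Kq + Kp * Kw))"
    by (intro summable_add summable_mult summable_mult2 g_summable wn_Suc_summable)
  then show "summable (\<lambda>n. cmod (wn (Suc n) - \<omega> * wn n
           - \<nu> * (Qn n + Pn n * wn n - Qn n * wn (Suc n) - Pn n * wn n * wn (Suc n))))"
    unfolding R_def[symmetric]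
    by (rule summable_comparison_test'[where N = 0]) (unfold real_norm_def abs_norm_cancel, rule le)
qed

end

section \<open>Bounded solutions of the Jacobi recursion\<close>

text \<open>The pair (\<open>r1\<close>, \<open>r2\<close>) is the first row of the product of ((1,
  -w'), (-cnj w', 1)) with ((A, B), (cnj B, cnj A)). Multiplication by ((1, w), (cnj w, 1)) from the
  right gives the row with entries \<open>r1 + r2 * cnj w\<close> and \<open>r1 * w + r2\<close>.
  The first identity is multiplicativity of the determinant; the second uses that ((1, w), (cnj w,
  1)) and ((1, -w), (-cnj w, 1)) have the product 1 - |w|^2.\<close>

lemma su11_conjugation:
  fixes A B w w' X :: complex
  defines "r1 \<equiv> A - w' * cnj B" and "r2 \<equiv> B - w' * cnj A"
  shows "(cmod (r1 + r2 * cnj w))\<^sup>2 - (cmod (r1 * w + r2))\<^sup>2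
           = ((cmod A)\<^sup>2 - (cmod B)\<^sup>2) * (1 - (cmod w')\<^sup>2) * (1 - (cmod w)\<^sup>2)"
    and "(r1 + r2 * cnj w) * (X - w * cnj X) + (r1 * w + r2) * cnj (X - w * cnj X)
           = of_real (1 - (cmod w)\<^sup>2) * ((A * X + B * cnj X) - w' * cnj (A * X + B * cnj X))"
proof -
  have "complex_of_real ((cmod (r1 + r2 * cnj w))\<^sup>2 - (cmod (r1 * w + r2))\<^sup>2)
           = complex_of_real (((cmod A)\<^sup>2 - (cmod B)\<^sup>2) * (1 - (cmod w')\<^sup>2) * (1 - (cmod w)\<^sup>2))"
    unfolding of_real_diff of_real_mult complex_norm_square r1_def r2_def of_real_1
    by (simp add: algebra_simps)
  then show "(cmod (r1 + r2 * cnj w))\<^sup>2 - (cmod (r1 * w + r2))\<^sup>2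
           = ((cmod A)\<^sup>2 - (cmod B)\<^sup>2) * (1 - (cmod w')\<^sup>2) * (1 - (cmod w)\<^sup>2)"
    by (simp only: of_real_eq_iff)
  show "(r1 + r2 * cnj w) * (X - w * cnj X) + (r1 * w + r2) * cnj (X - w * cnj X)
           = of_real (1 - (cmod w)\<^sup>2) * ((A * X + B * cnj X) - w' * cnj (A * X + B * cnj X))"
    unfolding of_real_diff complex_norm_square r1_def r2_def of_real_1
    by (simp add: algebra_simps)
qed

lemma perturbed_recursion_bounded:
  fixes S \<epsilon> :: "nat \<Rightarrow> real"
  assumes "summable \<epsilon>" and "\<And>n. 0 \<le> \<epsilon> n" and "\<And>n. 0 \<le> S n"
    and le: "\<And>n. n \<ge> N \<Longrightarrow> S (Suc n) \<le> S n * (1 + \<epsilon> n)"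
  shows "Bseq S"
proof -
  have "S (N + n) \<le> S N * exp (\<Sum>k<n. \<epsilon> (N + k))" for n
  proof (induction n)
    case (Suc n)
    have "S (N + Suc n) \<le> S (N + n) * (1 + \<epsilon> (N + n))" using le[of "N + n"] by simp
    also have "\<dots> \<le> (S N * exp (\<Sum>k<n. \<epsilon> (N + k))) * exp (\<epsilon> (N + n))"
      by (intro mult_mono Suc.IH) (auto simp: assms intro: add_nonneg_nonneg)
    finally show ?case by (simp add: exp_add mult_ac)
  qed simp
  moreover have "(\<Sum>k<n. \<epsilon> (N + k)) \<le> suminf \<epsilon>" for n
  proof -
    have "(\<Sum>k<n. \<epsilon> (N + k)) = sum \<epsilon> {N..<N + n}"
      by (rule sum.reindex_bij_witness[of _ "\<lambda>k. k - N" "\<lambda>k. N + k"]) auto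
    also have "\<dots> \<le> suminf \<epsilon>" by (rule sum_le_suminf) (auto simp: assms)
    finally show ?thesis .
  qed
  ultimately have "S (N + n) \<le> S N * exp (suminf \<epsilon>)" for n
    by (meson assms(3) exp_le_cancel_iff mult_left_mono order_trans)
  then have "\<bar>S (n + N)\<bar> \<le> S N * exp (suminf \<epsilon>)" for n
    using assms(3)[of "N + n"] unfolding add.commute[of n N] by simp
  then have "Bseq (\<lambda>n. S (n + N))" by (intro BseqI'[where K = "S N * exp (suminf \<epsilon>)"]) simp
  then show ?thesis by (rule Bseq_offset)
qed

lemma riccati_imp_bounded:
  fixes a b v :: "nat \<Rightarrow> real" and w :: "nat \<Rightarrow> complex" and \<eta> :: real
  assumes eta: "0 < \<eta>" "\<eta> < pi"
    and a_pos: "\<And>n. n \<ge> 1 \<Longrightarrow> a n > 0" and a_lim: "a \<longlonglongrightarrow> 1"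
    and rec: "\<And>n. n \<ge> 1 \<Longrightarrow> 2 * cos \<eta> * v n = a (n + 1) * v (n + 1) + b (n + 1) * v n + a n * v (n - 1)"
    and P: "\<And>n. P n = (of_real (b (n + 2)) * exp (- \<i> * \<eta>) + of_real ((a (n + 1))\<^sup>2 - 1)) / (2 * \<i> * sin \<eta>)"
    and w0: "w \<longlonglongrightarrow> 0"
    and sR: "summable (\<lambda>n. cmod (w (Suc n) - exp (- 2 * \<i> * \<eta>) * w n
           - exp (- \<i> * \<eta>) * (cnj (P n) + P n * w n - cnj (P n) * w (Suc n) - P n * w n * w (Suc n))))"
      (is "summable (\<lambda>n. cmod (?R n))")
  shows "Bseq v"
proof -
  \<comment> \<open>In the basis of free solutions the transfer matrix has rows \<open>(A, B)\<close> and \<open>(cnj B, cnj A)\<close>.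
    Conjugation by the unimodular matrix built from \<open>w\<close> makes its off-diagonal entry summable, and the
    modulus of the diagonal one is then controlled by the determinant.\<close>
  define e where "e = exp (\<i> * complex_of_real \<eta>)"
  have e_cnj: "cnj e = exp (- \<i> * complex_of_real \<eta>)" "exp (- 2 * \<i> * complex_of_real \<eta>) = cnj e * cnj e"
    unfolding e_def by (simp_all add: exp_cnj exp_add[symmetric] mult.assoc)
  have e1: "e * cnj e = 1" "cnj e * e = 1" unfolding e_cnj by (simp_all add: e_def exp_add[symmetric])
  have e_norm: "cmod e = 1" unfolding e_def by (simp add: norm_exp_eq_Re)
  have e_sum: "e + cnj e = of_real (2 * cos \<eta>)" "e - cnj e = 2 * \<i> * of_real (sin \<eta>)"
    by (simp_all add: complex_eq_iff e_def Re_exp Im_exp)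
  have s0: "sin \<eta> > 0" using eta by (rule sin_gt_zero)
  \<comment> \<open>This combination annihilates the free solution exp(in\<eta>) and multiplies
    exp(-in\<eta>) by \<open>cnj e\<close> per step, so it diagonalises the free recursion. With the
    factor \<open>a (n + 1)\<close> included, the perturbation enters through \<open>b\<close> and
    a^2 - 1 linearly.\<close>
  define X where "X n = of_real (a (n + 1) * v (n + 1)) - e * of_real (v n)" for n
  define A where "A n = cnj e + P n" for n
  define B where "B n = cnj (P n)" for n
  have P': "P n * (e - cnj e) = of_real (b (n + 2)) * cnj e + of_real ((a (n + 1))\<^sup>2 - 1)" for n
    unfolding P e_cnj(1)[symmetric] e_sum using s0 by simp
  have cP': "cnj (P n) * (e - cnj e) = - (of_real (b (n + 2)) * e + of_real ((a (n + 1))\<^sup>2 - 1))" for n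
    using arg_cong[OF P'[of n], of cnj] by (simp add: algebra_simps)
  have enz: "e - cnj e \<noteq> 0" unfolding e_sum using s0 by simp
  have XA: "A n * X n + B n * cnj (X n) = of_real (a (n + 1)) * X (Suc n)" for n
  proof -
    define \<alpha> \<beta> y z u where "\<alpha> = complex_of_real (a (n + 1))" and "\<beta> = complex_of_real (b (n + 2))"
      and "y = complex_of_real (v (n + 1))" and "z = complex_of_real (v n)"
      and "u = complex_of_real (a (n + 2) * v (n + 2))"
    have X1: "X n = \<alpha> * y - e * z" "cnj (X n) = \<alpha> * y - cnj e * z" "X (Suc n) = u - e * y"
      by (simp_all add: X_def \<alpha>_def y_def z_def u_def)
    have "complex_of_real (2 * cos \<eta> * v (n + 1)) = of_real (a (n + 2) * v (n + 2) + b (n + 2) * v (n + 1) + a (n + 1) * v n)"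
      using rec[of "n + 1"] by (simp add: numeral_2_eq_2)
    then have r: "u = (e + cnj e) * y - \<beta> * y - \<alpha> * z"
      unfolding e_sum \<alpha>_def \<beta>_def y_def z_def u_def by (simp add: algebra_simps)
    have "(e - cnj e) * (A n * X n + B n * cnj (X n)) =
       (e - cnj e) * cnj e * (\<alpha> * y - e * z) + (P n * (e - cnj e)) * (\<alpha> * y - e * z)
         + (cnj (P n) * (e - cnj e)) * (\<alpha> * y - cnj e * z)"
      unfolding X1(2) unfolding X1(1) A_def B_def by (simp add: algebra_simps)
    also have "\<dots> = (e - cnj e) * cnj e * (\<alpha> * y - e * z) + (\<beta> * cnj e + (\<alpha>\<^sup>2 - 1)) * (\<alpha> * y - e * z)
         - (\<beta> * e + (\<alpha>\<^sup>2 - 1)) * (\<alpha> * y - cnj e * z)"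
      unfolding P' cP' by (simp add: \<alpha>_def \<beta>_def algebra_simps)
    also have "\<dots> = (e - cnj e) * (\<alpha> * (cnj e * y - \<beta> * y - \<alpha> * z)) + (1 - e * cnj e) * ((e - cnj e) * z)"
      by (simp add: algebra_simps power2_eq_square)
    also have "\<dots> = (e - cnj e) * (\<alpha> * X (Suc n))"
      unfolding X1 r e1 by (simp add: algebra_simps)
    finally show ?thesis using enz by (simp add: \<alpha>_def)
  qed
  have det: "(cmod (A n))\<^sup>2 - (cmod (B n))\<^sup>2 = (a (n + 1))\<^sup>2" for n
  proof -
    have "(e - cnj e) * complex_of_real ((cmod (A n))\<^sup>2 - (cmod (B n))\<^sup>2)
       = (e - cnj e) * (e * cnj e) + e * (P n * (e - cnj e)) + cnj e * (cnj (P n) * (e - cnj e))"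
      unfolding of_real_diff complex_norm_square A_def B_def by (simp add: algebra_simps)
    also have "\<dots> = (e - cnj e) * complex_of_real ((a (n + 1))\<^sup>2)"
      unfolding P' cP' e1 using e1 by (simp add: algebra_simps)
    finally have "complex_of_real ((cmod (A n))\<^sup>2 - (cmod (B n))\<^sup>2) = complex_of_real ((a (n + 1))\<^sup>2)"
      using enz by (metis mult_left_cancel)
    then show ?thesis by (simp only: of_real_eq_iff)
  qed
  define Z where "Z n = X n - w n * cnj (X n)" for n
  define s where "s n = 1 - (cmod (w n))\<^sup>2" for n
  \<comment> \<open>Division by the square root normalises the conjugating matrix to determinant 1.
    In the growth estimate these factors then cancel, and only the residual remains.\<close>
  define S where "S n = cmod (Z n) / sqrt (s n)" for n
  \<comment> \<open>The off-diagonal entry of the conjugated matrix is, up to a unimodular factor,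
    the Riccati residual.\<close>
  have res: "(A n - w (Suc n) * cnj (B n)) * w n + (B n - w (Suc n) * cnj (A n)) = - (e * ?R n)" for n
  proof -
    have "e * ?R n = e * w (Suc n) - (e * cnj e) * (cnj e * w n) - (e * cnj e) * (cnj (P n) + P n * w n - cnj (P n) * w (Suc n) - P n * w n * w (Suc n))"
      unfolding e_cnj(2) e_cnj(1)[symmetric] by (simp add: algebra_simps)
    then show ?thesis unfolding e1 A_def B_def by (simp add: algebra_simps)
  qed
  have "eventually (\<lambda>n. cmod (w n) < 1 / 2) sequentially"
    using tendstoD[OF w0, of "1/2"] by simp
  moreover have "eventually (\<lambda>n. a n > 1 / 2) sequentially"
    using order_tendstoD(1)[OF a_lim, of "1/2"] by simp
  ultimately have "eventually (\<lambda>n. cmod (w n) < 1 / 2 \<and> a n > 1 / 2) sequentially" by (rule eventually_conj)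
  then obtain N where N: "\<And>n. n \<ge> N \<Longrightarrow> cmod (w n) < 1 / 2" "\<And>n. n \<ge> N \<Longrightarrow> a n > 1 / 2"
    unfolding eventually_sequentially by blast
  have s34: "3 / 4 \<le> s n" "s n \<le> 1" if "n \<ge> N" for n
    using power_mono[of "cmod (w n)" "1/2" 2] N(1)[OF that] by (auto simp: s_def power2_eq_square)
  \<comment> \<open>The constant is 2 times 8: the off-diagonal entry enters twice, once directly
    and once through the bound for the diagonal entry, and division by three factors of at least 1/2
    costs 8.\<close>
  have step: "S (Suc n) \<le> S n * (1 + 16 * cmod (?R n))" if n: "n \<ge> N" for n
  proof -
    define \<kappa> \<epsilon> where "\<kappa> = (A n - w (Suc n) * cnj (B n)) + (B n - w (Suc n) * cnj (A n)) * cnj (w n)"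
      and "\<epsilon> = (A n - w (Suc n) * cnj (B n)) * w n + (B n - w (Suc n) * cnj (A n))"
    define \<alpha> where "\<alpha> = a (n + 1)"
    have \<alpha>: "\<alpha> > 1 / 2" using N(2)[of "n + 1"] n by (simp add: \<alpha>_def)
    have s: "3 / 4 \<le> s n" "s n \<le> 1" "3 / 4 \<le> s (Suc n)" "s (Suc n) \<le> 1" using s34 n by auto
    have en: "cmod \<epsilon> = cmod (?R n)" unfolding \<epsilon>_def res by (simp add: norm_mult e_norm)
    \<comment> \<open>The determinant identity determines the modulus of the diagonal entry exactly
      once that of the off-diagonal entry is known.\<close>
    have "(cmod \<kappa>)\<^sup>2 - (cmod \<epsilon>)\<^sup>2 = \<alpha>\<^sup>2 * s (Suc n) * s n"
      unfolding \<kappa>_def \<epsilon>_def \<alpha>_def s_def su11_conjugation(1) det by simp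
    then have "(cmod \<kappa>)\<^sup>2 = (\<alpha> * sqrt (s (Suc n)) * sqrt (s n))\<^sup>2 + (cmod \<epsilon>)\<^sup>2"
      using s by (simp add: power_mult_distrib)
    also have "\<dots> \<le> (\<alpha> * sqrt (s (Suc n)) * sqrt (s n) + cmod \<epsilon>)\<^sup>2"
      using \<alpha> s by (simp add: power2_sum)
    finally have k: "cmod \<kappa> \<le> \<alpha> * sqrt (s (Suc n)) * sqrt (s n) + cmod \<epsilon>"
      by (rule power2_le_imp_le) (use \<alpha> s in auto)
    have "\<kappa> * Z n + \<epsilon> * cnj (Z n) = of_real (s n) * (of_real \<alpha> * Z (Suc n))"
      unfolding \<kappa>_def \<epsilon>_def Z_def s_def su11_conjugation(2) XA \<alpha>_def by (simp add: algebra_simps)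
    then have "s n * (\<alpha> * cmod (Z (Suc n))) = cmod (\<kappa> * Z n + \<epsilon> * cnj (Z n))"
      using \<alpha> s by (simp add: norm_mult)
    also have "\<dots> \<le> cmod \<kappa> * cmod (Z n) + cmod \<epsilon> * cmod (Z n)"
      by (rule order_trans[OF norm_triangle_ineq]) (simp add: norm_mult)
    also have "\<dots> \<le> (\<alpha> * sqrt (s (Suc n)) * sqrt (s n) + 2 * cmod \<epsilon>) * cmod (Z n)"
      using mult_right_mono[OF k, of "cmod (Z n)"] by (simp add: algebra_simps)
    finally have Zle: "s n * (\<alpha> * cmod (Z (Suc n))) \<le> (\<alpha> * sqrt (s (Suc n)) * sqrt (s n) + 2 * cmod \<epsilon>) * cmod (Z n)" .
    define \<sigma> \<tau> where "\<sigma> = sqrt (s n)" and "\<tau> = sqrt (s (Suc n))"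
    have st: "1 / 2 \<le> \<sigma>" "1 / 2 \<le> \<tau>" "\<sigma> \<le> 1" "\<tau> \<le> 1" "s n = \<sigma> * \<sigma>"
      unfolding \<sigma>_def \<tau>_def using s real_le_rsqrt[of "1/2" "s n"] real_le_rsqrt[of "1/2" "s (Suc n)"]
      by (auto simp: power2_eq_square)
    have ZS: "cmod (Z n) = \<sigma> * S n" "cmod (Z (Suc n)) = \<tau> * S (Suc n)"
      unfolding S_def \<sigma>_def[symmetric] \<tau>_def[symmetric] using st(1,2) by auto
    have S0: "0 \<le> S n" unfolding S_def using s by simp
    have "(\<sigma> * \<sigma>) * (\<alpha> * \<tau>) * S (Suc n) \<le> (\<alpha> * \<tau> * \<sigma> + 2 * cmod \<epsilon>) * (\<sigma> * S n)"
      using Zle unfolding \<sigma>_def[symmetric] \<tau>_def[symmetric] ZS unfolding st(5) by (simp only: mult_ac)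
    also have "\<dots> \<le> (\<alpha> * \<tau> * \<sigma> + 2 * cmod \<epsilon> * (8 * (\<sigma> * (\<alpha> * \<tau>)))) * (\<sigma> * S n)"
    proof -
      have "1 \<le> 8 * (\<sigma> * (\<alpha> * \<tau>))"
      proof -
        have "1 / 2 * (1 / 2 * (1 / 2)) \<le> \<sigma> * (\<alpha> * \<tau>)" using st(1-4) \<alpha> by (intro mult_mono) auto
        then show ?thesis by simp
      qed
      then have "2 * cmod \<epsilon> * 1 \<le> 2 * cmod \<epsilon> * (8 * (\<sigma> * (\<alpha> * \<tau>)))" by (intro mult_left_mono) auto
      then show ?thesis using st(1) S0 by (intro mult_right_mono add_left_mono) auto
    qed
    also have "\<dots> = (\<sigma> * \<sigma>) * (\<alpha> * \<tau>) * (S n * (1 + 16 * cmod \<epsilon>))" by (simp add: algebra_simps)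
    finally have "S (Suc n) \<le> S n * (1 + 16 * cmod \<epsilon>)"
      by (rule mult_left_le_imp_le) (use st(1-4) \<alpha> in auto)
    then show ?thesis unfolding en .
  qed
  have "Bseq (\<lambda>n. S (n + N))"
  proof (rule perturbed_recursion_bounded)
    show "summable (\<lambda>n. 16 * cmod (?R (n + N)))"
      by (rule summable_mult[OF summable_ignore_initial_segment[OF sR]])
    show "S (Suc n + N) \<le> S (n + N) * (1 + 16 * cmod (?R (n + N)))" for n
      using step[of "n + N"] by simp
    show "0 \<le> S (n + N)" for n using s34[of "n + N"] by (simp add: S_def)
  qed auto
  then obtain K where K: "\<And>n. S (n + N) \<le> K" "K > 0"
    by (auto simp: Bseq_def dest: abs_le_D1)
  have "\<bar>v (n + N)\<bar> \<le> 2 * K / sin \<eta>" for n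
  proof -
    let ?n = "n + N"
    have s: "3 / 4 \<le> s ?n" "s ?n \<le> 1" "cmod (w ?n) < 1 / 2" using s34[of ?n] N(1)[of ?n] by auto
    have "cmod (Z ?n) = sqrt (s ?n) * S ?n" using s by (simp add: S_def)
    also have "\<dots> \<le> 1 * K" using s K by (intro mult_mono) (auto simp: S_def)
    finally have Z: "cmod (Z ?n) \<le> K" by simp
    have "cmod (X ?n) \<le> cmod (Z ?n) + cmod (w ?n * cnj (X ?n))"
      using norm_triangle_ineq[of "Z ?n" "w ?n * cnj (X ?n)"] by (simp add: Z_def)
    also have "\<dots> \<le> K + 1 / 2 * cmod (X ?n)"
      unfolding norm_mult using s by (intro add_mono mult_mono Z) auto
    finally have "cmod (X ?n) \<le> 2 * K" by simp
    \<comment> \<open>As \<open>v\<close> is real, the imaginary part isolates \<open>v ?n\<close>;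
      this recovers the solution from its complex coordinate at the price of 1 / sin \<eta>.\<close>
    moreover have "Im (X ?n) = - (sin \<eta> * v ?n)" by (simp add: X_def e_def Im_exp)
    ultimately have "sin \<eta> * \<bar>v ?n\<bar> \<le> 2 * K"
      using abs_Im_le_cmod[of "X ?n"] s0 by (simp add: abs_mult)
    then show ?thesis using s0 by (simp add: field_simps)
  qed
  then have "Bseq (\<lambda>n. v (n + N))" by (intro BseqI'[where K = "2 * K / sin \<eta>"]) simp
  then show ?thesis by (rule Bseq_offset)
qed

section \<open>Normalised oscillating data and one alphabet for both sequences\<close>

lemma summable_on_of_powr:
  fixes f :: "'a \<Rightarrow> real"
  assumes s: "(\<lambda>x. f x powr \<beta>) summable_on A" and nn: "\<And>x. x \<in> A \<Longrightarrow> 0 \<le> f x" and b: "0 < \<beta>" "\<beta> \<le> 1"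
  shows "f summable_on A"
proof (rule summable_on_comparison_test)
  define S where "S = infsum (\<lambda>x. f x powr \<beta>) A"
  show "(\<lambda>x. f x powr \<beta> * S powr (1 / \<beta> - 1)) summable_on A"
    by (rule summable_on_cmult_left[OF s])
  show "f x \<le> f x powr \<beta> * S powr (1 / \<beta> - 1)" if x: "x \<in> A" for x
  proof (cases "f x = 0")
    case False
    then have pos: "f x > 0" using nn[OF x] by simp
    have "sum (\<lambda>x. f x powr \<beta>) {x} \<le> S" unfolding S_def
      by (rule finite_sum_le_infsum[OF s]) (use x in auto)
    then have le: "f x powr \<beta> \<le> S" by simp
    \<comment> \<open>The total mass \<open>S\<close> bounds each \<open>f x powr \<beta>\<close>,
      hence also the nonnegative power that is missing to reach exponent 1.\<close>
    have "f x = f x powr \<beta> * (f x powr \<beta>) powr (1 / \<beta> - 1)"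
      using pos b by (simp add: powr_powr powr_add[symmetric] algebra_simps)
    also have "\<dots> \<le> f x powr \<beta> * S powr (1 / \<beta> - 1)"
      using le b by (intro mult_left_mono powr_mono2) auto
    finally show ?thesis .
  qed simp
qed (use nn in auto)

text \<open>Here both indices start at 0, and the amplitudes are normalised to be at most 1.\<close>

definition osc_data :: "nat \<Rightarrow> real \<Rightarrow> (nat \<Rightarrow> real) \<Rightarrow> (nat \<Rightarrow> complex) \<Rightarrow> (nat \<Rightarrow> real) \<Rightarrow>
    (nat \<Rightarrow> nat \<Rightarrow> complex) \<Rightarrow> (nat \<Rightarrow> real) \<Rightarrow> real \<Rightarrow> bool" where
  "osc_data p \<beta> u c \<phi> \<gamma> g V \<longleftrightarrow>
     (\<forall>n. ((\<lambda>l. c l * (exp (- \<i> * of_nat n * of_real (\<phi> l)) * \<gamma> l n)) has_sum complex_of_real (u n)) UNIV) \<and>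
     (\<forall>l n. cmod (\<gamma> l n) \<le> g n) \<and> (\<forall>n. g n \<le> 1) \<and> summable (\<lambda>n. g n ^ p) \<and>
     (\<forall>l N. (\<Sum>n<N. cmod (\<gamma> l (Suc n) - \<gamma> l n)) \<le> V) \<and>
     (\<lambda>l. cmod (c l) powr \<beta>) summable_on UNIV"

lemma osc_dataD:
  assumes "osc_data p \<beta> u c \<phi> \<gamma> g V"
  shows "((\<lambda>l. c l * (exp (- \<i> * of_nat n * of_real (\<phi> l)) * \<gamma> l n)) has_sum complex_of_real (u n)) UNIV"
    and "cmod (\<gamma> l n) \<le> g n" and "g n \<le> 1" and "summable (\<lambda>n. g n ^ p)"
    and "(\<Sum>n<N. cmod (\<gamma> l (Suc n) - \<gamma> l n)) \<le> V" and "(\<lambda>l. cmod (c l) powr \<beta>) summable_on UNIV"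
  using assms unfolding osc_data_def by blast+

text \<open>A shift by \<open>s\<close> multiplies each term by exp(-is\<phi>), which is absorbed
  into its coefficient. A common bound of the amplitudes moves into the coefficients too. Since the
  original data start at index 1, \<open>s \<ge> 1\<close> makes them available from 0 on.\<close>

lemma oscillatory_decay_shift:
  assumes osc: "oscillatory_decay p \<beta> u" and p: "p \<ge> 1" and b: "0 < \<beta>" "\<beta> \<le> 1" and s: "s \<ge> 1"
  obtains c \<phi> \<gamma> g V where "osc_data p \<beta> (\<lambda>n. u (n + s)) c \<phi> \<gamma> g V"
proof -
  obtain c0 :: "nat \<Rightarrow> complex" and \<phi>0 :: "nat \<Rightarrow> real" and \<gamma>0 :: "nat \<Rightarrow> nat \<Rightarrow> complex" where
    sums: "\<And>n. n \<ge> 1 \<Longrightarrow> (\<lambda>l. c0 (Suc l) * exp (- \<i> * of_nat n * of_real (\<phi>0 (Suc l))) * \<gamma>0 (Suc l) n)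
                  sums complex_of_real (u n)"
    and var: "(SUP l\<in>{1..}. \<Sum>n. ennreal (cmod (\<gamma>0 l (Suc n + 1) - \<gamma>0 l (Suc n)))) < \<infinity>"
    and dec: "(\<Sum>n. (SUP l\<in>{1..}. ennreal (cmod (\<gamma>0 l (Suc n)))) ^ p) < \<infinity>"
    and cb: "summable (\<lambda>l. cmod (c0 (Suc l)) powr \<beta>)"
    using osc unfolding oscillatory_decay_def by blast
  define G where "G n = (SUP l\<in>{1..}. ennreal (cmod (\<gamma>0 l (Suc n))))" for n
  define h where "h n = enn2real (G n)" for n
  have "G n ^ p < \<infinity>" for n
  proof -
    have "G n ^ p \<le> (\<Sum>n. G n ^ p)"
      using sum_le_suminf[of "\<lambda>n. G n ^ p" "{n}"] by simp
    then show ?thesis using dec unfolding G_def[symmetric] by (rule order.strict_trans1)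
  qed
  then have Gfin: "G n < \<infinity>" for n
    using p by (metis ennreal_top_eq_mult_iff infinity_ennreal_def less_top not_one_le_zero power_eq_top_ennreal)
  then have hG: "ennreal (h n) = G n" for n by (simp add: h_def)
  have h0: "0 \<le> h n" for n by (simp add: h_def)
  have gh: "cmod (\<gamma>0 (Suc l) (Suc n)) \<le> h n" for l n
  proof -
    have "ennreal (cmod (\<gamma>0 (Suc l) (Suc n))) \<le> G n"
      unfolding G_def by (rule SUP_upper) simp
    then show ?thesis unfolding hG[symmetric] using h0 by simp
  qed
  have hs: "summable (\<lambda>n. h n ^ p)"
  proof (rule summable_suminf_not_top)
    have "(\<Sum>n. ennreal (h n ^ p)) = (\<Sum>n. G n ^ p)"
      by (simp add: hG[symmetric] ennreal_power h0)
    then show "(\<Sum>n. ennreal (h n ^ p)) \<noteq> top" using dec unfolding G_def[symmetric] by auto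
  qed (simp add: h0)
  define K where "K = max 1 (\<Sum>n. h n ^ p)"
  have K1: "1 \<le> K" by (simp add: K_def)
  have hK: "h n \<le> K" for n
  proof (cases "h n \<le> 1")
    case False
    then have "h n ^ 1 \<le> h n ^ p" using p by (intro power_increasing) auto
    also have "\<dots> \<le> (\<Sum>n. h n ^ p)" using sum_le_suminf[OF hs, of "{n}"] h0 by simp
    finally show ?thesis by (simp add: K_def)
  qed (use K1 in auto)
  \<comment> \<open>\<open>h\<close> is indexed so that \<open>h k\<close> bounds the amplitudes at
    \<open>Suc k\<close>; the amplitude at \<open>n + s\<close> is therefore bounded by
    \<open>h (n + s - 1)\<close>.\<close>
  define c \<phi> \<gamma> g V where "c l = K * c0 (Suc l) * exp (- \<i> * of_nat s * of_real (\<phi>0 (Suc l)))"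
    and "\<phi> l = \<phi>0 (Suc l)" and "\<gamma> l n = \<gamma>0 (Suc l) (n + s) / K" and "g n = h (n + s - 1) / K"
    and "V = enn2real (SUP l\<in>{1..}. \<Sum>n. ennreal (cmod (\<gamma>0 l (Suc n + 1) - \<gamma>0 l (Suc n))))" for l n
  have g: "cmod (\<gamma> l n) \<le> g n" for l n
    using gh[of l "n + s - 1"] s K1 by (simp add: \<gamma>_def g_def norm_divide divide_right_mono)
  have g1: "g n \<le> 1" for n using hK K1 by (simp add: g_def)
  have cc: "cmod (c l) = K * cmod (c0 (Suc l))" for l
    using K1 by (simp add: c_def norm_mult norm_exp_eq_Re)
  have cs: "(\<lambda>l. cmod (c l) powr \<beta>) summable_on UNIV"
  proof -
    have "summable (\<lambda>l. K powr \<beta> * cmod (c0 (Suc l)) powr \<beta>)" by (rule summable_mult[OF cb])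
    then show ?thesis using K1 by (subst summable_on_UNIV_nonneg_real_iff) (simp_all add: cc powr_mult)
  qed
  have cabs: "(\<lambda>l. cmod (c l)) summable_on UNIV"
    by (rule summable_on_of_powr[OF cs _ b]) simp
  have "osc_data p \<beta> (\<lambda>n. u (n + s)) c \<phi> \<gamma> g V"
    unfolding osc_data_def
  proof (intro conjI allI g g1 cs)
    show "((\<lambda>l. c l * (exp (- \<i> * of_nat n * of_real (\<phi> l)) * \<gamma> l n)) has_sum complex_of_real (u (n + s))) UNIV" for n
    proof (rule norm_summable_imp_has_sum)
      have "summable (\<lambda>l. cmod (c l))" using cabs by (rule summable_on_imp_summable)
      then show "summable (\<lambda>l. norm (c l * (exp (- \<i> * of_nat n * of_real (\<phi> l)) * \<gamma> l n)))"
        by (rule summable_comparison_test'[where N = 0])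
           (use order_trans[OF g g1] in \<open>auto simp: norm_mult norm_exp_eq_Re intro: mult_left_le\<close>)
      have eq: "c l * (exp (- \<i> * of_nat n * of_real (\<phi> l)) * \<gamma> l n)
         = c0 (Suc l) * exp (- \<i> * of_nat (n + s) * of_real (\<phi>0 (Suc l))) * \<gamma>0 (Suc l) (n + s)" for l
      proof -
        have "exp (- \<i> * of_nat (n + s) * of_real (\<phi>0 (Suc l)))
           = exp (- \<i> * of_nat s * of_real (\<phi>0 (Suc l))) * exp (- \<i> * of_nat n * of_real (\<phi>0 (Suc l)))"
          by (simp add: exp_add[symmetric] algebra_simps)
        then show ?thesis using K1 by (simp add: c_def \<phi>_def \<gamma>_def)
      qed
      show "(\<lambda>l. c l * (exp (- \<i> * of_nat n * of_real (\<phi> l)) * \<gamma> l n)) sums complex_of_real (u (n + s))"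
        unfolding eq by (rule sums) (use s in simp)
    qed
    show "summable (\<lambda>n. g n ^ p)"
    proof -
      have "summable (\<lambda>n. h (n + (s - 1)) ^ p * (1 / K) ^ p)"
        by (rule summable_mult2[OF summable_ignore_initial_segment[OF hs]])
      then show ?thesis using s by (simp add: g_def power_divide)
    qed
    show "(\<Sum>n<N. cmod (\<gamma> l (Suc n) - \<gamma> l n)) \<le> V" for l N
    proof -
      let ?f = "\<lambda>n. cmod (\<gamma>0 (Suc l) (Suc n + 1) - \<gamma>0 (Suc l) (Suc n))"
      have "(\<Sum>n<N. cmod (\<gamma> l (Suc n) - \<gamma> l n)) = (\<Sum>n<N. ?f (n + (s - 1)) / K)"
        using s K1 by (intro sum.cong) (simp_all add: \<gamma>_def diff_divide_distrib[symmetric] norm_divide)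
      also have "\<dots> \<le> (\<Sum>n<N. ?f (n + (s - 1)))"
        using K1 by (intro sum_mono) (simp add: divide_le_eq mult_le_cancel_left1)
      also have "\<dots> = sum ?f {s - 1..<N + (s - 1)}"
        by (rule sum.reindex_bij_witness[of _ "\<lambda>k. k - (s - 1)" "\<lambda>k. k + (s - 1)"]) auto
      finally have 1: "(\<Sum>n<N. cmod (\<gamma> l (Suc n) - \<gamma> l n)) \<le> sum ?f {s - 1..<N + (s - 1)}" .
      have "ennreal (sum ?f {s - 1..<N + (s - 1)}) = (\<Sum>n\<in>{s - 1..<N + (s - 1)}. ennreal (?f n))"
        by (rule sum_ennreal[symmetric]) simp
      also have "\<dots> \<le> (\<Sum>n. ennreal (?f n))" by (rule sum_le_suminf) auto
      also have "\<dots> \<le> (SUP l\<in>{1..}. \<Sum>n. ennreal (cmod (\<gamma>0 l (Suc n + 1) - \<gamma>0 l (Suc n))))"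
        by (rule SUP_upper[of "Suc l"]) simp
      also have "\<dots> = ennreal V" using var by (simp add: V_def)
      finally have "sum ?f {s - 1..<N + (s - 1)} \<le> V"
        by (subst (asm) ennreal_le_iff) (simp_all add: V_def)
      with 1 show ?thesis by linarith
    qed
  qed
  then show thesis by (rule that)
qed

lemma osc_data_tendsto_0:
  assumes o: "osc_data p \<beta> u c \<phi> \<gamma> g V" and p: "p \<ge> 1" and b: "0 < \<beta>" "\<beta> \<le> 1"
  shows "u \<longlonglongrightarrow> 0"
proof -
  note hs = osc_dataD(1)[OF o] and g = osc_dataD(2)[OF o] and gs = osc_dataD(4)[OF o] and cs = osc_dataD(6)[OF o]
  have cabs: "(\<lambda>l. cmod (c l)) summable_on UNIV"
    by (rule summable_on_of_powr[OF cs _ b]) simp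
  have g0: "0 \<le> g n" for n by (rule order_trans[OF norm_ge_zero g[of 0]])
  have "(\<lambda>n. g n ^ p) \<longlonglongrightarrow> 0" using gs by (rule summable_LIMSEQ_zero)
  then have "(\<lambda>n. root p (g n ^ p)) \<longlonglongrightarrow> root p 0" by (rule tendsto_real_root)
  then have glim: "g \<longlonglongrightarrow> 0" using p g0 by (simp add: real_root_power_cancel)
  have "\<bar>u n\<bar> \<le> (\<Sum>\<^sub>\<infinity>l. cmod (c l)) * g n" for n
  proof -
    have s: "(\<lambda>l. cmod (c l) * g n) summable_on UNIV" by (rule summable_on_cmult_left[OF cabs])
    have "cmod (complex_of_real (u n)) \<le> (\<Sum>\<^sub>\<infinity>l. cmod (c l) * g n)"
      by (rule norm_infsum_le[OF hs has_sum_infsum[OF s]])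
         (auto simp: norm_mult norm_exp_eq_Re intro!: mult_left_mono g)
    then show ?thesis by (simp add: infsum_cmult_left')
  qed
  then show ?thesis
    by (intro Lim_null_comparison[OF always_eventually tendsto_mult_right_zero[OF glim, of "\<Sum>\<^sub>\<infinity>l. cmod (c l)"]]) auto
qed

text \<open>The two sequences have separate expansions. Their letters are merged into one alphabet,
  tagged by a Boolean.\<close>

lemma has_sum_bool_times:
  fixes f :: "bool \<times> 'a \<Rightarrow> 'b::topological_comm_monoid_add"
  assumes "((\<lambda>l. f (True, l)) has_sum s) UNIV" and "((\<lambda>l. f (False, l)) has_sum t) UNIV"
  shows "(f has_sum (s + t)) UNIV"
proof -
  have "(f has_sum s) (range (Pair True))" "(f has_sum t) (range (Pair False))"
    using assms by (simp_all add: has_sum_reindex inj_on_def o_def)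
  then have "(f has_sum (s + t)) (range (Pair True) \<union> range (Pair False))"
    by (rule has_sum_Un_disjoint) auto
  moreover have "range (Pair True) \<union> range (Pair False) = (UNIV :: (bool \<times> 'a) set)"
    by (auto simp: image_iff)
  ultimately show ?thesis by simp
qed

lemma (in riccati_words) ev_letter_fun:
  assumes "((\<lambda>l. f l * (exp (- \<i> * of_nat n * of_real (\<phi> l)) * \<gamma> l n)) has_sum s) UNIV"
  shows "ev n (letter_fun f) = s"
proof -
  have "((\<lambda>I. letter_fun f I * weight n I) has_sum s) (range (\<lambda>l. [l]))"
    using assms by (subst has_sum_reindex) (simp_all add: inj_on_def o_def letter_fun_def weight_def)
  then have "((\<lambda>I. letter_fun f I * weight n I) has_sum s) UNIV"
    by (rule has_sum_cong_neutral[THEN iffD1, rotated -1]) (auto simp: letter_fun_def split: list.splits)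
  then show ?thesis unfolding ev_def by (rule infsumI)
qed

text \<open>The two small-divisor assumptions of \<open>riccati_words\<close>, without the factor 1
  / (2 sin \<eta>) in the coefficients, so that the bad \<eta> are described by a fixed
  family.\<close>

definition nonresonant_phase :: "nat \<Rightarrow> ('l \<Rightarrow> real) \<Rightarrow> ('l \<Rightarrow> real) \<Rightarrow> real \<Rightarrow> bool" where
  "nonresonant_phase p c \<phi> \<eta> \<longleftrightarrow>
     (\<forall>J. exp (- \<i> * of_real (sum_list (map \<phi> J))) \<noteq> exp (- 2 * \<i> * of_real \<eta>)) \<and>
     (\<forall>i\<in>{1..<p}. (\<lambda>J. prod_list (map c J) /
        cmod (exp (- \<i> * of_real (sum_list (map \<phi> J))) - exp (- 2 * \<i> * of_real \<eta>)) ^ (p - 1))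
        summable_on {J. length J = i})"

text \<open>The coefficient of the Riccati equation at step \<open>n\<close> combines
  \<open>(a (n + 1))\<^sup>2 - 1\<close> with \<open>b (n + 2)\<close>; hence the two different
  shifts.\<close>

lemma bounded_solutions:
  fixes a b v :: "nat \<Rightarrow> real"
  assumes o1: "osc_data p \<beta> (\<lambda>n. (a (n + 1))\<^sup>2 - 1) c1 \<phi>1 \<gamma>1 g1 V1"
    and o2: "osc_data p \<beta> (\<lambda>n. b (n + 2)) c2 \<phi>2 \<gamma>2 g2 V2"
    and p: "p \<ge> 1" and bet: "0 < \<beta>" "\<beta> \<le> 1"
    and eta: "0 < \<eta>" "\<eta> < pi"
    and good: "nonresonant_phase p (\<lambda>(t, l). cmod (if t then c1 l else c2 l)) (\<lambda>(t, l). if t then \<phi>1 l else \<phi>2 l) \<eta>"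
    and a_pos: "\<And>n. n \<ge> 1 \<Longrightarrow> a n > 0"
    and rec: "\<And>n. n \<ge> 1 \<Longrightarrow> 2 * cos \<eta> * v n = a (n + 1) * v (n + 1) + b (n + 1) * v n + a n * v (n - 1)"
  shows "Bseq v"
proof -
  define c where "c = (\<lambda>(t, l). if t then c1 l else c2 (l::nat))"
  define \<phi> where "\<phi> = (\<lambda>(t, l). if t then \<phi>1 l else \<phi>2 (l::nat))"
  define \<gamma> where "\<gamma> = (\<lambda>(t, l) n. if t then \<gamma>1 l n else \<gamma>2 (l::nat) n)"
  define g where "g n = max (g1 n) (g2 n)" for n
  define V where "V = max V1 V2"
  define r where "r = 1 / (2 * sin \<eta>)"
  have s0: "sin \<eta> > 0" using eta by (rule sin_gt_zero)
  have r0: "r > 0" using s0 by (simp add: r_def)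
  define pc where "pc = (\<lambda>(t, l). c (t, l) * (if t then 1 else exp (- \<i> * \<eta>)) / (2 * \<i> * sin \<eta>))"
  \<comment> \<open>Both sequences are real, so the conjugate of \<open>P n\<close> is again a
    combination of them and expands in the same oscillating terms, not in the conjugate ones. One
    alphabet therefore serves \<open>P\<close> and its conjugate.\<close>
  define qc where "qc = (\<lambda>(t, l). - (c (t, l) * (if t then 1 else exp (\<i> * \<eta>)) / (2 * \<i> * sin \<eta>)))"
  note d1 = osc_dataD[OF o1] and d2 = osc_dataD[OF o2]
  have g0: "0 \<le> g1 n" "0 \<le> g2 n" for n
    by (rule order_trans[OF norm_ge_zero d1(2)[of 0]] order_trans[OF norm_ge_zero d2(2)[of 0]])+
  have cs: "(\<lambda>x. cmod (c x)) summable_on UNIV"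
  proof -
    have "(\<lambda>l. cmod (c1 l)) summable_on UNIV" "(\<lambda>l. cmod (c2 l)) summable_on UNIV"
      by (rule summable_on_of_powr[OF d1(6) _ bet] summable_on_of_powr[OF d2(6) _ bet]; simp)+
    then obtain s t where "((\<lambda>l. cmod (c1 l)) has_sum s) UNIV" "((\<lambda>l. cmod (c2 l)) has_sum t) UNIV"
      unfolding summable_on_def by blast
    then have "((\<lambda>x. cmod (c x)) has_sum (s + t)) UNIV"
      by (intro has_sum_bool_times) (simp_all add: c_def)
    then show ?thesis by (rule has_sum_imp_summable)
  qed
  have cnorm: "(\<lambda>(t, l). cmod (if t then c1 l else c2 l)) = (\<lambda>x. cmod (c x))"
    by (auto simp: c_def fun_eq_iff)
  have prod_scale: "prod_list (map (\<lambda>l. r * cmod (c l)) J) = r ^ length J * prod_list (map (\<lambda>x. cmod (c x)) J)" for J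
    by (induction J) (simp_all add: mult_ac)
  interpret word_eval \<phi> \<gamma>
    by unfold_locales (use order_trans[OF d1(2,3)] order_trans[OF d2(2,3)] in \<open>auto simp: \<gamma>_def split: prod.split\<close>)
  interpret riccati_words \<phi> \<gamma> pc qc "\<lambda>l. r * cmod (c l)" "exp (- 2 * \<i> * \<eta>)" "exp (- \<i> * \<eta>)" p g V
  proof unfold_locales
    show "cmod (pc l) \<le> r * cmod (c l)" "cmod (qc l) \<le> r * cmod (c l)" for l
      using s0 by (auto simp: pc_def qc_def r_def norm_divide norm_mult norm_exp_eq_Re split: prod.split)
    show "(\<lambda>l. r * cmod (c l)) summable_on UNIV" by (rule summable_on_cmult_right[OF cs])
    show "cmod (exp (- 2 * \<i> * complex_of_real \<eta>)) = 1" "cmod (exp (- \<i> * complex_of_real \<eta>)) = 1"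
      by (simp_all add: norm_exp_eq_Re)
    show "1 \<le> p" by (rule p)
    show "cmod (\<gamma> l n) \<le> g n" for l n
      using d1(2)[of "snd l" n] d2(2)[of "snd l" n] by (auto simp: \<gamma>_def g_def split: prod.split)
    show "g n \<le> 1" for n using d1(3) d2(3) by (simp add: g_def)
    have le: "g n ^ p \<le> g1 n ^ p + g2 n ^ p" for n
      unfolding g_def max_def using g0[of n] by simp
    show "summable (\<lambda>n. g n ^ p)"
    proof (rule summable_comparison_test'[where N = 0, OF summable_add[OF d1(4) d2(4)]])
      show "norm (g n ^ p) \<le> g1 n ^ p + g2 n ^ p" for n
        using le[of n] g0[of n] by (simp add: g_def)
    qed
    show "(\<Sum>n<N. cmod (\<gamma> l (Suc n) - \<gamma> l n)) \<le> V" for l N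
      using d1(5)[of "snd l" N] d2(5)[of "snd l" N] by (cases "fst l") (auto simp: \<gamma>_def V_def split: prod.split)
    show "phase J \<noteq> exp (- 2 * \<i> * complex_of_real \<eta>)" for J
      unfolding phase_def using good unfolding nonresonant_phase_def \<phi>_def by blast
    show "(\<lambda>J. prod_list (map (\<lambda>l. r * cmod (c l)) J) / cmod (phase J - exp (- 2 * \<i> * complex_of_real \<eta>)) ^ (p - 1))
         summable_on {J. length J = i}" if "1 \<le> i" "i < p" for i
    proof -
      have "(\<lambda>J. r ^ i * (prod_list (map (\<lambda>x. cmod (c x)) J) / cmod (phase J - exp (- 2 * \<i> * complex_of_real \<eta>)) ^ (p - 1)))
         summable_on {J. length J = i}"
        unfolding phase_def using good that unfolding nonresonant_phase_def \<phi>_def cnorm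
        by (intro summable_on_cmult_right) auto
      then show ?thesis
        by (rule summable_on_cong[THEN iffD1, rotated]) (auto simp: prod_scale)
    qed
  qed
  define E1 E2 where "E1 n l = c1 l * (exp (- \<i> * of_nat n * of_real (\<phi>1 l)) * \<gamma>1 l n)"
    and "E2 n l = c2 l * (exp (- \<i> * of_nat n * of_real (\<phi>2 l)) * \<gamma>2 l n)" for n l
  note d11 = d1(1)[folded E1_def] and d21 = d2(1)[folded E2_def]
  define P where "P n = (of_real (b (n + 2)) * exp (- \<i> * \<eta>) + of_real ((a (n + 1))\<^sup>2 - 1)) / (2 * \<i> * sin \<eta>)" for n
  have Pn: "Pn n = P n" for n
    unfolding Pn_def
  proof (rule ev_letter_fun)
    have "((\<lambda>l. E1 n l * (1 / (2 * \<i> * sin \<eta>)))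
       has_sum (complex_of_real ((a (n + 1))\<^sup>2 - 1) * (1 / (2 * \<i> * sin \<eta>)))) UNIV"
      by (rule has_sum_cmult_left[OF d11])
    moreover have "((\<lambda>l. E2 n l * (exp (- \<i> * \<eta>) / (2 * \<i> * sin \<eta>)))
       has_sum (complex_of_real (b (n + 2)) * (exp (- \<i> * \<eta>) / (2 * \<i> * sin \<eta>)))) UNIV"
      by (rule has_sum_cmult_left[OF d21])
    ultimately have "((\<lambda>l. pc l * (exp (- \<i> * of_nat n * of_real (\<phi> l)) * \<gamma> l n)) has_sum
       (complex_of_real ((a (n + 1))\<^sup>2 - 1) * (1 / (2 * \<i> * sin \<eta>)) + complex_of_real (b (n + 2)) * (exp (- \<i> * \<eta>) / (2 * \<i> * sin \<eta>)))) UNIV"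
      by (intro has_sum_bool_times) (simp_all add: E1_def E2_def pc_def c_def \<phi>_def \<gamma>_def mult_ac)
    then show "((\<lambda>l. pc l * (exp (- \<i> * of_nat n * of_real (\<phi> l)) * \<gamma> l n)) has_sum P n) UNIV"
      by (simp add: P_def add_divide_distrib add_ac)
  qed
  have cP: "cnj (P n) = complex_of_real ((a (n + 1))\<^sup>2 - 1) * (- (1 / (2 * \<i> * sin \<eta>)))
      + complex_of_real (b (n + 2)) * (- (exp (\<i> * \<eta>) / (2 * \<i> * sin \<eta>)))" for n
    by (simp add: P_def exp_cnj add_divide_distrib)
  have Qn: "Qn n = cnj (P n)" for n
    unfolding Qn_def
  proof (rule ev_letter_fun)
    have "((\<lambda>l. E1 n l * (- (1 / (2 * \<i> * sin \<eta>))))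
       has_sum (complex_of_real ((a (n + 1))\<^sup>2 - 1) * (- (1 / (2 * \<i> * sin \<eta>))))) UNIV"
      by (rule has_sum_cmult_left[OF d11])
    moreover have "((\<lambda>l. E2 n l * (- (exp (\<i> * \<eta>) / (2 * \<i> * sin \<eta>))))
       has_sum (complex_of_real (b (n + 2)) * (- (exp (\<i> * \<eta>) / (2 * \<i> * sin \<eta>))))) UNIV"
      by (rule has_sum_cmult_left[OF d21])
    ultimately show "((\<lambda>l. qc l * (exp (- \<i> * of_nat n * of_real (\<phi> l)) * \<gamma> l n)) has_sum cnj (P n)) UNIV"
      unfolding cP by (intro has_sum_bool_times) (simp_all add: E1_def E2_def qc_def c_def \<phi>_def \<gamma>_def mult_ac)
  qed
  have a_lim: "a \<longlonglongrightarrow> 1"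
  proof -
    have "(\<lambda>n. (a (n + 1))\<^sup>2 - 1) \<longlonglongrightarrow> 0" by (rule osc_data_tendsto_0[OF o1 p bet])
    then have "(\<lambda>n. sqrt (((a (n + 1))\<^sup>2 - 1) + 1)) \<longlonglongrightarrow> sqrt (0 + 1)" by (intro tendsto_intros)
    then have "(\<lambda>n. a (n + 1)) \<longlonglongrightarrow> 1" using less_imp_le[OF a_pos] by simp
    then show ?thesis by (rule LIMSEQ_offset)
  qed
  obtain w where w: "w \<longlonglongrightarrow> 0" and R: "summable (\<lambda>n. cmod (w (Suc n) - exp (- 2 * \<i> * \<eta>) * w n
           - exp (- \<i> * \<eta>) * (Qn n + Pn n * w n - Qn n * w (Suc n) - Pn n * w n * w (Suc n))))"
    using approximate_riccati by blast
  show ?thesis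
    by (rule riccati_imp_bounded[OF eta a_pos a_lim rec P_def w]) (use R in \<open>simp_all only: Pn Qn\<close>)
qed

section \<open>Hausdorff null sets\<close>

definition hausdorff_cost :: "real \<Rightarrow> 'a::metric_space set \<Rightarrow> ennreal" where
  "hausdorff_cost s U = (if U = {} then 0 else if s = 0 then 1 else ennreal (diameter U powr s))"

lemma hausdorff_premeasure_le:
  assumes "S \<subseteq> (\<Union>i. U i)" and "\<And>i. bounded (U i)" and "\<And>i. diameter (U i) \<le> \<delta>"
  shows "hausdorff_premeasure s \<delta> S \<le> (\<Sum>i. hausdorff_cost s (U i))"
  unfolding hausdorff_premeasure_def hausdorff_cost_def
  by (rule INF_lower) (use assms in auto)

lemma hausdorff_premeasure_less:
  assumes "hausdorff_premeasure s \<delta> S < c"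
  obtains U where "S \<subseteq> (\<Union>i. U i)" and "\<And>i::nat. bounded (U i)" and "\<And>i. diameter (U i) \<le> \<delta>"
    and "(\<Sum>i. hausdorff_cost s (U i)) < c"
  using assms unfolding hausdorff_premeasure_def hausdorff_cost_def
  by (auto simp: INF_less_iff)

lemma hausdorff_premeasure_mono:
  assumes "S \<subseteq> T" shows "hausdorff_premeasure s \<delta> S \<le> hausdorff_premeasure s \<delta> T"
  unfolding hausdorff_premeasure_def by (rule INF_superset_mono) (use assms in auto)

lemma hausdorff_premeasure_UN:
  "hausdorff_premeasure s \<delta> (\<Union>n. E n) \<le> (\<Sum>n::nat. hausdorff_premeasure s \<delta> (E n))"
proof (rule ennreal_le_epsilon)
  fix e :: real assume e: "0 < e" and fin: "(\<Sum>n. hausdorff_premeasure s \<delta> (E n)) < top"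
  have "\<exists>U. E n \<subseteq> (\<Union>i::nat. U i) \<and> (\<forall>i. bounded (U i) \<and> diameter (U i) \<le> \<delta>) \<and>
      (\<Sum>i. hausdorff_cost s (U i)) \<le> hausdorff_premeasure s \<delta> (E n) + ennreal (e * (1 / 2) ^ Suc n)" for n
  proof -
    have "hausdorff_premeasure s \<delta> (E n) \<noteq> top"
      using fin sum_le_suminf[of "\<lambda>n. hausdorff_premeasure s \<delta> (E n)" "{n}"] by (auto simp: top_unique)
    then have "hausdorff_premeasure s \<delta> (E n) < hausdorff_premeasure s \<delta> (E n) + ennreal (e * (1 / 2) ^ Suc n)"
      using e by (simp add: ennreal_add_left_cancel_less less_top)
    from hausdorff_premeasure_less[OF this] show ?thesis by (metis less_imp_le)
  qed
  then obtain U where U: "\<And>n. E n \<subseteq> (\<Union>i::nat. U n i)" "\<And>n i. bounded (U n i)" "\<And>n i. diameter (U n i) \<le> \<delta>"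
      "\<And>n. (\<Sum>i. hausdorff_cost s (U n i)) \<le> hausdorff_premeasure s \<delta> (E n) + ennreal (e * (1 / 2) ^ Suc n)"
    by metis
  have "hausdorff_premeasure s \<delta> (\<Union>n. E n) \<le> (\<Sum>k. hausdorff_cost s (case prod_decode k of (n, i) \<Rightarrow> U n i))"
  proof (rule hausdorff_premeasure_le)
    show "(\<Union>n. E n) \<subseteq> (\<Union>k. case prod_decode k of (n, i) \<Rightarrow> U n i)"
    proof
      fix x assume "x \<in> (\<Union>n. E n)"
      then obtain n i where "x \<in> U n i" using U(1) by blast
      then show "x \<in> (\<Union>k. case prod_decode k of (n, i) \<Rightarrow> U n i)"
        by (intro UN_I[of "prod_encode (n, i)"]) auto
    qed
  qed (auto simp: U split: prod.split)
  also have "\<dots> = (\<Sum>k. case_prod (\<lambda>n i. hausdorff_cost s (U n i)) (prod_decode k))"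
    by (intro suminf_cong) (auto split: prod.split)
  also have "\<dots> = (\<Sum>n. \<Sum>i. hausdorff_cost s (U n i))"
    by (rule suminf_ennreal_2dimen[unfolded o_def]) simp
  also have "\<dots> \<le> (\<Sum>n. hausdorff_premeasure s \<delta> (E n) + ennreal (e * (1 / 2) ^ Suc n))"
    by (intro suminf_le U(4)) auto
  also have "\<dots> = (\<Sum>n. hausdorff_premeasure s \<delta> (E n)) + (\<Sum>n. ennreal (e * (1 / 2) ^ Suc n))"
    by (rule suminf_add[symmetric]) auto
  also have "(\<Sum>n. ennreal (e * (1 / 2) ^ Suc n)) = ennreal e"
  proof -
    have "(\<lambda>n. e * (1 / 2) ^ Suc n) sums (e * 1)" by (rule sums_mult[OF power_half_series])
    then show ?thesis using e by (intro suminf_ennreal_eq) auto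
  qed
  finally show "hausdorff_premeasure s \<delta> (\<Union>n. E n) \<le> (\<Sum>n. hausdorff_premeasure s \<delta> (E n)) + ennreal e" .
qed

lemma hausdorff_null_iff:
  "hausdorff_measure s S = 0 \<longleftrightarrow> (\<forall>\<delta>>0. hausdorff_premeasure s \<delta> S = 0)"
  unfolding hausdorff_measure_def using gt_ex[of "0::real"]
  by (subst SUP_eq_iff) auto

lemma hausdorff_null_mono:
  "hausdorff_measure s T = 0 \<Longrightarrow> S \<subseteq> T \<Longrightarrow> hausdorff_measure s S = 0"
  unfolding hausdorff_null_iff by (metis hausdorff_premeasure_mono le_zero_eq)

lemma hausdorff_null_UN:
  assumes "\<And>n::nat. hausdorff_measure s (E n) = 0" shows "hausdorff_measure s (\<Union>n. E n) = 0"
  unfolding hausdorff_null_iff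
proof (intro allI impI)
  fix \<delta> :: real assume "\<delta> > 0"
  then have "hausdorff_premeasure s \<delta> (E n) = 0" for n using assms by (auto simp: hausdorff_null_iff)
  then show "hausdorff_premeasure s \<delta> (\<Union>n. E n) = 0" using hausdorff_premeasure_UN[of s \<delta> E] by simp
qed

lemma hausdorff_null_Un:
  assumes "hausdorff_measure s A = 0" "hausdorff_measure s B = 0" shows "hausdorff_measure s (A \<union> B) = 0"
proof -
  have "hausdorff_measure s (\<Union>n::nat. if n = 0 then A else B) = 0"
    by (rule hausdorff_null_UN) (use assms in auto)
  then show ?thesis by (rule hausdorff_null_mono) (auto intro: exI[of _ 0] exI[of _ 1] split: if_splits)
qed

lemma hausdorff_premeasure_finite_cover:
  assumes s: "s > 0" and K: "finite K" and cov: "S \<subseteq> (\<Union>k\<in>K. J k)"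
    and J: "\<And>k. k \<in> K \<Longrightarrow> bounded (J k)" "\<And>k. k \<in> K \<Longrightarrow> diameter (J k) \<le> h" and h: "0 \<le> h" "h \<le> \<delta>"
  shows "hausdorff_premeasure s \<delta> S \<le> ennreal (real (card K) * h powr s)"
proof -
  obtain e where e: "bij_betw e {0..<card K} K" using ex_bij_betw_nat_finite[OF K] by blast
  define U where "U i = (if i < card K then J (e i) else {})" for i
  have eK: "e i \<in> K" if "i < card K" for i using e that by (auto simp: bij_betw_def)
  have "hausdorff_premeasure s \<delta> S \<le> (\<Sum>i. hausdorff_cost s (U i))"
  proof (rule hausdorff_premeasure_le)
    show "S \<subseteq> (\<Union>i. U i)"
    proof
      fix x assume "x \<in> S"
      then obtain k where k: "k \<in> K" "x \<in> J k" using cov by blast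
      then obtain i where "i < card K" "e i = k" using e by (force simp: bij_betw_def)
      then show "x \<in> (\<Union>i. U i)" using k by (intro UN_I[of i]) (auto simp: U_def)
    qed
  qed (use J eK h in \<open>auto simp: U_def intro: order_trans\<close>)
  also have "\<dots> = (\<Sum>i<card K. hausdorff_cost s (U i))"
    by (rule suminf_finite) (auto simp: U_def hausdorff_cost_def)
  also have "\<dots> \<le> (\<Sum>i<card K. ennreal (h powr s))"
  proof (rule sum_mono)
    fix i assume i: "i \<in> {..<card K}"
    have "diameter (J (e i)) powr s \<le> h powr s"
      using s i by (intro powr_mono2 J eK diameter_ge_0) auto
    then show "hausdorff_cost s (U i) \<le> ennreal (h powr s)"
      using i s by (auto simp: hausdorff_cost_def U_def intro: ennreal_leI)
  qed
  also have "\<dots> = ennreal (real (card K) * h powr s)"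
    by (simp add: ennreal_mult ennreal_of_nat_eq_real_of_nat)
  finally show ?thesis .
qed

lemma hausdorff_measure_countable:
  assumes s: "s > 0" and S: "countable S" shows "hausdorff_measure s S = 0"
proof (cases "S = {}")
  case False
  have "hausdorff_measure s {x} = 0" for x :: 'a
    unfolding hausdorff_null_iff
    using hausdorff_premeasure_finite_cover[OF s, of "{()}" "{x}" "\<lambda>_. {x}" 0] by simp
  then have "hausdorff_measure s (\<Union>n. {from_nat_into S n}) = 0" by (rule hausdorff_null_UN)
  then show ?thesis
    by (rule hausdorff_null_mono) (use range_from_nat_into[OF False S] in auto)
next
  case True
  then show ?thesis unfolding hausdorff_null_iff
    using hausdorff_premeasure_finite_cover[OF s, of "{}" S "\<lambda>_::unit. {}" 0] by (simp add: less_imp_le)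
qed

lemma hausdorff_null_Lipschitz_image:
  fixes f :: "'a::metric_space \<Rightarrow> 'b::metric_space"
  assumes s: "s > 0" and L: "L > 0" and null: "hausdorff_measure s S = 0"
    and lip: "\<And>x y. x \<in> S \<Longrightarrow> y \<in> S \<Longrightarrow> dist (f x) (f y) \<le> L * dist x y"
  shows "hausdorff_measure s (f ` S) = 0"
  unfolding hausdorff_null_iff
proof (intro allI impI)
  fix \<delta> :: real assume \<delta>: "\<delta> > 0"
  have "hausdorff_premeasure s \<delta> (f ` S) \<le> 0 + ennreal e" if e: "e > 0" for e
  proof -
    have "hausdorff_premeasure s (\<delta> / L) S < ennreal (e / L powr s)"
      using null \<delta> L e by (simp add: hausdorff_null_iff)
    from hausdorff_premeasure_less[OF this] obtain U where
      U: "S \<subseteq> (\<Union>i. U i)" "\<And>i::nat. bounded (U i)" "\<And>i. diameter (U i) \<le> \<delta> / L"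
        "(\<Sum>i. hausdorff_cost s (U i)) < ennreal (e / L powr s)" by metis
    have dist: "dist x y \<le> L * diameter (U i)" if xy': "x \<in> f ` (U i \<inter> S)" "y \<in> f ` (U i \<inter> S)" for x y i
    proof -
      obtain x' y' where xy: "x = f x'" "y = f y'" "x' \<in> U i \<inter> S" "y' \<in> U i \<inter> S" using xy' by blast
      have "dist x y \<le> L * dist x' y'" using lip xy by auto
      also have "\<dots> \<le> L * diameter (U i)" using L U(2) xy by (intro mult_left_mono diameter_bounded_bound) auto
      finally show ?thesis .
    qed
    have diam: "diameter (f ` (U i \<inter> S)) \<le> L * diameter (U i)" for i
      unfolding diameter_def[of "f ` (U i \<inter> S)"]
      using dist L diameter_ge_0[OF U(2)[of i]] by (auto intro!: cSUP_least mult_nonneg_nonneg)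
    have bnd: "bounded (f ` (U i \<inter> S))" for i
      by (metis bounded_two_points dist)
    have "hausdorff_premeasure s \<delta> (f ` S) \<le> (\<Sum>i. hausdorff_cost s (f ` (U i \<inter> S)))"
    proof (rule hausdorff_premeasure_le)
      show "f ` S \<subseteq> (\<Union>i. f ` (U i \<inter> S))" using U(1) by blast
      show "diameter (f ` (U i \<inter> S)) \<le> \<delta>" for i
        by (rule order_trans[OF diam]) (use U(3)[of i] L in \<open>simp add: field_simps\<close>)
    qed (rule bnd)
    also have "\<dots> \<le> (\<Sum>i. ennreal (L powr s) * hausdorff_cost s (U i))"
    proof (intro suminf_le)
      fix i
      have "diameter (f ` (U i \<inter> S)) powr s \<le> (L * diameter (U i)) powr s"
        using s by (intro powr_mono2 diam diameter_ge_0 bnd) auto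
      also have "\<dots> = L powr s * diameter (U i) powr s" using L by (simp add: powr_mult diameter_ge_0[OF U(2)])
      finally have "ennreal (diameter (f ` (U i \<inter> S)) powr s) \<le> ennreal (L powr s) * ennreal (diameter (U i) powr s)"
        by (simp add: ennreal_mult[symmetric])
      then show "hausdorff_cost s (f ` (U i \<inter> S)) \<le> ennreal (L powr s) * hausdorff_cost s (U i)"
        using s by (auto simp: hausdorff_cost_def)
    qed auto
    also have "\<dots> = ennreal (L powr s) * (\<Sum>i. hausdorff_cost s (U i))" by (rule ennreal_suminf_cmult)
    also have "\<dots> \<le> ennreal (L powr s) * ennreal (e / L powr s)" using U(4) by (intro mult_left_mono) auto
    also have "\<dots> = ennreal e" using L e by (simp add: ennreal_mult[symmetric])
    finally show ?thesis by simp
  qed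
  then have "hausdorff_premeasure s \<delta> (f ` S) \<le> 0" by (rule ennreal_le_epsilon)
  then show "hausdorff_premeasure s \<delta> (f ` S) = 0" by simp
qed

lemma hausdorff_dim_le:
  assumes "0 \<le> \<sigma>" and "\<And>s. s > \<sigma> \<Longrightarrow> hausdorff_measure s S = 0"
  shows "hausdorff_dim S \<le> ennreal \<sigma>"
proof (rule ennreal_le_epsilon)
  fix e :: real assume e: "0 < e"
  have "hausdorff_dim S \<le> ennreal (\<sigma> + e)"
    unfolding hausdorff_dim_def by (rule INF_lower) (use assms e in auto)
  then show "hausdorff_dim S \<le> ennreal \<sigma> + ennreal e" using assms e by (simp add: ennreal_plus)
qed

text \<open>For covering sets of diameter at most 1 and \<open>s \<le> 1\<close> the diameter is at
  most its \<open>s\<close>-th power. Covering sets may fail to be measurable; each is enclosed in a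
  ball about one of its points, of length twice the diameter.\<close>

lemma hausdorff_null_imp_lborel_null:
  fixes S :: "real set"
  assumes s: "0 < s" "s \<le> 1" and S: "S \<in> sets borel" and null: "hausdorff_measure s S = 0"
  shows "emeasure lborel S = 0"
proof -
  have "emeasure lborel S \<le> 0 + ennreal e" if e: "e > 0" for e
  proof -
    have "hausdorff_premeasure s 1 S < ennreal (e / 2)" using null e by (simp add: hausdorff_null_iff)
    from hausdorff_premeasure_less[OF this] obtain U where
      U: "S \<subseteq> (\<Union>i. U i)" "\<And>i::nat. bounded (U i)" "\<And>i. diameter (U i) \<le> 1"
        "(\<Sum>i. hausdorff_cost s (U i)) < ennreal (e / 2)" by metis
    define x where "x i = (SOME x. x \<in> U i)" for i
    define B where "B i = (if U i = {} then {} else cball (x i) (diameter (U i)))" for i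
    have UB: "U i \<subseteq> B i" for i
    proof
      fix y assume y: "y \<in> U i"
      then have "x i \<in> U i" unfolding x_def by (rule someI)
      then show "y \<in> B i" using y diameter_bounded_bound[OF U(2)] by (auto simp: B_def)
    qed
    have "S \<subseteq> (\<Union>i. B i)" using U(1) UB by blast
    then have "emeasure lborel S \<le> emeasure lborel (\<Union>i. B i)"
      by (rule emeasure_mono) (auto simp: B_def)
    also have "\<dots> \<le> (\<Sum>i. emeasure lborel (B i))"
      by (rule emeasure_subadditive_countably) (auto simp: B_def)
    also have "\<dots> \<le> (\<Sum>i. 2 * hausdorff_cost s (U i))"
    proof (intro suminf_le)
      fix i
      have d: "0 \<le> diameter (U i)" by (rule diameter_ge_0[OF U(2)])
      have "diameter (U i) powr 1 \<le> diameter (U i) powr s"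
        using s U(3)[of i] d by (intro powr_mono') auto
      then have "diameter (U i) \<le> diameter (U i) powr s" using d by simp
      then have "ennreal (2 * diameter (U i)) \<le> 2 * ennreal (diameter (U i) powr s)"
        using d by (simp add: ennreal_mult mult_left_mono ennreal_leI)
      then show "emeasure lborel (B i) \<le> 2 * hausdorff_cost s (U i)"
        using s d by (auto simp: hausdorff_cost_def B_def cball_eq_atLeastAtMost)
    qed auto
    also have "\<dots> = 2 * (\<Sum>i. hausdorff_cost s (U i))" by (rule ennreal_suminf_cmult)
    also have "\<dots> \<le> 2 * ennreal (e / 2)" using U(4) by (intro mult_left_mono) auto
    also have "\<dots> = ennreal e" using e by (simp add: ennreal_mult[symmetric] flip: ennreal_numeral)
    finally show ?thesis by simp
  qed
  then have "emeasure lborel S \<le> 0" by (rule ennreal_le_epsilon)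
  then show ?thesis by simp
qed

lemma card_floor_neighbours:
  fixes z :: real and \<xi> :: "int \<Rightarrow> real"
  assumes F: "finite F" and \<xi>: "\<And>k. k \<in> F \<Longrightarrow> \<lfloor>\<xi> k\<rfloor> = k"
  shows "card {k\<in>F. \<bar>\<xi> k - z\<bar> \<le> 1} \<le> 3"
proof -
  have "{k\<in>F. \<bar>\<xi> k - z\<bar> \<le> 1} \<subseteq> {\<lfloor>z\<rfloor> - 1..\<lfloor>z\<rfloor> + 1}"
  proof
    fix k assume k: "k \<in> {k\<in>F. \<bar>\<xi> k - z\<bar> \<le> 1}"
    then have "\<xi> k \<le> z + 1" "z \<le> \<xi> k + 1" "\<lfloor>\<xi> k\<rfloor> = k" using \<xi> by auto
    moreover from this have "\<lfloor>\<xi> k\<rfloor> \<le> \<lfloor>z\<rfloor> + 1" "\<lfloor>z\<rfloor> \<le> \<lfloor>\<xi> k\<rfloor> + 1" by linarith+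
    ultimately show "k \<in> {\<lfloor>z\<rfloor> - 1..\<lfloor>z\<rfloor> + 1}" by simp
  qed
  from card_mono[OF _ this] show ?thesis by simp
qed

text \<open>If \<open>d \<le> 1\<close>, the scale \<open>m\<close> with 2^-(m+1) < d <= 2^-m
  already dominates, and passing from 2^-(m+1) to 2^-m costs 2^\<sigma>. The summand 1 serves
  \<open>d > 1\<close>.\<close>

lemma powr_neg_le_dyadic:
  fixes d :: real
  assumes d: "d > 0" and \<sigma>: "\<sigma> \<ge> 0" and M: "(1 / 2) ^ M < d"
  shows "d powr (-\<sigma>) \<le> 1 + (\<Sum>m<M. 2 powr \<sigma> * ((1 / 2) ^ m) powr (-\<sigma>) * (if d \<le> (1 / 2) ^ m then 1 else 0))"
proof (cases "d > 1")
  case True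
  then have "d powr (-\<sigma>) \<le> d powr 0" using \<sigma> by (intro powr_mono) auto
  also have "\<dots> = 1" using d by simp
  finally show ?thesis by (rule order_trans) (auto intro!: sum_nonneg)
next
  case False
  define n where "n = (LEAST n. (1 / 2) ^ n < d)"
  have n: "(1 / 2) ^ n < d" unfolding n_def by (rule LeastI[of _ M]) (rule M)
  have nM: "n \<le> M" unfolding n_def by (rule Least_le) (rule M)
  obtain m where m: "n = Suc m" using n False by (cases n) auto
  have dm: "d \<le> (1 / 2) ^ m" using not_less_Least[of m "\<lambda>n. (1 / 2) ^ n < d"] m n_def by auto
  have "d powr (-\<sigma>) \<le> ((1 / 2) ^ n) powr (-\<sigma>)" using n d \<sigma> by (intro powr_mono2') auto
  also have "\<dots> = 2 powr \<sigma> * ((1 / 2) ^ m) powr (-\<sigma>)"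
    by (simp add: m powr_mult powr_minus powr_divide field_simps)
  also have "\<dots> = 2 powr \<sigma> * ((1 / 2) ^ m) powr (-\<sigma>) * (if d \<le> (1 / 2) ^ m then 1 else 0)" using dm by simp
  also have "\<dots> \<le> (\<Sum>m<M. 2 powr \<sigma> * ((1 / 2) ^ m) powr (-\<sigma>) * (if d \<le> (1 / 2) ^ m then 1 else 0))"
    using nM m by (intro member_le_sum) auto
  finally show ?thesis by linarith
qed

text \<open>If the sum diverges at \<open>x\<close>, then the discrete measure with masses \<open>v\<close> gives mass at least
  \<open>r\<close> powr \<open>\<tau>\<close> to infinitely many dyadic neighbourhoods of \<open>x\<close>, of radius \<open>r\<close>, for any
  \<open>\<sigma> < \<tau> < t\<close>. There are few such neighbourhoods of each size.\<close>

lemma hausdorff_null_singular_sum: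
  fixes v y :: "'i \<Rightarrow> real"
  assumes v: "v summable_on A" "\<And>i. i \<in> A \<Longrightarrow> 0 \<le> v i" and \<sigma>: "0 \<le> \<sigma>" "\<sigma> < t"
  shows "hausdorff_measure t {x. (\<forall>i\<in>A. y i \<noteq> x) \<and> \<not> (\<lambda>i. v i * \<bar>x - y i\<bar> powr (-\<sigma>)) summable_on A} = 0"
    (is "hausdorff_measure t ?E = 0")
proof -
  \<comment> \<open>Both gaps are needed: the exponent \<tau> - \<sigma> makes the sum converge off
    the exceptional levels, and t - \<tau> makes the covers of those levels small.\<close>
  define \<tau> where "\<tau> = (\<sigma> + t) / 2"
  have \<tau>: "\<sigma> < \<tau>" "\<tau> < t" "0 < \<tau>" "0 < t" using \<sigma> by (auto simp: \<tau>_def)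
  have half: "(1 / 2 :: real) powr q < 1" if "q > 0" for q
    using powr_less_mono2[of q "1/2" 1] that by simp
  define h :: "nat \<Rightarrow> real" where "h m = (1 / 2) ^ m" for m
  have h0: "0 < h m" for m by (simp add: h_def)
  have hpow: "h m powr q = ((1 / 2) powr q) ^ m" for m q
    by (simp add: h_def powr_realpow[symmetric] powr_powr mult.commute)
  define w where "w m x i = v i * (if \<bar>x - y i\<bar> \<le> h m then 1 else 0)" for m x i
  have ws: "w m x summable_on A" for m x
    by (rule summable_on_comparison_test[OF v(1)]) (auto simp: w_def v)
  define F where "F m x = infsum (w m x) A" for m x
  define T where "T = infsum v A"
  have T0: "0 \<le> T" unfolding T_def by (rule infsum_nonneg[OF v(2)])
  have FT: "F m x \<le> T" for m x
    unfolding F_def T_def by (rule infsum_mono[OF ws v(1)]) (auto simp: w_def v)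
  define E where "E m = {x. F m x \<ge> h m powr \<tau>}" for m

  have cover: "?E \<subseteq> (\<Union>m. E (m0 + m))" for m0
  proof (rule ccontr)
    assume "\<not> ?E \<subseteq> (\<Union>m. E (m0 + m))"
    then obtain x where x: "\<forall>i\<in>A. y i \<noteq> x" "\<not> (\<lambda>i. v i * \<bar>x - y i\<bar> powr (-\<sigma>)) summable_on A"
      and "\<And>m. x \<notin> E (m0 + m)" by blast
    then have small: "F m x < h m powr \<tau>" if "m \<ge> m0" for m
      using that unfolding E_def by (metis (mono_tags, lifting) le_Suc_ex mem_Collect_eq not_le_imp_less)
    \<comment> \<open>Bounds for the contributions of the single scales; on the finitely many scales
      before \<open>m0\<close> only the total mass \<open>T\<close> is available.\<close>
    define q where "q m = h m powr (-\<sigma>) * (if m < m0 then T else h m powr \<tau>)" for m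
    have qF: "h m powr (-\<sigma>) * F m x \<le> q m" for m
      unfolding q_def using FT[of m x] less_imp_le[OF small[of m]] by (intro mult_left_mono) auto
    have "summable (\<lambda>m. ((1 / 2) powr (\<tau> - \<sigma>) :: real) ^ m)"
      using \<tau> by (intro summable_geometric) (auto simp: half)
    moreover have "\<forall>\<^sub>F m in sequentially. ((1 / 2) powr (\<tau> - \<sigma>) :: real) ^ m = q m"
      using eventually_ge_at_top[of m0]
      by eventually_elim (auto simp: q_def hpow[symmetric] powr_add[symmetric])
    ultimately have qs: "summable q" by (subst (asm) summable_cong) assumption+
    have q0: "0 \<le> q m" for m using T0 by (auto simp: q_def)
    define u where "u i = v i * \<bar>x - y i\<bar> powr (-\<sigma>)" for i
    have "u summable_on A"
    proof (rule nonneg_bdd_above_summable_on)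
      show "0 \<le> u i" if "i \<in> A" for i using v that by (simp add: u_def)
      show "bdd_above (sum u ` {B. B \<subseteq> A \<and> finite B})"
      proof (rule bdd_aboveI2)
        fix B assume "B \<in> {B. B \<subseteq> A \<and> finite B}"
        then have B: "B \<subseteq> A" "finite B" by auto
        \<comment> \<open>Finitely many points stay away from \<open>x\<close>, so the dyadic
          decomposition of all their terms can stop at a common scale.\<close>
        have "\<exists>M. \<forall>i\<in>B. h M < \<bar>x - y i\<bar>"
        proof -
          have "\<forall>\<^sub>F M in sequentially. \<forall>i\<in>B. h M < \<bar>x - y i\<bar>"
          proof (intro eventually_ball_finite[OF B(2)] ballI)
            fix i assume "i \<in> B"
            then have "\<bar>x - y i\<bar> > 0" using x(1) B by auto
            moreover have "h \<longlonglongrightarrow> 0" unfolding h_def[abs_def] by (rule LIMSEQ_power_zero) simp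
            ultimately show "\<forall>\<^sub>F M in sequentially. h M < \<bar>x - y i\<bar>" by (intro order_tendstoD(2))
          qed
          then show ?thesis by (rule eventually_happens'[OF sequentially_bot])
        qed
        then obtain M where M: "\<And>i. i \<in> B \<Longrightarrow> h M < \<bar>x - y i\<bar>" by blast
        have "(\<Sum>i\<in>B. u i)
            \<le> (\<Sum>i\<in>B. v i * (1 + (\<Sum>m<M. 2 powr \<sigma> * h m powr (-\<sigma>) * (if \<bar>x - y i\<bar> \<le> h m then 1 else 0))))"
          unfolding u_def
        proof (intro sum_mono mult_left_mono)
          fix i assume i: "i \<in> B"
          have "\<bar>x - y i\<bar> > 0" using h0[of M] M[OF i] by linarith
          then show "\<bar>x - y i\<bar> powr (-\<sigma>) \<le> 1 + (\<Sum>m<M. 2 powr \<sigma> * h m powr (-\<sigma>) * (if \<bar>x - y i\<bar> \<le> h m then 1 else 0))"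
            using powr_neg_le_dyadic[OF _ \<sigma>(1), of "\<bar>x - y i\<bar>" M] M[OF i] by (simp add: h_def)
        qed (use B v in auto)
        also have "\<dots> = sum v B + (\<Sum>i\<in>B. \<Sum>m<M. 2 powr \<sigma> * h m powr (-\<sigma>) * w m x i)"
          by (simp add: algebra_simps sum.distrib sum_distrib_left w_def)
        also have "(\<Sum>i\<in>B. \<Sum>m<M. 2 powr \<sigma> * h m powr (-\<sigma>) * w m x i) = (\<Sum>m<M. 2 powr \<sigma> * (h m powr (-\<sigma>) * sum (w m x) B))"
          by (subst sum.swap) (simp add: sum_distrib_left mult.assoc)
        also have "\<dots> \<le> (\<Sum>m<M. 2 powr \<sigma> * q m)"
        proof (intro sum_mono mult_left_mono)
          fix m
          have "sum (w m x) B \<le> F m x" unfolding F_def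
            by (rule finite_sum_le_infsum[OF ws B(2,1)]) (auto simp: w_def v)
          then have "h m powr (-\<sigma>) * sum (w m x) B \<le> h m powr (-\<sigma>) * F m x" by (intro mult_left_mono) auto
          then show "h m powr (-\<sigma>) * sum (w m x) B \<le> q m" using qF[of m] by linarith
        qed auto
        also have "\<dots> = 2 powr \<sigma> * sum q {..<M}" by (simp add: sum_distrib_left)
        also have "\<dots> \<le> 2 powr \<sigma> * suminf q" by (intro mult_left_mono sum_le_suminf qs) (auto simp: q0)
        also have "sum v B \<le> T" unfolding T_def by (rule finite_sum_le_infsum[OF v(1) B(2,1)]) (use v in auto)
        finally show "(\<Sum>i\<in>B. u i) \<le> T + 2 powr \<sigma> * suminf q" by simp
      qed
    qed
    with x(2) show False by (simp add: u_def[abs_def])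
  qed

  have level: "hausdorff_premeasure t \<delta> (E m) \<le> ennreal (3 * T * h m powr (t - \<tau>))" if hd: "h m \<le> \<delta>" for m \<delta>
  proof -
    define K where "K = (\<lambda>x. \<lfloor>x / h m\<rfloor>) ` E m"
    \<comment> \<open>Each grid cell that meets \<open>E m\<close> provides a point with mass at
      least \<open>h m powr \<tau>\<close> within distance \<open>h m\<close>, and each
      \<open>y i\<close> is counted for at most 3 cells. Hence the number of cells times that mass
      is at most \<open>3 * T\<close>.\<close>
    have card_le: "real (card G) * h m powr \<tau> \<le> 3 * T" if G: "finite G" "G \<subseteq> K" for G
    proof -
      have "\<forall>k\<in>G. \<exists>x. x \<in> E m \<and> \<lfloor>x / h m\<rfloor> = k" using G unfolding K_def by blast
      then obtain X where X: "\<And>k. k \<in> G \<Longrightarrow> X k \<in> E m" "\<And>k. k \<in> G \<Longrightarrow> \<lfloor>X k / h m\<rfloor> = k" by metis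
      have hs: "((\<lambda>i. \<Sum>k\<in>G. w m (X k) i) has_sum (\<Sum>k\<in>G. F m (X k))) A"
        unfolding F_def by (rule has_sum_finite_sum) (rule has_sum_infsum[OF ws])
      have "real (card G) * h m powr \<tau> = (\<Sum>k\<in>G. h m powr \<tau>)" by simp
      also have "\<dots> \<le> (\<Sum>k\<in>G. F m (X k))" using X(1) by (intro sum_mono) (auto simp: E_def)
      also have "\<dots> \<le> 3 * T"
        unfolding T_def
      proof (rule has_sum_mono[OF hs has_sum_cmult_right[OF has_sum_infsum[OF v(1)]]])
        fix i assume i: "i \<in> A"
        have "(\<Sum>k\<in>G. w m (X k) i) = v i * real (card {k\<in>G. \<bar>X k / h m - y i / h m\<bar> \<le> 1})"
        proof -
          have "(\<bar>X k - y i\<bar> \<le> h m) = (\<bar>X k / h m - y i / h m\<bar> \<le> 1)" for k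
            using h0[of m] by (simp add: diff_divide_distrib[symmetric])
          then show ?thesis
            using G(1) by (simp add: w_def sum_distrib_left[symmetric] sum.If_cases Int_def)
        qed
        also have "\<dots> \<le> v i * 3"
          using card_floor_neighbours[OF G(1), of "\<lambda>k. X k / h m" "y i / h m"] X(2) i v(2) by (intro mult_left_mono) auto
        finally show "(\<Sum>k\<in>G. w m (X k) i) \<le> 3 * v i" by simp
      qed
      finally show ?thesis .
    qed
    have finK: "finite K"
    proof (rule ccontr)
      assume "infinite K"
      obtain N :: nat where "real N > 3 * T / h m powr \<tau>" using reals_Archimedean2 by blast
      moreover obtain G where "finite G" "card G = N" "G \<subseteq> K" using infinite_arbitrarily_large[OF \<open>infinite K\<close>] by blast
      ultimately show False using card_le[of G] h0[of m] by (simp add: field_simps)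
    qed
    have "hausdorff_premeasure t \<delta> (E m) \<le> ennreal (real (card K) * h m powr t)"
    proof (rule hausdorff_premeasure_finite_cover[OF \<tau>(4) finK, where J = "\<lambda>k. {real_of_int k * h m..(real_of_int k + 1) * h m}"])
      show "E m \<subseteq> (\<Union>k\<in>K. {real_of_int k * h m..(real_of_int k + 1) * h m})"
      proof
        fix x assume x: "x \<in> E m"
        have "x \<in> {real_of_int \<lfloor>x / h m\<rfloor> * h m..(real_of_int \<lfloor>x / h m\<rfloor> + 1) * h m}"
          using floor_divide_lower[OF h0[of m], of x] floor_divide_upper[OF h0[of m], of x] by simp
        then show "x \<in> (\<Union>k\<in>K. {real_of_int k * h m..(real_of_int k + 1) * h m})" using x unfolding K_def by blast
      qed
      show "diameter {real_of_int k * h m..(real_of_int k + 1) * h m} \<le> h m" for k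
        using h0[of m] by (simp add: diameter_closed_interval algebra_simps)
    qed (use h0[of m] hd in auto)
    also have "\<dots> \<le> ennreal (3 * T * h m powr (t - \<tau>))"
    proof (rule ennreal_leI)
      have "real (card K) * h m powr t = (real (card K) * h m powr \<tau>) * h m powr (t - \<tau>)"
        by (simp add: powr_add[symmetric])
      also have "\<dots> \<le> 3 * T * h m powr (t - \<tau>)" using card_le[OF finK] by (intro mult_right_mono) auto
      finally show "real (card K) * h m powr t \<le> 3 * T * h m powr (t - \<tau>)" .
    qed
    finally show ?thesis .
  qed

  show ?thesis
    unfolding hausdorff_null_iff
  proof (intro allI impI)
    fix \<delta> :: real assume \<delta>: "\<delta> > 0"
    define r :: real where "r = (1 / 2) powr (t - \<tau>)"
    have r: "0 < r" "r < 1" using \<tau> by (auto simp: r_def half)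
    have hr: "h m powr (t - \<tau>) = r ^ m" for m by (simp add: hpow r_def)
    have hl: "h \<longlonglongrightarrow> 0" unfolding h_def[abs_def] by (rule LIMSEQ_power_zero) simp
    have le: "hausdorff_premeasure t \<delta> ?E \<le> ennreal (3 * T * r ^ m0 * (1 / (1 - r)))" if m0: "h m0 \<le> \<delta>" for m0
    proof -
      have "hausdorff_premeasure t \<delta> ?E \<le> hausdorff_premeasure t \<delta> (\<Union>m. E (m0 + m))"
        by (rule hausdorff_premeasure_mono[OF cover])
      also have "\<dots> \<le> (\<Sum>m. hausdorff_premeasure t \<delta> (E (m0 + m)))" by (rule hausdorff_premeasure_UN)
      also have "\<dots> \<le> (\<Sum>m. ennreal (3 * T * r ^ m0 * r ^ m))"
      proof (intro suminf_le)
        fix m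
        have "h (m0 + m) \<le> h m0" unfolding h_def by (rule power_decreasing) auto
        then have "hausdorff_premeasure t \<delta> (E (m0 + m)) \<le> ennreal (3 * T * h (m0 + m) powr (t - \<tau>))"
          using m0 by (intro level) auto
        then show "hausdorff_premeasure t \<delta> (E (m0 + m)) \<le> ennreal (3 * T * r ^ m0 * r ^ m)"
          by (simp add: hr power_add mult.assoc)
      qed auto
      also have "\<dots> = ennreal (3 * T * r ^ m0 * (1 / (1 - r)))"
        by (intro suminf_ennreal_eq sums_mult geometric_sums) (use r T0 in auto)
      finally show ?thesis .
    qed
    have "(\<lambda>m0. ennreal (3 * T * r ^ m0 * (1 / (1 - r)))) \<longlonglongrightarrow> ennreal (3 * T * 0 * (1 / (1 - r)))"
      using r by (intro tendsto_ennrealI tendsto_intros LIMSEQ_power_zero) auto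
    moreover have "\<forall>\<^sub>F m0 in sequentially. hausdorff_premeasure t \<delta> ?E \<le> ennreal (3 * T * r ^ m0 * (1 / (1 - r)))"
      using order_tendstoD(2)[OF hl \<delta>] by eventually_elim (rule le, simp)
    ultimately have "hausdorff_premeasure t \<delta> ?E \<le> ennreal (3 * T * 0 * (1 / (1 - r)))"
      by (rule tendsto_lowerbound) simp
    then show "hausdorff_premeasure t \<delta> ?E = 0" by simp
  qed
qed

section \<open>Distance to resonance, and the dimension of the set of resonant phases\<close>

lemma half_le_sin:
  fixes v :: real
  assumes "0 \<le> v" "v \<le> pi / 2" shows "v / 2 \<le> sin v"
proof -
  have "sin 0 - 0 * cos 0 \<le> sin (v / 2) - v / 2 * cos (v / 2)"
  proof (rule DERIV_nonneg_imp_nondecreasing[where f = "\<lambda>x. sin x - x * cos x"])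
    fix x assume x: "0 \<le> x" "x \<le> v / 2"
    have "((\<lambda>x. sin x - x * cos x) has_real_derivative x * sin x) (at x)"
      by (auto intro!: derivative_eq_intros)
    moreover have "0 \<le> x * sin x" using x assms by (intro mult_nonneg_nonneg sin_ge_zero) auto
    ultimately show "\<exists>y. ((\<lambda>x. sin x - x * cos x) has_real_derivative y) (at x) \<and> 0 \<le> y" by blast
  qed (use assms in auto)
  then have 1: "v / 2 * cos (v / 2) \<le> sin (v / 2)" by simp
  have c: "0 \<le> cos (v / 2)" using assms by (intro cos_ge_zero) auto
  have cv: "0 \<le> cos v" using assms by (intro cos_ge_zero) auto
  have "v / 2 \<le> v / 2 * (1 + cos v)" using assms cv by (simp add: mult_le_cancel_left1)
  also have "\<dots> = 2 * (v / 2 * cos (v / 2)) * cos (v / 2)"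
    using cos_double_cos[of "v / 2"] by (simp add: power2_eq_square)
  also have "\<dots> \<le> 2 * sin (v / 2) * cos (v / 2)" using 1 c by (intro mult_right_mono) auto
  also have "\<dots> = sin v" using sin_double[of "v / 2"] by simp
  finally show ?thesis .
qed

text \<open>The zeros of sine in the closed interval [-pi, pi] are -pi, 0 and pi; the nearest one is
  the witness.\<close>

lemma abs_sin_ge:
  fixes u :: real
  assumes u: "-pi < u" "u < pi"
  obtains k where "k \<in> {-1, 0, 1 :: real}" and "\<bar>u - k * pi\<bar> \<le> 2 * \<bar>sin u\<bar>"
proof -
  consider "\<bar>u\<bar> \<le> pi / 2" | "u > pi / 2" | "u < - pi / 2" by linarith
  then show thesis
  proof cases
    case 1
    have "sin \<bar>u\<bar> = \<bar>sin u\<bar> \<or> sin \<bar>u\<bar> = - \<bar>sin u\<bar>" by (auto simp: abs_if)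
    then have "\<bar>u\<bar> \<le> 2 * \<bar>sin u\<bar>" using half_le_sin[of "\<bar>u\<bar>"] 1 by auto
    then show thesis by (intro that[of 0]) auto
  next
    case 2
    have "(pi - u) / 2 \<le> sin (pi - u)" using 2 u by (intro half_le_sin) auto
    then show thesis using u by (intro that[of 1]) auto
  next
    case 3
    have "(pi + u) / 2 \<le> sin (pi + u)" using 3 u by (intro half_le_sin) auto
    then show thesis using u by (intro that[of "-1"]) auto
  qed
qed

lemma summable_prod_list:
  fixes f :: "'l \<Rightarrow> real"
  assumes "f summable_on UNIV" "\<And>l. 0 \<le> f l"
  shows "(\<lambda>J. prod_list (map f J)) summable_on {J. length J = i}"
proof (induction i)
  case (Suc i)
  have nn: "0 \<le> prod_list (map f J)" for J using assms(2) by (induction J) auto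
  have eq: "{J. length J = Suc i} = (\<lambda>(l, J). l # J) ` (UNIV \<times> {J. length J = i})"
    by (auto simp: length_Suc_conv image_iff)
  have "(\<lambda>(l, J). norm (f l * prod_list (map f J))) summable_on UNIV \<times> {J. length J = i}"
    using has_sum_times_abs(1)[of f UNIV "\<lambda>J. prod_list (map f J)"] assms Suc nn by simp
  then show ?case
    unfolding eq by (subst summable_on_reindex) (auto simp: inj_on_def o_def case_prod_unfold nn assms(2))
qed auto

lemma phase_diff_norm:
  "cmod (exp (- \<i> * of_real (2 * y)) - exp (- 2 * \<i> * of_real \<eta>)) = 2 * \<bar>sin (\<eta> - y)\<bar>"
proof -
  have "exp (- \<i> * of_real (2 * y)) - exp (- 2 * \<i> * of_real \<eta>)
      = exp (- 2 * \<i> * of_real \<eta>) * (exp (\<i> * of_real (2 * (\<eta> - y))) - 1)"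
    by (simp add: algebra_simps exp_add[symmetric])
  then have "cmod (exp (- \<i> * of_real (2 * y)) - exp (- 2 * \<i> * of_real \<eta>))
      = cmod (exp (- 2 * \<i> * of_real \<eta>)) * cmod (exp (\<i> * of_real (2 * (\<eta> - y))) - 1)"
    by (simp only: norm_mult)
  also have "cmod (exp (- 2 * \<i> * of_real \<eta>)) = 1" by (simp add: norm_exp_eq_Re)
  finally have "cmod (exp (- \<i> * of_real (2 * y)) - exp (- 2 * \<i> * of_real \<eta>)) = 2 * \<bar>sin (2 * (\<eta> - y) / 2)\<bar>"
    by (simp only: dist_exp_i_1 mult_1_left)
  moreover have "2 * (\<eta> - y) / 2 = \<eta> - y" by simp
  ultimately show ?thesis by (simp only:)
qed

text \<open>A small divisor is at least the distance from \<eta> to one of three points attached to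
  the word. Taking \<beta>-th powers turns the divisor power \<open>p - 1\<close> into the
  singularity exponent \<beta>(p-1), and the coefficients into a summable family; then
  \<open>hausdorff_null_singular_sum\<close> applies for each word length and each of the three
  points.\<close>

lemma resonant_phases_null:
  fixes c \<phi> :: "'l::countable \<Rightarrow> real"
  assumes c: "\<And>l. 0 \<le> c l" and cb: "(\<lambda>l. c l powr \<beta>) summable_on UNIV"
    and \<beta>: "0 < \<beta>" "\<beta> \<le> 1" and p: "p \<ge> 2" and s: "s > \<beta> * (real p - 1)"
  shows "hausdorff_measure s {\<eta>. 0 < \<eta> \<and> \<eta> < pi \<and> \<not> nonresonant_phase p c \<phi> \<eta>} = 0"
proof -
  define \<Phi> where "\<Phi> J = sum_list (map \<phi> J)" for J
  \<comment> \<open>Half the phase reduced modulo pi to [0, pi). Then \<eta> - y(J) lies in (-pi,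
    pi), and only the translates by -pi, 0 and pi matter.\<close>
  define y where "y J = \<Phi> J / 2 - pi * \<lfloor>\<Phi> J / (2 * pi)\<rfloor>" for J
  define \<sigma> where "\<sigma> = \<beta> * (real p - 1)"
  define cc where "cc J = prod_list (map c J)" for J
  define D where "D \<eta> J = cmod (exp (- \<i> * of_real (\<Phi> J)) - exp (- 2 * \<i> * of_real \<eta>))" for \<eta> J
  have \<sigma>: "0 \<le> \<sigma>" "\<sigma> < s" using \<beta> p s by (auto simp: \<sigma>_def)
  have s0: "0 < s" using \<sigma> by simp
  have cc0: "0 \<le> cc J" for J unfolding cc_def using c by (induction J) auto
  have yint: "0 \<le> y J" "y J < pi" for J
    using floor_divide_lower[of "2 * pi" "\<Phi> J"] floor_divide_upper[of "2 * pi" "\<Phi> J"]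
    by (auto simp: y_def algebra_simps)
  have D: "D \<eta> J = 2 * \<bar>sin (\<eta> - y J)\<bar>" for \<eta> J
  proof -
    have "exp (- \<i> * complex_of_real (\<Phi> J)) = exp (- \<i> * complex_of_real (2 * y J))"
      unfolding exp_eq by (rule exI[of _ "- \<lfloor>\<Phi> J / (2 * pi)\<rfloor>"]) (simp add: y_def algebra_simps)
    then show ?thesis unfolding D_def using phase_diff_norm[of "y J" \<eta>] by simp
  qed
  \<comment> \<open>The exact resonances. They are countably many because words over a countable
    alphabet are countable.\<close>
  define R where "R = range (\<lambda>(J, k::int). y J + k * pi)"
  have R: "hausdorff_measure s R = 0"
    by (rule hausdorff_measure_countable[OF s0]) (simp add: R_def)
  have ccb: "(\<lambda>J. cc J powr \<beta>) summable_on {J. length J = i}" for i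
  proof -
    have "cc J powr \<beta> = prod_list (map (\<lambda>l. c l powr \<beta>) J)" for J
      unfolding cc_def using c by (induction J) (auto simp: powr_mult prod_list_nonneg)
    then show ?thesis using summable_prod_list[OF cb] by simp
  qed
  define B where "B i k = {x. (\<forall>J\<in>{J. length J = i}. y J + k * pi \<noteq> x) \<and>
     \<not> (\<lambda>J. cc J powr \<beta> * \<bar>x - (y J + k * pi)\<bar> powr (-\<sigma>)) summable_on {J. length J = i}}" for i :: nat and k :: real
  have B: "hausdorff_measure s (B i k) = 0" for i k
    unfolding B_def by (rule hausdorff_null_singular_sum[OF ccb _ \<sigma>]) simp
  have sub: "{\<eta>. 0 < \<eta> \<and> \<eta> < pi \<and> \<not> nonresonant_phase p c \<phi> \<eta>} \<subseteq> R \<union> (\<Union>i. B i (-1) \<union> (B i 0 \<union> B i 1))"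
  proof (rule subsetI, rule ccontr)
    fix \<eta> assume "\<eta> \<in> {\<eta>. 0 < \<eta> \<and> \<eta> < pi \<and> \<not> nonresonant_phase p c \<phi> \<eta>}"
    then have eta: "0 < \<eta>" "\<eta> < pi" and res: "\<not> nonresonant_phase p c \<phi> \<eta>" by auto
    assume no: "\<eta> \<notin> R \<union> (\<Union>i. B i (-1) \<union> (B i 0 \<union> B i 1))"
    have nR: "y J + of_int k * pi \<noteq> \<eta>" for J and k :: int using no unfolding R_def by auto
    have nR': "y J + k * pi \<noteq> \<eta>" if "k \<in> {-1, 0, 1}" for J and k :: real
      using that nR[of J "-1"] nR[of J 0] nR[of J 1] by auto
    have Dge: "\<exists>k\<in>{-1, 0, 1 :: real}. \<bar>\<eta> - (y J + k * pi)\<bar> \<le> D \<eta> J" for J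
    proof -
      have u: "-pi < \<eta> - y J" "\<eta> - y J < pi" using yint[of J] eta by auto
      from abs_sin_ge[OF u] show ?thesis unfolding D by (metis diff_diff_eq)
    qed
    have Dpos: "D \<eta> J > 0" for J
      using Dge[of J] nR' by (smt (verit) zero_less_abs_iff)
    define trm where "trm k J = cc J powr \<beta> * \<bar>\<eta> - (y J + k * pi)\<bar> powr (-\<sigma>)" for k J
    have terms: "(cc J / D \<eta> J ^ (p - 1)) powr \<beta> \<le> trm (-1) J
        + (trm 0 J + trm 1 J)" for J
    proof -
      obtain k where k: "k \<in> {-1, 0, 1 :: real}" "\<bar>\<eta> - (y J + k * pi)\<bar> \<le> D \<eta> J" using Dge by blast
      have pos: "0 < \<bar>\<eta> - (y J + k * pi)\<bar>" using nR'[OF k(1), of J] by simp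
      have "(cc J / D \<eta> J ^ (p - 1)) powr \<beta> = cc J powr \<beta> * D \<eta> J powr (-\<sigma>)"
      proof -
        have "D \<eta> J ^ (p - 1) = D \<eta> J powr (real p - 1)"
          using Dpos[of J] p by (simp add: powr_realpow[symmetric] of_nat_diff)
        then show ?thesis using Dpos[of J] cc0[of J]
          by (simp add: powr_divide powr_powr powr_minus_divide \<sigma>_def mult.commute)
      qed
      also have "\<dots> \<le> trm k J"
        unfolding trm_def using k(2) pos \<sigma> by (intro mult_left_mono powr_mono2') auto
      also have "\<dots> \<le> trm (-1) J
        + (trm 0 J + trm 1 J)"
      proof -
        have "0 \<le> trm q J" for q by (simp add: trm_def)
        from this[of "-1"] this[of 0] this[of 1] k(1) show ?thesis by auto
      qed
      finally show ?thesis .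
    qed
    have part: "trm k summable_on {J. length J = i}"
      if k: "k \<in> {-1, 0, 1}" for k :: real and i
    proof (rule ccontr)
      assume "\<not> ?thesis"
      then have "\<eta> \<in> B i k" unfolding B_def trm_def[abs_def] using nR'[OF k] by blast
      then show False using no k by auto
    qed
    have "(\<lambda>J. cc J / D \<eta> J ^ (p - 1)) summable_on {J. length J = i}" for i
    proof (rule summable_on_of_powr[OF _ _ \<beta>])
      show "(\<lambda>J. (cc J / D \<eta> J ^ (p - 1)) powr \<beta>) summable_on {J. length J = i}"
        by (rule summable_on_comparison_test[OF summable_on_add[OF part summable_on_add[OF part part]] terms]) auto
    qed (use cc0 Dpos in \<open>auto simp: less_imp_le\<close>)
    moreover have "exp (- \<i> * of_real (\<Phi> J)) \<noteq> exp (- 2 * \<i> * of_real \<eta>)" for J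
      using Dpos[of J] by (auto simp: D_def)
    ultimately have "nonresonant_phase p c \<phi> \<eta>"
      unfolding nonresonant_phase_def D_def cc_def \<Phi>_def by blast
    with res show False by contradiction
  qed
  show ?thesis
    by (rule hausdorff_null_mono[OF _ sub]) (intro hausdorff_null_Un hausdorff_null_UN R B)
qed

section \<open>Spectral measure and bounded solutions\<close>

text \<open>The polynomials of the second kind. The initial value \<open>1 / a 1\<close> makes their
  Wronskian with the orthonormal polynomials equal to 1.\<close>

fun second_kind :: "(nat \<Rightarrow> real) \<Rightarrow> (nat \<Rightarrow> real) \<Rightarrow> real \<Rightarrow> nat \<Rightarrow> real" where
  "second_kind a b x 0 = 0"
| "second_kind a b x (Suc 0) = 1 / a 1"
| "second_kind a b x (Suc (Suc n)) =
     ((x - b (n + 2)) * second_kind a b x (Suc n) - a (n + 1) * second_kind a b x n) / a (n + 2)"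

locale jacobi_measure = real_distribution \<rho> for \<rho> :: "real measure" +
  fixes a b :: "nat \<Rightarrow> real" and P :: "nat \<Rightarrow> real poly" and Amax :: real
  assumes moments: "\<And>k::nat. integrable \<rho> (\<lambda>x. x ^ k)"
    and orth: "orthonormal_polynomials \<rho> P"
    and a_pos: "\<And>n. n \<ge> 1 \<Longrightarrow> a n > 0"
    and a_le: "\<And>n. n \<ge> 1 \<Longrightarrow> a n \<le> Amax"
    and P_rec: "\<And>n x. x * poly (P n) x = a (n + 1) * poly (P (n + 1)) x + b (n + 1) * poly (P n) x +
             (if n = 0 then 0 else a n * poly (P (n - 1)) x)"
begin

definition pp :: "nat \<Rightarrow> real \<Rightarrow> real" where "pp n x = poly (P n) x"
definition qq :: "nat \<Rightarrow> real \<Rightarrow> real" where "qq n x = second_kind a b x n"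
text \<open>With a fixed bound the set is closed; the set where all solutions are bounded is the
  union over integer bounds, hence Borel.\<close>

definition bounded_at :: "real \<Rightarrow> real set" where
  "bounded_at M = {x. \<forall>n. \<bar>pp n x\<bar> \<le> M \<and> \<bar>qq n x\<bar> \<le> M}"

lemma Amax_pos: "Amax > 0" using a_pos[of 1] a_le[of 1] by simp

lemma integrable_poly: "integrable \<rho> (\<lambda>x. poly q x)"
  unfolding poly_altdef by (intro Bochner_Integration.integrable_sum integrable_mult_right moments)

lemma pp_0 [simp]: "pp 0 x = 1"
proof -
  have deg: "degree (P 0) = 0" and lc: "lead_coeff (P 0) > 0"
    and int: "(\<integral>x. poly (P 0) x * poly (P 0) x \<partial>\<rho>) = 1"
    using orth unfolding orthonormal_polynomials_def by simp_all metis
  obtain c where c: "P 0 = [:c:]" using degree_eq_zeroE[OF deg] by blast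
  have "c > 0" using lc by (simp add: c)
  moreover have "c\<^sup>2 = 1" using int using prob_space by (simp add: c power2_eq_square)
  ultimately have "c = 1" by (simp add: power2_eq_1_iff)
  then show ?thesis by (simp add: pp_def c)
qed

lemma integrable_pp: "integrable \<rho> (pp n)"
  unfolding pp_def by (rule integrable_poly)

lemma integrable_pp_mult: "integrable \<rho> (\<lambda>x. pp m x * pp n x)"
  unfolding pp_def poly_mult[symmetric] by (rule integrable_poly)

lemma integral_pp_mult: "(\<integral>x. pp m x * pp n x \<partial>\<rho>) = (if m = n then 1 else 0)"
  using orth unfolding orthonormal_polynomials_def pp_def by auto

lemma integral_pp: "(\<integral>x. pp n x \<partial>\<rho>) = (if n = 0 then 1 else 0)"
  using integral_pp_mult[of n 0] by simp

lemma pp_1: "a 1 * pp 1 x = x - b 1"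
  using P_rec[of x 0] by (simp add: pp_def[symmetric])

lemma pp_Suc_Suc: "a (n + 2) * pp (n + 2) x = (x - b (n + 2)) * pp (n + 1) x - a (n + 1) * pp n x"
  using P_rec[of x "n + 1"] by (simp add: pp_def[symmetric] algebra_simps)

lemma qq_simps: "qq 0 x = 0" "a 1 * qq 1 x = 1"
  "a (n + 2) * qq (n + 2) x = (x - b (n + 2)) * qq (n + 1) x - a (n + 1) * qq n x"
  using a_pos[of 1] a_pos[of "n + 2"] by (simp_all add: qq_def)

lemma continuous_pp: "continuous_on UNIV (pp n)"
  unfolding pp_def by (intro continuous_intros)

lemma continuous_qq: "continuous_on UNIV (qq n)"
proof (induction n rule: induct_nat_012)
  case 0 show ?case by (simp add: qq_def)
next
  case 1 show ?case by (simp add: qq_def)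
next
  case (ge2 n)
  have "qq (Suc (Suc n)) = (\<lambda>x. ((x - b (n + 2)) * qq (Suc n) x - a (n + 1) * qq n x) / a (n + 2))"
    by (simp add: qq_def fun_eq_iff)
  then show ?case using a_pos[of "n + 2"] ge2 by (simp only:) (intro continuous_intros, auto)
qed

lemma closed_bounded_at: "closed (bounded_at M)"
proof -
  have "bounded_at M = (\<Inter>n. {x. \<bar>pp n x\<bar> \<le> M} \<inter> {x. \<bar>qq n x\<bar> \<le> M})"
    by (auto simp: bounded_at_def)
  moreover have "closed (\<Inter>n. {x. \<bar>pp n x\<bar> \<le> M} \<inter> {x. \<bar>qq n x\<bar> \<le> M})"
    by (intro closed_INT ballI closed_Int closed_Collect_le continuous_intros continuous_pp continuous_qq)
  ultimately show ?thesis by simp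
qed

lemma wronskian: "a (n + 1) * (pp n x * qq (n + 1) x - pp (n + 1) x * qq n x) = 1"
proof (induction n)
  case 0
  show ?case using qq_simps(1,2)[of x] by simp
next
  case (Suc n)
  have "a (n + 2) * (pp (n + 1) x * qq (n + 2) x - pp (n + 2) x * qq (n + 1) x)
      = pp (n + 1) x * (a (n + 2) * qq (n + 2) x) - (a (n + 2) * pp (n + 2) x) * qq (n + 1) x"
    by (simp add: algebra_simps)
  also have "\<dots> = a (n + 1) * (pp n x * qq (n + 1) x - pp (n + 1) x * qq n x)"
    unfolding pp_Suc_Suc qq_simps(3) by (simp add: algebra_simps)
  finally show ?case using Suc by simp
qed

text \<open>Variation of parameters: \<open>A\<close> and \<open>B\<close> are the coordinates of a solution \<open>y\<close> at the
  energy \<open>z\<close> in the basis of the solutions at \<open>x\<close>.\<close>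

context
  fixes x M :: real and z :: complex and y A B :: "nat \<Rightarrow> complex"
  assumes x: "x \<in> bounded_at M"
    and y: "\<And>n. of_real (a (n + 2)) * y (n + 2) = (z - of_real (b (n + 2))) * y (n + 1) - of_real (a (n + 1)) * y n"
    and A: "\<And>n. A n = of_real (a (n + 1)) * (y n * of_real (qq (n + 1) x) - y (n + 1) * of_real (qq n x))"
    and B: "\<And>n. B n = - of_real (a (n + 1)) * (y n * of_real (pp (n + 1) x) - y (n + 1) * of_real (pp n x))"
begin

lemma M_bounds: "\<bar>pp n x\<bar> \<le> M" "\<bar>qq n x\<bar> \<le> M" "1 \<le> M"
proof -
  show M: "\<bar>pp n x\<bar> \<le> M" "\<bar>qq n x\<bar> \<le> M" for n using x unfolding bounded_at_def by auto
  show "1 \<le> M" using M(1)[of 0] by simp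
qed

text \<open>\<open>A\<close> and \<open>B\<close> are Wronskians of \<open>y\<close> with the two
  basis solutions. A Wronskian of solutions at energies z and x changes per step by the product of
  the solutions times the difference of the energies.\<close>

lemma variation_step:
  "A (n + 1) = A n + (of_real x - z) * y (n + 1) * of_real (qq (n + 1) x)"
  "B (n + 1) = B n + (z - of_real x) * y (n + 1) * of_real (pp (n + 1) x)"
proof -
  have p: "complex_of_real (a (n + 2)) * of_real (pp (n + 2) x) = (of_real x - of_real (b (n + 2))) * of_real (pp (n + 1) x) - of_real (a (n + 1)) * of_real (pp n x)"
    using arg_cong[OF pp_Suc_Suc[of n x], of complex_of_real] by simp
  have q: "complex_of_real (a (n + 2)) * of_real (qq (n + 2) x) = (of_real x - of_real (b (n + 2))) * of_real (qq (n + 1) x) - of_real (a (n + 1)) * of_real (qq n x)"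
    using arg_cong[OF qq_simps(3)[of n x], of complex_of_real] by simp
  have "A (n + 1) = y (n + 1) * (of_real (a (n + 2)) * of_real (qq (n + 2) x)) - (of_real (a (n + 2)) * y (n + 2)) * of_real (qq (n + 1) x)"
    unfolding A by (simp add: algebra_simps)
  then show "A (n + 1) = A n + (of_real x - z) * y (n + 1) * of_real (qq (n + 1) x)"
    unfolding q y A by (simp add: algebra_simps)
  have "B (n + 1) = - (y (n + 1) * (of_real (a (n + 2)) * of_real (pp (n + 2) x))) + (of_real (a (n + 2)) * y (n + 2)) * of_real (pp (n + 1) x)"
    unfolding B by (simp add: algebra_simps)
  then show "B (n + 1) = B n + (z - of_real x) * y (n + 1) * of_real (pp (n + 1) x)"
    unfolding p y B by (simp add: algebra_simps)
qed

lemma variation_repr: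
  "y n = A n * of_real (pp n x) + B n * of_real (qq n x)"
  "y (n + 1) = A n * of_real (pp (n + 1) x) + B n * of_real (qq (n + 1) x)"
proof -
  define w where "w = complex_of_real (a (n + 1)) * (of_real (pp n x) * of_real (qq (n + 1) x) - of_real (pp (n + 1) x) * of_real (qq n x))"
  have w: "w = 1"
    using arg_cong[OF wronskian[of n x], of complex_of_real] by (simp add: w_def)
  have "A n * of_real (pp n x) + B n * of_real (qq n x) = y n * w"
    unfolding A B w_def by (simp add: algebra_simps)
  then show "y n = A n * of_real (pp n x) + B n * of_real (qq n x)" unfolding w by simp
  have "A n * of_real (pp (n + 1) x) + B n * of_real (qq (n + 1) x) = y (n + 1) * w"
    unfolding A B w_def by (simp add: algebra_simps)
  then show "y (n + 1) = A n * of_real (pp (n + 1) x) + B n * of_real (qq (n + 1) x)" unfolding w by simp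
qed

lemma variation_increment:
  "cmod (A (n + 1) - A n) + cmod (B (n + 1) - B n) \<le> 2 * M\<^sup>2 * cmod (z - of_real x) * (cmod (A n) + cmod (B n))"
proof -
  have "cmod (y (n + 1)) \<le> cmod (A n) * M + cmod (B n) * M"
    unfolding variation_repr(2)[of n]
    by (rule order_trans[OF norm_triangle_ineq]) (auto simp: norm_mult intro!: add_mono mult_left_mono M_bounds)
  then have y1: "cmod (y (n + 1)) \<le> M * (cmod (A n) + cmod (B n))" by (simp add: algebra_simps)
  have bd: "cmod (d * y (n + 1) * of_real r) \<le> cmod d * (M * (cmod (A n) + cmod (B n))) * M" if "\<bar>r\<bar> \<le> M" for d r
    unfolding norm_mult using that y1 M_bounds(3) by (intro mult_mono mult_nonneg_nonneg) auto
  have 1: "cmod (A (n + 1) - A n) \<le> cmod (of_real x - z) * (M * (cmod (A n) + cmod (B n))) * M"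
    unfolding variation_step(1) using bd[OF M_bounds(2)[of "n + 1"], of "of_real x - z"] by simp
  have 2: "cmod (B (n + 1) - B n) \<le> cmod (z - of_real x) * (M * (cmod (A n) + cmod (B n))) * M"
    unfolding variation_step(2) using bd[OF M_bounds(1)[of "n + 1"], of "z - of_real x"] by simp
  have "cmod (A (n + 1) - A n) + cmod (B (n + 1) - B n) \<le>
      cmod (z - of_real x) * (M * (cmod (A n) + cmod (B n))) * M + cmod (z - of_real x) * (M * (cmod (A n) + cmod (B n))) * M"
    using add_mono[OF 1 2] by (simp only: norm_minus_commute)
  also have "\<dots> = 2 * M\<^sup>2 * cmod (z - of_real x) * (cmod (A n) + cmod (B n))"
    by (simp add: power2_eq_square algebra_simps)
  finally show ?thesis .
qed

text \<open>A discrete Gronwall estimate; 3 bounds exp 1.\<close>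

lemma variation_upper:
  fixes N n :: nat
  assumes "2 * M\<^sup>2 * cmod (z - of_real x) * N \<le> 1" and "n \<le> N"
  shows "cmod (A n) + cmod (B n) \<le> 3 * (cmod (A 0) + cmod (B 0))"
proof -
  define k where "k = 2 * M\<^sup>2 * cmod (z - of_real x)"
  have k0: "0 \<le> k" by (simp add: k_def)
  have le: "cmod (A n) + cmod (B n) \<le> exp (k * n) * (cmod (A 0) + cmod (B 0))" for n
  proof (induction n)
    case (Suc n)
    have "cmod (A (n + 1)) + cmod (B (n + 1)) \<le> (cmod (A n) + cmod (B n)) + (cmod (A (n + 1) - A n) + cmod (B (n + 1) - B n))"
      using norm_triangle_ineq2[of "A (n + 1)" "A n"] norm_triangle_ineq2[of "B (n + 1)" "B n"] by simp
    also have "\<dots> \<le> (1 + k) * (cmod (A n) + cmod (B n))"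
      using variation_increment[of n] by (simp add: k_def algebra_simps)
    also have "\<dots> \<le> exp k * (exp (k * n) * (cmod (A 0) + cmod (B 0)))"
      using Suc k0 by (intro mult_mono exp_ge_add_one_self) auto
    finally have "cmod (A (n + 1)) + cmod (B (n + 1)) \<le> (exp k * exp (k * n)) * (cmod (A 0) + cmod (B 0))"
      by (simp only: mult.assoc)
    then show ?case by (simp add: mult_exp_exp algebra_simps)
  qed simp
  have "k * n \<le> k * N" using assms(2) k0 by (intro mult_left_mono) auto
  then have "exp (k * n) \<le> exp 1" using assms(1) by (simp add: k_def)
  also have "\<dots> \<le> 3" using exp_le by simp
  finally have "exp (k * n) * (cmod (A 0) + cmod (B 0)) \<le> 3 * (cmod (A 0) + cmod (B 0))"
    by (intro mult_right_mono) auto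
  then show ?thesis using le[of n] by linarith
qed

text \<open>Each step shrinks the coordinates at most by the factor \<open>1 - k\<close>, and
  Bernoulli's inequality keeps the product of at most \<open>N\<close> such factors above
  1/2.\<close>

lemma variation_lower:
  fixes N n :: nat
  assumes "2 * M\<^sup>2 * cmod (z - of_real x) * N \<le> 1 / 2" and "n \<le> N"
  shows "(cmod (A 0) + cmod (B 0)) / 2 \<le> cmod (A n) + cmod (B n)"
proof (cases "N = 0")
  case False
  define k where "k = 2 * M\<^sup>2 * cmod (z - of_real x)"
  have k0: "0 \<le> k" by (simp add: k_def)
  have "k * 1 \<le> k * N" using False k0 by (intro mult_left_mono) auto
  then have k1: "k \<le> 1 / 2" using assms(1) by (simp add: k_def)
  have le: "(1 - k) ^ n * (cmod (A 0) + cmod (B 0)) \<le> cmod (A n) + cmod (B n)" for n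
  proof (induction n)
    case (Suc n)
    have "(1 - k) * ((1 - k) ^ n * (cmod (A 0) + cmod (B 0))) \<le> (1 - k) * (cmod (A n) + cmod (B n))"
      using Suc k1 by (intro mult_left_mono) auto
    also have "\<dots> \<le> (cmod (A n) + cmod (B n)) - (cmod (A (n + 1) - A n) + cmod (B (n + 1) - B n))"
      using variation_increment[of n] by (simp add: k_def algebra_simps)
    also have "\<dots> \<le> cmod (A (n + 1)) + cmod (B (n + 1))"
      using norm_triangle_ineq2[of "A n" "A (n + 1)"] norm_triangle_ineq2[of "B n" "B (n + 1)"]
      by (simp add: norm_minus_commute)
    finally show ?case by (simp add: mult.assoc)
  qed simp
  have "k * n \<le> k * N" using assms(2) k0 by (intro mult_left_mono) auto
  then have "1 / 2 \<le> 1 + n * (- k)" using assms(1) by (simp add: k_def mult.commute)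
  also have "\<dots> \<le> (1 + - k) ^ n" by (rule Bernoulli_inequality) (use k1 in auto)
  finally have "1 / 2 * (cmod (A 0) + cmod (B 0)) \<le> (1 - k) ^ n * (cmod (A 0) + cmod (B 0))"
    by (intro mult_right_mono) auto
  then show ?thesis using le[of n] by simp
qed (use assms in auto)

end

end

section \<open>Upper bound for the measure of short intervals\<close>

context jacobi_measure
begin

definition cfloor :: "real \<Rightarrow> real" where "cfloor M = 1 / (2 * Amax\<^sup>2 * M\<^sup>2)"

text \<open>The Wronskian equals 1 while \<open>a\<close> and \<open>qq\<close> are bounded, so two
  consecutive values of \<open>pp\<close> cannot both be small.\<close>

lemma pp_pair_lower:
  assumes x: "x \<in> bounded_at M"
  shows "cfloor M \<le> (pp n x)\<^sup>2 + (pp (n + 1) x)\<^sup>2"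
proof -
  have bd: "\<bar>qq n x\<bar> \<le> M" "\<bar>qq (n + 1) x\<bar> \<le> M" and M1: "1 \<le> M"
    using x pp_0[of x] unfolding bounded_at_def by (auto, metis abs_1)
  define u v where "u = \<bar>pp n x\<bar>" and "v = \<bar>pp (n + 1) x\<bar>"
  have uv: "0 \<le> u" "0 \<le> v" by (auto simp: u_def v_def)
  have an: "0 < a (n + 1)" "a (n + 1) \<le> Amax" using a_pos[of "n + 1"] a_le[of "n + 1"] by auto
  have "1 = \<bar>a (n + 1) * (pp n x * qq (n + 1) x - pp (n + 1) x * qq n x)\<bar>" by (simp only: wronskian abs_1)
  also have "\<dots> \<le> a (n + 1) * (\<bar>pp n x * qq (n + 1) x\<bar> + \<bar>pp (n + 1) x * qq n x\<bar>)"
    unfolding abs_mult[of "a (n + 1)"] abs_of_pos[OF an(1)] using an(1)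
    by (intro mult_left_mono abs_triangle_ineq4) auto
  also have "\<dots> \<le> Amax * (u * M + v * M)"
    unfolding abs_mult u_def v_def using an bd M1 by (intro mult_mono add_mono) auto
  finally have "1 \<le> Amax * M * (u + v)" by (simp add: algebra_simps)
  then have "1 \<le> (Amax * M * (u + v))\<^sup>2" using Amax_pos M1 uv by (simp add: one_le_power)
  also have "\<dots> \<le> Amax\<^sup>2 * M\<^sup>2 * (2 * (u\<^sup>2 + v\<^sup>2))"
  proof -
    have "(u + v)\<^sup>2 \<le> 2 * (u\<^sup>2 + v\<^sup>2)" using sum_squares_ge_zero[of "u - v" 0] by (simp add: power2_eq_square algebra_simps)
    then show ?thesis unfolding power_mult_distrib by (intro mult_left_mono) auto
  qed
  finally have "1 \<le> (2 * Amax\<^sup>2 * M\<^sup>2) * (u\<^sup>2 + v\<^sup>2)" by (simp add: algebra_simps)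
  then show ?thesis using Amax_pos M1
    by (simp add: cfloor_def u_def v_def pos_divide_le_eq mult.commute)
qed

lemma cfloor_pos: "M \<ge> 1 \<Longrightarrow> 0 < cfloor M"
  using Amax_pos by (simp add: cfloor_def)

lemma sum_pairs_le:
  fixes u :: "nat \<Rightarrow> real"
  assumes "\<And>n. 0 \<le> u n" shows "(\<Sum>n<N. u n + u (n + 1)) \<le> 2 * (\<Sum>n\<le>N. u n)"
proof -
  have "(\<Sum>n<N. u n) \<le> (\<Sum>n\<le>N. u n)" by (rule sum_mono2) (use assms in auto)
  moreover have "(\<Sum>n<N. u (n + 1)) \<le> (\<Sum>n\<le>N. u n)"
    using assms[of 0] by (induction N) auto
  ultimately show ?thesis by (simp add: sum.distrib)
qed

lemma sum_pp_lower:
  assumes x: "x \<in> bounded_at M"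
  shows "N * cfloor M / 2 \<le> (\<Sum>n\<le>N. (pp n x)\<^sup>2)"
proof -
  have "N * cfloor M = (\<Sum>n<N. cfloor M)" by simp
  also have "\<dots> \<le> (\<Sum>n<N. (pp n x)\<^sup>2 + (pp (n + 1) x)\<^sup>2)" by (intro sum_mono pp_pair_lower[OF x])
  also have "\<dots> \<le> 2 * (\<Sum>n\<le>N. (pp n x)\<^sup>2)" by (rule sum_pairs_le) simp
  finally show ?thesis by simp
qed

lemma integral_kernel_square:
  "integrable \<rho> (\<lambda>t. (\<Sum>n\<le>N. c n * pp n t)\<^sup>2)" "(\<integral>t. (\<Sum>n\<le>N. c n * pp n t)\<^sup>2 \<partial>\<rho>) = (\<Sum>n\<le>N. (c n)\<^sup>2)"
proof -
  have eq: "(\<Sum>n\<le>N. c n * pp n t)\<^sup>2 = (\<Sum>m\<le>N. \<Sum>n\<le>N. (c m * c n) * (pp m t * pp n t))" for t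
    unfolding power2_eq_square sum_product by (simp add: mult_ac)
  show "integrable \<rho> (\<lambda>t. (\<Sum>n\<le>N. c n * pp n t)\<^sup>2)"
    unfolding eq by (intro Bochner_Integration.integrable_sum integrable_mult_right integrable_pp_mult)
  have "(\<integral>t. (\<Sum>n\<le>N. c n * pp n t)\<^sup>2 \<partial>\<rho>) = (\<Sum>m\<le>N. \<Sum>n\<le>N. (c m * c n) * (if m = n then 1 else 0))"
    unfolding eq by (subst Bochner_Integration.integral_sum, (intro Bochner_Integration.integrable_sum integrable_mult_right integrable_pp_mult),
      subst Bochner_Integration.integral_sum, (intro integrable_mult_right integrable_pp_mult), simp add: integral_pp_mult)
  also have "\<dots> = (\<Sum>n\<le>N. (c n)\<^sup>2)"
    by (simp add: if_distrib[of "\<lambda>x. _ * x"] power2_eq_square cong: if_cong)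
  finally show "(\<integral>t. (\<Sum>n\<le>N. c n * pp n t)\<^sup>2 \<partial>\<rho>) = (\<Sum>n\<le>N. (c n)\<^sup>2)" .
qed

text \<open>In the basis at \<open>x\<close>, the solution \<open>pp n t\<close> starts with
  coordinates (1, t - x). Coordinates of total size at most 6 increase the deviation from (1, 0) by
  at most 12 \<open>M\<^sup>2\<close> |t - x| per step.\<close>

lemma pp_perturbation:
  fixes N n :: nat
  assumes x: "x \<in> bounded_at M" and N: "2 * M\<^sup>2 * \<bar>t - x\<bar> * N \<le> 1" and t: "\<bar>t - x\<bar> \<le> 1" and n: "n \<le> N" and N1: "N \<ge> 1"
  shows "\<bar>pp n t - pp n x\<bar> \<le> M * ((1 + 12 * M\<^sup>2) * (\<bar>t - x\<bar> * N))"
proof -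
  define y where "y n = complex_of_real (pp n t)" for n
  define A where "A n = of_real (a (n + 1)) * (y n * of_real (qq (n + 1) x) - y (n + 1) * of_real (qq n x))" for n
  define B where "B n = - of_real (a (n + 1)) * (y n * of_real (pp (n + 1) x) - y (n + 1) * of_real (pp n x))" for n
  have y: "of_real (a (n + 2)) * y (n + 2) = (of_real t - of_real (b (n + 2))) * y (n + 1) - of_real (a (n + 1)) * y n" for n
    using arg_cong[OF pp_Suc_Suc[of n t], of complex_of_real] by (simp add: y_def)
  note var = x y A_def B_def
  have M: "\<bar>pp n x\<bar> \<le> M" "\<bar>qq n x\<bar> \<le> M" "1 \<le> M" for n by (rule M_bounds[OF var])+
  have nrm: "cmod (of_real t - of_real x) = \<bar>t - x\<bar>" by (metis norm_of_real of_real_diff)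
  have A0: "A 0 = 1"
  proof -
    have "A 0 = complex_of_real (a 1 * qq 1 x)" by (simp add: A_def y_def qq_simps(1))
    then show ?thesis by (simp only: qq_simps(2) of_real_1)
  qed
  have B0: "B 0 = of_real (t - x)"
  proof -
    have "B 0 = complex_of_real (a 1 * pp 1 t - a 1 * pp 1 x)" by (simp add: B_def y_def algebra_simps)
    then show ?thesis unfolding pp_1 by simp
  qed
  have H: "cmod (A k) + cmod (B k) \<le> 6" if "k \<le> N" for k
  proof -
    have "cmod (A k) + cmod (B k) \<le> 3 * (cmod (A 0) + cmod (B 0))"
      by (rule variation_upper[OF var _ that]) (use N nrm in simp)
    also have "\<dots> \<le> 6" unfolding A0 B0 norm_of_real norm_one using t by simp
    finally show ?thesis .
  qed
  have dev: "cmod (A k - 1) + cmod (B k) \<le> \<bar>t - x\<bar> * (1 + 12 * M\<^sup>2 * k)" if "k \<le> N" for k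
    using that
  proof (induction k)
    case 0
    show ?case by (simp add: A0 B0)
  next
    case (Suc k)
    have "cmod (A (k + 1) - 1) + cmod (B (k + 1)) \<le> (cmod (A k - 1) + cmod (B k)) + (cmod (A (k + 1) - A k) + cmod (B (k + 1) - B k))"
      using norm_triangle_ineq[of "A k - 1" "A (k + 1) - A k"] norm_triangle_ineq[of "B k" "B (k + 1) - B k"] by simp
    also have "\<dots> \<le> \<bar>t - x\<bar> * (1 + 12 * M\<^sup>2 * k) + 2 * M\<^sup>2 * \<bar>t - x\<bar> * (cmod (A k) + cmod (B k))"
      using Suc variation_increment[OF var, of k] by (intro add_mono) (auto simp: nrm)
    also have "\<dots> \<le> \<bar>t - x\<bar> * (1 + 12 * M\<^sup>2 * k) + 2 * M\<^sup>2 * \<bar>t - x\<bar> * 6"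
      using Suc.prems by (intro add_left_mono mult_left_mono H) auto
    also have "\<dots> = \<bar>t - x\<bar> * (1 + 12 * M\<^sup>2 * Suc k)" by (simp add: algebra_simps)
    finally show ?case by simp
  qed
  have "complex_of_real (pp n t - pp n x) = (A n - 1) * of_real (pp n x) + B n * of_real (qq n x)"
    using variation_repr(1)[OF var, of n] by (simp add: y_def algebra_simps)
  then have "\<bar>pp n t - pp n x\<bar> = cmod ((A n - 1) * of_real (pp n x) + B n * of_real (qq n x))"
    by (metis norm_of_real)
  also have "\<dots> \<le> cmod (A n - 1) * M + cmod (B n) * M"
    by (rule order_trans[OF norm_triangle_ineq]) (auto simp: norm_mult intro!: add_mono mult_left_mono M)
  also have "\<dots> = M * (cmod (A n - 1) + cmod (B n))" by (simp add: algebra_simps)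
  also have "\<dots> \<le> M * (\<bar>t - x\<bar> * (1 + 12 * M\<^sup>2 * n))" using M by (intro mult_left_mono dev n) auto
  also have "\<dots> \<le> M * ((1 + 12 * M\<^sup>2) * (\<bar>t - x\<bar> * N))"
  proof -
    have "1 + 12 * M\<^sup>2 * n \<le> 1 * N + 12 * M\<^sup>2 * N" using N1 n by (intro add_mono mult_left_mono) auto
    then have "\<bar>t - x\<bar> * (1 + 12 * M\<^sup>2 * n) \<le> \<bar>t - x\<bar> * (1 * N + 12 * M\<^sup>2 * N)" by (intro mult_left_mono) auto
    then show ?thesis using M by (intro mult_left_mono) (auto simp: algebra_simps)
  qed
  finally show ?thesis .
qed

text \<open>The polynomial \<open>\<Sum>n\<le>N. p\<^sub>n(x) p\<^sub>n(t)\<close> is an almost extremal function for the Christoffel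
  function at \<open>x\<close>, and it remains comparable to its value at \<open>t = x\<close> on the scale \<open>1 / N\<close>.\<close>

lemma measure_interval_upper:
  assumes M: "M \<ge> 1"
  obtains \<delta> C where "\<delta> > 0" "C > 0"
    "\<And>x N. x \<in> bounded_at M \<Longrightarrow> N \<ge> 1 \<Longrightarrow> measure \<rho> {x - \<delta> / real N..x + \<delta> / real N} \<le> C / real N"
proof -
  define c where "c = cfloor M"
  \<comment> \<open>Chosen so that on the interval the kernel deviates from its central value
    \<open>K\<close> by at most N D \<delta> / 4, hence by at most N c / 4, which is at most K / 2.
    The other bounds on \<delta> are the hypotheses of \<open>pp_perturbation\<close>.\<close>
  define D where "D = 8 * M\<^sup>2 * (1 + 12 * M\<^sup>2)"
  define \<delta> where "\<delta> = min 1 (min (1 / (2 * M\<^sup>2)) (c / D))"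
  have c0: "c > 0" unfolding c_def by (rule cfloor_pos[OF M])
  have D0: "D > 0" using M by (auto simp: D_def intro!: mult_pos_pos add_pos_nonneg)
  have \<delta>: "\<delta> > 0" "\<delta> \<le> 1" "\<delta> \<le> 1 / (2 * M\<^sup>2)" "\<delta> \<le> c / D" using c0 D0 M by (auto simp: \<delta>_def)
  have main: "measure \<rho> {x - \<delta> / real N..x + \<delta> / real N} \<le> (8 / c) / real N" if x: "x \<in> bounded_at M" and N: "N \<ge> 1" for x N
  proof -
    have bd: "\<bar>pp n x\<bar> \<le> M" for n using x unfolding bounded_at_def by auto
    define K where "K = (\<Sum>n\<le>N. (pp n x)\<^sup>2)"
    define k where "k t = (\<Sum>n\<le>N. pp n x * pp n t)" for t
    have KN: "N * c / 2 \<le> K" unfolding K_def c_def by (rule sum_pp_lower[OF x])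
    have K0: "K > 0" using KN N c0 by (smt (verit) mult_pos_pos half_gt_zero of_nat_0_less_iff less_le_trans zero_less_one of_nat_1 of_nat_le_iff)
    have kK: "K / 2 \<le> k t" if t: "t \<in> {x - \<delta> / real N..x + \<delta> / real N}" for t
    proof -
      have "\<bar>t - x\<bar> \<le> \<delta> / N" using t by (auto simp: abs_le_iff)
      then have tx: "\<bar>t - x\<bar> * N \<le> \<delta>" using N by (simp add: pos_le_divide_eq)
      have tx1: "\<bar>t - x\<bar> \<le> 1"
      proof -
        have "\<bar>t - x\<bar> * 1 \<le> \<bar>t - x\<bar> * N" using N by (intro mult_left_mono) auto
        also note tx
        finally show ?thesis using \<delta>(2) by simp
      qed
      have "2 * M\<^sup>2 * (\<bar>t - x\<bar> * N) \<le> 2 * M\<^sup>2 * (1 / (2 * M\<^sup>2))" using tx \<delta>(3) by (intro mult_left_mono) auto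
      also have "\<dots> = 1" using M by simp
      finally have s: "2 * M\<^sup>2 * \<bar>t - x\<bar> * N \<le> 1" by (simp add: mult.assoc)
      have "\<bar>k t - K\<bar> = \<bar>\<Sum>n\<le>N. pp n x * (pp n t - pp n x)\<bar>"
        unfolding k_def K_def by (simp add: sum_subtractf[symmetric] algebra_simps power2_eq_square)
      also have "\<dots> \<le> (\<Sum>n\<le>N. \<bar>pp n x * (pp n t - pp n x)\<bar>)" by (rule sum_abs)
      also have "\<dots> \<le> (\<Sum>n\<le>N. M * (M * ((1 + 12 * M\<^sup>2) * \<delta>)))"
      proof (rule sum_mono)
        fix n assume n: "n \<in> {..N}"
        have "\<bar>pp n t - pp n x\<bar> \<le> M * ((1 + 12 * M\<^sup>2) * (\<bar>t - x\<bar> * N))"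
          by (rule pp_perturbation[OF x s tx1 _ N]) (use n in auto)
        also have "\<dots> \<le> M * ((1 + 12 * M\<^sup>2) * \<delta>)" using M tx by (intro mult_left_mono) auto
        finally show "\<bar>pp n x * (pp n t - pp n x)\<bar> \<le> M * (M * ((1 + 12 * M\<^sup>2) * \<delta>))"
          unfolding abs_mult using bd M by (intro mult_mono) auto
      qed
      also have "\<dots> = (real N + 1) * (M * (M * ((1 + 12 * M\<^sup>2) * \<delta>)))" by simp
      also have "\<dots> \<le> (2 * real N) * (M * (M * ((1 + 12 * M\<^sup>2) * \<delta>)))"
        using N M \<delta> by (intro mult_right_mono mult_nonneg_nonneg) auto
      also have "\<dots> = real N / 4 * (D * \<delta>)" by (simp add: D_def power2_eq_square)
      also have "\<dots> \<le> real N / 4 * c" using \<delta>(4) D0 by (intro mult_left_mono) (auto simp: field_simps)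
      also have "\<dots> \<le> K / 2" using KN by (simp add: mult.commute)
      finally show ?thesis by linarith
    qed
    have int: "(\<integral>t. (k t)\<^sup>2 \<partial>\<rho>) = K" "integrable \<rho> (\<lambda>t. (k t)\<^sup>2)"
      unfolding k_def K_def by (rule integral_kernel_square)+
    define I where "I = {x - \<delta> / real N..x + \<delta> / real N}"
    \<comment> \<open>Chebyshev's inequality: the square of the kernel has integral \<open>K\<close>
      and is at least (K / 2)^2 on the interval.\<close>
    have "measure \<rho> I * (K / 2)\<^sup>2 = (\<integral>t. (K / 2)\<^sup>2 * indicator I t \<partial>\<rho>)"
      by (simp add: I_def)
    also have "\<dots> \<le> (\<integral>t. (k t)\<^sup>2 \<partial>\<rho>)"
    proof (rule integral_mono[OF _ int(2)])
      show "integrable \<rho> (\<lambda>t. (K / 2)\<^sup>2 * indicator I t)"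
        by (intro integrable_mult_right integrable_real_indicator) (auto simp: I_def less_top[symmetric])
      show "(K / 2)\<^sup>2 * indicator I t \<le> (k t)\<^sup>2" for t
        using kK[of t] K0 by (cases "t \<in> I") (auto simp: I_def intro!: power_mono)
    qed
    finally have "measure \<rho> I * (K / 2)\<^sup>2 \<le> K" unfolding int(1) .
    then have "measure \<rho> I \<le> 4 / K" using K0 by (simp add: power2_eq_square field_simps)
    also have "\<dots> \<le> 4 / (N * c / 2)" using KN N c0 K0 by (intro divide_left_mono mult_pos_pos) auto
    also have "\<dots> = (8 / c) / real N" by simp
    finally show ?thesis unfolding I_def .
  qed
  show thesis by (rule that[of \<delta> "8 / c"]) (use main \<delta> c0 in auto)
qed

end

section \<open>Lower bound for the Poisson integral\<close>

context jacobi_measure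
begin

lemma integrable_pp_bounded:
  assumes g: "g \<in> borel_measurable borel" and K: "\<And>t. \<bar>g t\<bar> \<le> (K::real)"
  shows "integrable \<rho> (\<lambda>t. pp n t * g t)" "integrable \<rho> (\<lambda>t. (g t)\<^sup>2)"
proof -
  have gm [measurable]: "g \<in> borel_measurable \<rho>" using g by (simp cong: measurable_cong_sets)
  have pm [measurable]: "pp n \<in> borel_measurable \<rho>" using integrable_pp by (rule borel_measurable_integrable)
  show "integrable \<rho> (\<lambda>t. pp n t * g t)"
  proof (rule Bochner_Integration.integrable_bound)
    show "integrable \<rho> (\<lambda>t. pp n t * K)" by (intro integrable_mult_left integrable_pp)
    show "AE t in \<rho>. norm (pp n t * g t) \<le> norm (pp n t * K)"
      using K by (auto simp: abs_mult intro!: AE_I2 mult_left_mono) (meson abs_ge_self order_trans)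
  qed measurable
  show "integrable \<rho> (\<lambda>t. (g t)\<^sup>2)"
  proof (rule integrable_const_bound[of _ "K\<^sup>2"])
    show "AE t in \<rho>. norm ((g t)\<^sup>2) \<le> K\<^sup>2"
    proof (rule AE_I2)
      show "norm ((g t)\<^sup>2) \<le> K\<^sup>2" for t using power_mono[OF K[of t] abs_ge_zero, of 2] by simp
    qed
  qed measurable
qed

lemma bessel:
  assumes g: "g \<in> borel_measurable borel" and K: "\<And>t. \<bar>g t\<bar> \<le> (K::real)"
  shows "(\<Sum>n\<le>N. (\<integral>t. pp n t * g t \<partial>\<rho>)\<^sup>2) \<le> (\<integral>t. (g t)\<^sup>2 \<partial>\<rho>)"
proof -
  note int = integrable_pp_bounded[OF g K]
  define c where "c n = (\<integral>t. pp n t * g t \<partial>\<rho>)" for n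
  have eq: "(g t - (\<Sum>n\<le>N. c n * pp n t))\<^sup>2
      = (g t)\<^sup>2 - 2 * (\<Sum>n\<le>N. c n * (pp n t * g t)) + (\<Sum>n\<le>N. c n * pp n t)\<^sup>2" for t
    by (simp add: power2_diff sum_distrib_left mult_ac)
  have "0 \<le> (\<integral>t. (g t - (\<Sum>n\<le>N. c n * pp n t))\<^sup>2 \<partial>\<rho>)" by (rule integral_nonneg_AE) simp
  also have "\<dots> = (\<integral>t. (g t)\<^sup>2 \<partial>\<rho>) - 2 * (\<integral>t. (\<Sum>n\<le>N. c n * (pp n t * g t)) \<partial>\<rho>) + (\<Sum>n\<le>N. (c n)\<^sup>2)"
    unfolding eq integral_kernel_square(2)[symmetric]
    by (subst Bochner_Integration.integral_add Bochner_Integration.integral_diff,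
        (intro Bochner_Integration.integrable_diff integrable_mult_right Bochner_Integration.integrable_sum int integral_kernel_square(1))+)+ simp
  also have "(\<integral>t. (\<Sum>n\<le>N. c n * (pp n t * g t)) \<partial>\<rho>) = (\<Sum>n\<le>N. (c n)\<^sup>2)"
    by (subst Bochner_Integration.integral_sum) (auto intro!: integrable_mult_right int simp: c_def power2_eq_square)
  finally show ?thesis by (simp add: c_def)
qed

text \<open>\<open>U + \<i> V\<close> below is the Weyl solution, the integral of \<open>p\<^sub>n(t) / (t - x - \<i>\<epsilon>)\<close>. Its
  square sum is at most \<open>1 / \<epsilon>\<close> times the Poisson integral by Bessel's inequality, while its terms
  stay away from 0 for \<open>n\<close> up to the order of \<open>1 / \<epsilon>\<close>.\<close>

lemma poisson_lower_scale:
  assumes x: "x \<in> bounded_at M" and N: "N \<ge> 1"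
  defines "\<epsilon> \<equiv> 1 / (4 * M\<^sup>2 * real N)"
  shows "1 / (1024 * Amax\<^sup>2 * M ^ 4) \<le> (\<integral>t. \<epsilon> / ((t - x)\<^sup>2 + \<epsilon>\<^sup>2) \<partial>\<rho>)"
proof -
  have bd: "\<bar>pp n x\<bar> \<le> M" "\<bar>qq n x\<bar> \<le> M" for n using x unfolding bounded_at_def by auto
  have M: "1 \<le> M" using bd(1)[of 0] by simp
  have MN: "1 \<le> M\<^sup>2 * real N" using M N mult_mono[of 1 "M\<^sup>2" 1 "real N"] by (simp add: one_le_power)
  have e0: "0 < \<epsilon>" "\<epsilon> \<le> 1" using MN by (auto simp: \<epsilon>_def mult.assoc divide_le_eq)
  \<comment> \<open>Real and imaginary part of 1 / (t - x - i\<epsilon>).\<close>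
  define g1 g2 where "g1 t = (t - x) / ((t - x)\<^sup>2 + \<epsilon>\<^sup>2)" and "g2 t = \<epsilon> / ((t - x)\<^sup>2 + \<epsilon>\<^sup>2)" for t
  have den: "0 < (t - x)\<^sup>2 + \<epsilon>\<^sup>2" for t using e0 by (simp add: add_nonneg_pos)
  have gm: "g1 \<in> borel_measurable borel" "g2 \<in> borel_measurable borel"
    unfolding g1_def[abs_def] g2_def[abs_def] by measurable
  have gb: "\<bar>g1 t\<bar> \<le> 1 / \<epsilon>" "\<bar>g2 t\<bar> \<le> 1 / \<epsilon>" for t
  proof -
    have "2 * (\<bar>t - x\<bar> * \<epsilon>) \<le> (t - x)\<^sup>2 + \<epsilon>\<^sup>2"
      using zero_le_power2[of "\<bar>t - x\<bar> - \<epsilon>"] by (simp add: power2_diff)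
    moreover have "\<epsilon> * \<epsilon> \<le> (t - x)\<^sup>2 + \<epsilon>\<^sup>2" by (simp add: power2_eq_square)
    moreover have "0 \<le> \<bar>t - x\<bar> * \<epsilon>" using e0 by simp
    ultimately have "\<bar>t - x\<bar> * \<epsilon> \<le> (t - x)\<^sup>2 + \<epsilon>\<^sup>2" "\<epsilon> * \<epsilon> \<le> (t - x)\<^sup>2 + \<epsilon>\<^sup>2" by linarith+
    then show "\<bar>g1 t\<bar> \<le> 1 / \<epsilon>" "\<bar>g2 t\<bar> \<le> 1 / \<epsilon>"
      using den[of t] e0 by (auto simp: g1_def g2_def abs_divide field_simps)
  qed
  have gid: "t * g1 t = x * g1 t + 1 - \<epsilon> * g2 t" "t * g2 t = x * g2 t + \<epsilon> * g1 t" for t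
  proof -
    define m where "m = (t - x)\<^sup>2 + \<epsilon>\<^sup>2"
    have m: "m \<noteq> 0" "(t - x)\<^sup>2 = m - \<epsilon>\<^sup>2" using den[of t] by (auto simp: m_def)
    have "(t - x) * g1 t = (t - x)\<^sup>2 / m" by (simp add: g1_def m_def power2_eq_square)
    also have "\<dots> = 1 - \<epsilon> * (\<epsilon> / m)"
      unfolding m(2) using m(1) by (simp add: diff_divide_distrib power2_eq_square)
    also have "\<epsilon> / m = g2 t" by (simp add: g2_def m_def)
    finally show "t * g1 t = x * g1 t + 1 - \<epsilon> * g2 t" by (simp add: algebra_simps)
    have "(t - x) * g2 t = \<epsilon> * g1 t" by (simp add: g1_def g2_def)
    then show "t * g2 t = x * g2 t + \<epsilon> * g1 t" by (simp add: algebra_simps)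
  qed
  note i1 = integrable_pp_bounded[OF gm(1) gb(1)] and i2 = integrable_pp_bounded[OF gm(2) gb(2)]
  define U V where "U n = (\<integral>t. pp n t * g1 t \<partial>\<rho>)" and "V n = (\<integral>t. pp n t * g2 t \<partial>\<rho>)" for n
  \<comment> \<open>Multiplication by t - x - i\<epsilon> leaves the integral of
    \<open>pp (n + 1)\<close>, which vanishes. Only the first step, \<open>U1\<close>, keeps the
    inhomogeneity 1; it is what makes \<open>B 0\<close> below equal to 1 + i\<epsilon>
    y(0).\<close>
  have U_rec: "a (n + 2) * U (n + 2) = (x - b (n + 2)) * U (n + 1) - \<epsilon> * V (n + 1) - a (n + 1) * U n" for n
  proof -
    have pw: "a (n + 2) * (pp (n + 2) t * g1 t) = (x - b (n + 2)) * (pp (n + 1) t * g1 t) + pp (n + 1) t - \<epsilon> * (pp (n + 1) t * g2 t) - a (n + 1) * (pp n t * g1 t)" for t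
    proof -
      have "a (n + 2) * (pp (n + 2) t * g1 t) = (a (n + 2) * pp (n + 2) t) * g1 t" by simp
      also have "\<dots> = pp (n + 1) t * (t * g1 t) - b (n + 2) * (pp (n + 1) t * g1 t) - a (n + 1) * (pp n t * g1 t)"
        unfolding pp_Suc_Suc by (simp add: algebra_simps)
      finally show ?thesis unfolding gid(1) by (simp add: algebra_simps)
    qed
    have "a (n + 2) * U (n + 2) = (\<integral>t. a (n + 2) * (pp (n + 2) t * g1 t) \<partial>\<rho>)"
      by (simp add: U_def)
    also have "\<dots> = (x - b (n + 2)) * U (n + 1) + 0 - \<epsilon> * V (n + 1) - a (n + 1) * U n"
      unfolding pw
      using integral_pp[of "n + 1"] by (simp add: i1 i2 integrable_pp U_def V_def)
    finally show ?thesis by simp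
  qed
  have V_rec: "a (n + 2) * V (n + 2) = (x - b (n + 2)) * V (n + 1) + \<epsilon> * U (n + 1) - a (n + 1) * V n" for n
  proof -
    have pw: "a (n + 2) * (pp (n + 2) t * g2 t) = (x - b (n + 2)) * (pp (n + 1) t * g2 t) + \<epsilon> * (pp (n + 1) t * g1 t) - a (n + 1) * (pp n t * g2 t)" for t
    proof -
      have "a (n + 2) * (pp (n + 2) t * g2 t) = (a (n + 2) * pp (n + 2) t) * g2 t" by simp
      also have "\<dots> = pp (n + 1) t * (t * g2 t) - b (n + 2) * (pp (n + 1) t * g2 t) - a (n + 1) * (pp n t * g2 t)"
        unfolding pp_Suc_Suc by (simp add: algebra_simps)
      finally show ?thesis unfolding gid(2) by (simp add: algebra_simps)
    qed
    have "a (n + 2) * V (n + 2) = (\<integral>t. a (n + 2) * (pp (n + 2) t * g2 t) \<partial>\<rho>)"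
      by (simp add: V_def)
    also have "\<dots> = (x - b (n + 2)) * V (n + 1) + \<epsilon> * U (n + 1) - a (n + 1) * V n"
      unfolding pw
      by (simp add: i1 i2 U_def V_def)
    finally show ?thesis .
  qed
  have U1: "a 1 * U 1 = (x - b 1) * U 0 + 1 - \<epsilon> * V 0"
  proof -
    have pw: "a 1 * (pp 1 t * g1 t) = (x - b 1) * (pp 0 t * g1 t) + pp 0 t - \<epsilon> * (pp 0 t * g2 t)" for t
      using gid(1)[of t] pp_1[of t] by (simp only: mult.assoc[symmetric]) (simp add: algebra_simps)
    have "a 1 * U 1 = (\<integral>t. a 1 * (pp 1 t * g1 t) \<partial>\<rho>)"
      by (simp add: U_def)
    also have "\<dots> = (x - b 1) * U 0 + 1 - \<epsilon> * V 0"
      unfolding pw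
      using integral_pp[of 0] i1(1)[of 0] i2(1)[of 0] integrable_pp[of 0] by (simp add: U_def V_def del: pp_0)
    finally show ?thesis .
  qed
  have V1: "a 1 * V 1 = (x - b 1) * V 0 + \<epsilon> * U 0"
  proof -
    have pw: "a 1 * (pp 1 t * g2 t) = (x - b 1) * (pp 0 t * g2 t) + \<epsilon> * (pp 0 t * g1 t)" for t
      using gid(2)[of t] pp_1[of t] by (simp only: mult.assoc[symmetric]) (simp add: algebra_simps)
    have "a 1 * V 1 = (\<integral>t. a 1 * (pp 1 t * g2 t) \<partial>\<rho>)"
      by (simp add: V_def)
    also have "\<dots> = (x - b 1) * V 0 + \<epsilon> * U 0"
      unfolding pw
      using i1(1)[of 0] i2(1)[of 0] by (simp add: U_def V_def del: pp_0)
    finally show ?thesis .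
  qed
  define y z where "y n = Complex (U n) (V n)" and "z = Complex x \<epsilon>" for n
  define A where "A n = of_real (a (n + 1)) * (y n * of_real (qq (n + 1) x) - y (n + 1) * of_real (qq n x))" for n
  define B where "B n = - of_real (a (n + 1)) * (y n * of_real (pp (n + 1) x) - y (n + 1) * of_real (pp n x))" for n
  have y: "of_real (a (n + 2)) * y (n + 2) = (z - of_real (b (n + 2))) * y (n + 1) - of_real (a (n + 1)) * y n" for n
    using U_rec[of n] V_rec[of n] by (simp add: complex_eq_iff y_def z_def algebra_simps)
  note var = x y A_def B_def
  have zx: "z - of_real x = \<i> * of_real \<epsilon>" by (simp add: complex_eq_iff z_def)
  have nrm: "cmod (z - of_real x) = \<epsilon>" unfolding zx using e0 by (simp add: norm_mult)
  have A0: "A 0 = y 0"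
  proof -
    have "A 0 = y 0 * complex_of_real (a 1 * qq 1 x)" by (simp add: A_def qq_simps(1))
    then show ?thesis by (simp only: qq_simps(2) of_real_1 mult_1_right)
  qed
  have B0: "B 0 = 1 + \<i> * of_real \<epsilon> * y 0"
  proof -
    have "B 0 = of_real (a 1) * y 1 - y 0 * complex_of_real (a 1 * pp 1 x)" by (simp add: B_def algebra_simps)
    also have "of_real (a 1) * y 1 = Complex ((x - b 1) * U 0 + 1 - \<epsilon> * V 0) ((x - b 1) * V 0 + \<epsilon> * U 0)"
      using U1 V1 by (simp add: complex_eq_iff y_def)
    finally show ?thesis unfolding pp_1 by (simp add: complex_eq_iff y_def algebra_simps)
  qed
  \<comment> \<open>Since \<epsilon> is at most 1, either y(0) is large or \<open>B 0\<close> is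
    close to 1. This excludes a small Weyl solution without information on \<rho>.\<close>
  have H0: "1 \<le> cmod (A 0) + cmod (B 0)"
  proof -
    have "1 - cmod (\<i> * of_real \<epsilon> * y 0) \<le> cmod (B 0)"
      unfolding B0 using norm_diff_ineq[of 1 "\<i> * of_real \<epsilon> * y 0"] by simp
    moreover have "cmod (\<i> * of_real \<epsilon> * y 0) \<le> cmod (y 0)"
      using e0 by (simp add: norm_mult mult_left_le_one_le)
    ultimately show ?thesis unfolding A0 by linarith
  qed
  have Hn: "1 / 2 \<le> cmod (A n) + cmod (B n)" if "n \<le> N" for n
  proof -
    \<comment> \<open>The value of \<epsilon> gives equality, so the solution persists for exactly
      \<open>N\<close> steps in \<open>variation_lower\<close>.\<close>
    have "2 * M\<^sup>2 * cmod (z - of_real x) * N \<le> 1 / 2"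
      unfolding nrm \<epsilon>_def using MN by (simp add: field_simps)
    have "1 / 2 \<le> (cmod (A 0) + cmod (B 0)) / 2" using H0 by simp
    also note variation_lower[OF var \<open>2 * M\<^sup>2 * cmod (z - of_real x) * N \<le> 1 / 2\<close> that]
    finally show ?thesis .
  qed
  define k where "k = 1 / (128 * Amax\<^sup>2 * M\<^sup>2)"
  have pair: "k \<le> (cmod (y n))\<^sup>2 + (cmod (y (n + 1)))\<^sup>2" if "n < N" for n
  proof -
    have an: "0 < a (n + 1)" "a (n + 1) \<le> Amax" using a_pos[of "n + 1"] a_le[of "n + 1"] by auto
    have le: "cmod (of_real (a (n + 1)) * (y n * of_real r - y (n + 1) * of_real s)) \<le> Amax * (cmod (y n) * M + cmod (y (n + 1)) * M)"
      if "\<bar>r\<bar> \<le> M" "\<bar>s\<bar> \<le> M" for r s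
      unfolding norm_mult[of "of_real (a (n + 1))"]
      using an that by (intro mult_mono order_trans[OF norm_triangle_ineq4] add_mono) (auto simp: norm_mult intro!: mult_left_mono)
    have "cmod (A n) \<le> Amax * (cmod (y n) * M + cmod (y (n + 1)) * M)" unfolding A_def by (rule le) (rule bd)+
    moreover have "cmod (B n) \<le> Amax * (cmod (y n) * M + cmod (y (n + 1)) * M)"
      unfolding B_def mult_minus_left norm_minus_cancel by (rule le) (rule bd)+
    ultimately have "1 / 2 \<le> 2 * (Amax * (cmod (y n) * M + cmod (y (n + 1)) * M))" using Hn[of n] that by linarith
    then have "1 \<le> 4 * Amax * M * (cmod (y n) + cmod (y (n + 1)))" by (simp add: algebra_simps)
    then have "1 \<le> (4 * Amax * M * (cmod (y n) + cmod (y (n + 1))))\<^sup>2" by (simp add: one_le_power)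
    also have "\<dots> \<le> 16 * Amax\<^sup>2 * M\<^sup>2 * (2 * ((cmod (y n))\<^sup>2 + (cmod (y (n + 1)))\<^sup>2))"
    proof -
      have "(cmod (y n) + cmod (y (n + 1)))\<^sup>2 \<le> 2 * ((cmod (y n))\<^sup>2 + (cmod (y (n + 1)))\<^sup>2)"
        using sum_squares_ge_zero[of "cmod (y n) - cmod (y (n + 1))" 0] by (simp add: power2_eq_square algebra_simps)
      then show ?thesis unfolding power_mult_distrib by (simp add: mult_left_mono)
    qed
    also have "\<dots> \<le> (128 * Amax\<^sup>2 * M\<^sup>2) * ((cmod (y n))\<^sup>2 + (cmod (y (n + 1)))\<^sup>2)"
      by (simp add: algebra_simps)
    finally show ?thesis unfolding k_def using Amax_pos M by (simp add: pos_divide_le_eq mult.commute)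
  qed
  have "N * k = (\<Sum>n<N. k)" by simp
  also have "\<dots> \<le> (\<Sum>n<N. (cmod (y n))\<^sup>2 + (cmod (y (n + 1)))\<^sup>2)" by (intro sum_mono pair) simp
  also have "\<dots> \<le> 2 * (\<Sum>n\<le>N. (cmod (y n))\<^sup>2)" by (rule sum_pairs_le) simp
  also have "(\<Sum>n\<le>N. (cmod (y n))\<^sup>2) = (\<Sum>n\<le>N. (U n)\<^sup>2) + (\<Sum>n\<le>N. (V n)\<^sup>2)"
    by (simp add: cmod_power2 y_def sum.distrib)
  also have "\<dots> \<le> (\<integral>t. (g1 t)\<^sup>2 \<partial>\<rho>) + (\<integral>t. (g2 t)\<^sup>2 \<partial>\<rho>)"
    unfolding U_def V_def by (intro add_mono bessel[OF gm(1) gb(1)] bessel[OF gm(2) gb(2)])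
  also have "\<dots> = (\<integral>t. (g1 t)\<^sup>2 + (g2 t)\<^sup>2 \<partial>\<rho>)" using i1(2) i2(2) by simp
  \<comment> \<open>The squared modulus of 1 / (t - x - i\<epsilon>) is its imaginary part divided
    by \<epsilon>; this turns the square integral into a Poisson integral.\<close>
  also have "(\<lambda>t. (g1 t)\<^sup>2 + (g2 t)\<^sup>2) = (\<lambda>t. g2 t * (1 / \<epsilon>))"
  proof
    fix t
    have "(g1 t)\<^sup>2 + (g2 t)\<^sup>2 = ((t - x)\<^sup>2 + \<epsilon>\<^sup>2) / ((t - x)\<^sup>2 + \<epsilon>\<^sup>2)\<^sup>2"
      by (simp add: g1_def g2_def power_divide add_divide_distrib)
    also have "\<dots> = 1 / ((t - x)\<^sup>2 + \<epsilon>\<^sup>2)" using den[of t] by (simp add: power2_eq_square)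
    finally show "(g1 t)\<^sup>2 + (g2 t)\<^sup>2 = g2 t * (1 / \<epsilon>)" using e0 by (simp add: g2_def)
  qed
  finally have "N * k \<le> 2 * ((\<integral>t. g2 t \<partial>\<rho>) * (1 / \<epsilon>))" by simp
  then have "N * k * \<epsilon> \<le> 2 * (\<integral>t. g2 t \<partial>\<rho>)" using e0 by (simp add: field_simps)
  moreover have "N * k * \<epsilon> = 2 * (1 / (1024 * Amax\<^sup>2 * M ^ 4))"
    using N M Amax_pos by (simp add: k_def \<epsilon>_def field_simps eval_nat_numeral)
  ultimately show ?thesis unfolding g2_def by linarith
qed

end

section \<open>From bounds at the scale 1 / N to null sets\<close>

lemma arctan_FTC:
  fixes t \<epsilon> l u :: real
  assumes "\<epsilon> > 0" "l \<le> u"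
  shows "(\<integral>\<^sup>+x. ennreal (\<epsilon> / ((t - x)\<^sup>2 + \<epsilon>\<^sup>2)) * indicator {l..u} x \<partial>lborel) \<le> ennreal pi"
proof -
  have den: "0 < (t - x)\<^sup>2 + \<epsilon>\<^sup>2" for x using assms by (simp add: add_nonneg_pos)
  have "(\<integral>\<^sup>+x. ennreal (\<epsilon> / ((t - x)\<^sup>2 + \<epsilon>\<^sup>2)) * indicator {l..u} x \<partial>lborel)
      = ennreal (arctan ((u - t) / \<epsilon>) - arctan ((l - t) / \<epsilon>))"
  proof (rule nn_integral_FTC_Icc[where F = "\<lambda>x. arctan ((x - t) / \<epsilon>)"])
    fix x
    have "inverse (1 + ((x - t) / \<epsilon>)\<^sup>2) * (1 / \<epsilon>) = \<epsilon> / ((t - x)\<^sup>2 + \<epsilon>\<^sup>2)"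
    proof -
      have "1 + ((x - t) / \<epsilon>)\<^sup>2 = ((t - x)\<^sup>2 + \<epsilon>\<^sup>2) / \<epsilon>\<^sup>2"
        using assms by (simp add: power_divide power2_commute[of x t] field_simps)
      then show ?thesis using assms by (simp add: power2_eq_square)
    qed
    moreover have "((\<lambda>x. arctan ((x - t) / \<epsilon>)) has_real_derivative inverse (1 + ((x - t) / \<epsilon>)\<^sup>2) * (1 / \<epsilon>)) (at x)"
      by (rule DERIV_chain2[OF DERIV_arctan]) (use assms in \<open>auto intro!: derivative_eq_intros\<close>)
    ultimately show "((\<lambda>x. arctan ((x - t) / \<epsilon>)) has_real_derivative \<epsilon> / ((t - x)\<^sup>2 + \<epsilon>\<^sup>2)) (at x)"
      by simp
    show "0 \<le> \<epsilon> / ((t - x)\<^sup>2 + \<epsilon>\<^sup>2)" using den[of x] assms by simp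
  qed (use assms in auto)
  also have "\<dots> \<le> ennreal pi"
    using arctan_bounded[of "(u - t) / \<epsilon>"] arctan_bounded[of "(l - t) / \<epsilon>"] by (intro ennreal_leI) auto
  finally show ?thesis .
qed

context jacobi_measure
begin

text \<open>An open neighbourhood of total length about \<open>e\<close> contains all grid cells of
  width h = \<delta> / N that meet \<open>K\<close>, once h is below the distance given by
  compactness. The cells are disjoint, so their number times h is at most \<open>e\<close>, while
  each has \<rho>-measure at most C / N = (C / \<delta>) h.\<close>

lemma bounded_at_compact_null:
  assumes M: "M \<ge> 1" and K: "compact K" "K \<subseteq> bounded_at M" and null: "emeasure lborel K = 0"
  shows "emeasure \<rho> K = 0"
proof -
  obtain \<delta> C where dC: "\<delta> > 0" "C > 0"
    "\<And>x N. x \<in> bounded_at M \<Longrightarrow> N \<ge> 1 \<Longrightarrow> measure \<rho> {x - \<delta> / real N..x + \<delta> / real N} \<le> C / real N"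
    using measure_interval_upper[OF M] by blast
  have Kb: "K \<in> sets borel" using K(1) by (simp add: compact_imp_closed borel_closed)
  have bound: "measure \<rho> K \<le> e * (C / \<delta>)" if e: "e > 0" for e
  proof -
    obtain U where U: "open U" "K \<subseteq> U" "emeasure lborel (U - K) < ennreal e"
      using outer_regular_lborel[OF Kb e] by blast
    have "emeasure lborel U = emeasure lborel (U - K) + emeasure lborel K"
      using U Kb by (subst plus_emeasure) (auto simp: Un_absorb1 Un_absorb2 borel_open)
    then have Ue: "emeasure lborel U \<le> ennreal e" using null U(3) by simp
    obtain r where r: "r > 0" "(\<Union>x\<in>K. ball x r) \<subseteq> U"
      using compact_subset_open_imp_ball_epsilon_subset[OF K(1) U(1,2)] by blast
    obtain N0 :: nat where N0: "\<delta> / r < real N0" using reals_Archimedean2 by blast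
    define N where "N = Suc N0"
    define h where "h = \<delta> / real N"
    have h0: "h > 0" using dC by (simp add: h_def N_def)
    have hr: "h < r"
    proof -
      have "\<delta> < real N0 * r" using N0 r by (simp add: pos_divide_less_eq)
      also have "\<dots> \<le> real N * r" using r by (intro mult_right_mono) (auto simp: N_def)
      finally show ?thesis by (simp add: h_def N_def pos_divide_less_eq mult.commute)
    qed
    define Ks where "Ks = (\<lambda>x. \<lfloor>x / h\<rfloor>) ` K"
    define J where "J k = {real_of_int k * h..<(real_of_int k + 1) * h}" for k
    have inJ: "x \<in> J \<lfloor>x / h\<rfloor>" for x
      using floor_divide_lower[OF h0, of x] floor_divide_upper[OF h0, of x] by (simp add: J_def)
    have Jdist: "\<bar>t - x\<bar> < h" if "t \<in> J k" "x \<in> J k" for t x k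
      using that by (auto simp: J_def algebra_simps)
    obtain R where R: "\<And>x. x \<in> K \<Longrightarrow> \<bar>x\<bar> \<le> R"
      using compact_imp_bounded[OF K(1)] by (auto simp: bounded_iff)
    have finK: "finite Ks"
    proof (rule finite_subset)
      show "Ks \<subseteq> {\<lfloor>- R / h\<rfloor>..\<lfloor>R / h\<rfloor>}"
        unfolding Ks_def
      proof (rule image_subsetI)
        fix x assume "x \<in> K"
        then have "- R \<le> x" "x \<le> R" using R[of x] by linarith+
        then have "- R / h \<le> x / h" "x / h \<le> R / h" using h0 by (auto simp only: intro!: divide_right_mono)
        then show "\<lfloor>x / h\<rfloor> \<in> {\<lfloor>- R / h\<rfloor>..\<lfloor>R / h\<rfloor>}" by (auto intro: floor_mono)
      qed
    qed simp
    have Kx: "\<exists>x\<in>K. x \<in> J k" if "k \<in> Ks" for k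
      using that inJ unfolding Ks_def by blast
    have JU: "J k \<subseteq> U" if k: "k \<in> Ks" for k
    proof
      fix t assume t: "t \<in> J k"
      obtain x where "x \<in> K" "x \<in> J k" using Kx[OF k] by blast
      then show "t \<in> U" using r(2) Jdist[OF t, of x] hr by (force simp: dist_real_def abs_minus_commute)
    qed
    have Jm: "measure \<rho> (J k) \<le> C / real N" if k: "k \<in> Ks" for k
    proof -
      obtain x where x: "x \<in> K" "x \<in> J k" using Kx[OF k] by blast
      have "J k \<subseteq> {x - \<delta> / real N..x + \<delta> / real N}"
        using Jdist[OF _ x(2)] unfolding h_def[symmetric] by (force simp: abs_less_iff)
      then have "measure \<rho> (J k) \<le> measure \<rho> {x - \<delta> / real N..x + \<delta> / real N}"
        by (intro finite_measure_mono) auto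
      also have "\<dots> \<le> C / real N" using x K(2) by (intro dC(3)) (auto simp: N_def)
      finally show ?thesis .
    qed
    have disj: "disjoint_family_on J Ks"
      unfolding disjoint_family_on_def
    proof (intro ballI impI)
      fix k k' :: int assume "k \<noteq> k'"
      have "k = \<lfloor>x / h\<rfloor>" if "x \<in> J k" for x k
        using that h0 by (intro floor_unique[symmetric]) (auto simp: J_def field_simps)
      then show "J k \<inter> J k' = {}" using \<open>k \<noteq> k'\<close> by blast
    qed
    have "ennreal (card Ks * h) = (\<Sum>k\<in>Ks. emeasure lborel (J k))"
      using h0 by (simp add: J_def algebra_simps ennreal_mult ennreal_of_nat_eq_real_of_nat)
    also have "\<dots> = emeasure lborel (\<Union>k\<in>Ks. J k)"
      by (rule sum_emeasure[OF _ disj finK]) (auto simp: J_def)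
    also have "\<dots> \<le> emeasure lborel U" by (rule emeasure_mono) (use JU U in \<open>auto simp: borel_open\<close>)
    also note Ue
    finally have card: "card Ks * h \<le> e" using e by simp
    have "measure \<rho> K \<le> measure \<rho> (\<Union>k\<in>Ks. J k)"
    proof (rule finite_measure_mono)
      show "K \<subseteq> (\<Union>k\<in>Ks. J k)" using inJ unfolding Ks_def by blast
      show "(\<Union>k\<in>Ks. J k) \<in> sets \<rho>" using finK by (auto simp: J_def)
    qed
    also have "\<dots> \<le> (\<Sum>k\<in>Ks. measure \<rho> (J k))"
      by (rule finite_measure_subadditive_finite[OF finK]) (auto simp: J_def)
    also have "\<dots> \<le> (\<Sum>k\<in>Ks. C / real N)" by (intro sum_mono Jm)
    also have "\<dots> = (card Ks * h) * (C / \<delta>)" using dC by (simp add: h_def)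
    also have "\<dots> \<le> e * (C / \<delta>)" using card dC by (intro mult_right_mono) auto
    finally show ?thesis .
  qed
  have "measure \<rho> K \<le> 0"
  proof (rule field_le_epsilon)
    fix e :: real assume "e > 0"
    then show "measure \<rho> K \<le> 0 + e" using bound[of "e * \<delta> / C"] dC by simp
  qed
  then show ?thesis using measure_nonneg[of \<rho> K] by (simp add: emeasure_eq_measure)
qed

text \<open>The lower bound for the Poisson integral of \<rho> is integrated over \<open>K\<close>,
  and Fubini moves the kernel to the indicator of \<open>K\<close>. The resulting functions are
  bounded by pi and tend to 0 off \<open>K\<close>, that is, \<rho>-almost everywhere; dominated
  convergence leaves no room for positive length.\<close>

lemma bounded_at_compact_charged:
  assumes M: "M \<ge> 1" and K: "compact K" "K \<subseteq> bounded_at M" and null: "emeasure \<rho> K = 0"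
  shows "emeasure lborel K = 0"
proof -
  define c where "c = 1 / (1024 * Amax\<^sup>2 * M ^ 4)"
  define \<epsilon> where "\<epsilon> n = 1 / (4 * M\<^sup>2 * real (Suc n))" for n
  define pk where "pk n t x = \<epsilon> n / ((t - x)\<^sup>2 + (\<epsilon> n)\<^sup>2)" for n t x
  define q where "q n t x = ennreal (pk n t x) * indicator K x" for n t x
  \<comment> \<open>Up to the factor pi, the harmonic extension of the indicator of \<open>K\<close>
    at height \<open>\<epsilon> n\<close>.\<close>
  define om where "om n t = (\<integral>\<^sup>+x. q n t x \<partial>lborel)" for n t
  have c0: "c > 0" using M Amax_pos by (simp add: c_def)
  have e0: "\<epsilon> n > 0" for n using M by (simp add: \<epsilon>_def)
  have den: "0 < (t - x)\<^sup>2 + (\<epsilon> n)\<^sup>2" for t x n using e0[of n] by (simp add: add_nonneg_pos)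
  have Kb [measurable]: "K \<in> sets borel" using K(1) by (simp add: compact_imp_closed borel_closed)
  have Kfin: "emeasure lborel K < \<infinity>" using emeasure_compact_finite[OF K(1)] by simp
  interpret pair_sigma_finite \<rho> lborel ..
  have qm: "(\<lambda>(t, x). q n t x) \<in> borel_measurable (\<rho> \<Otimes>\<^sub>M lborel)" for n
    unfolding q_def pk_def by measurable
  have low: "ennreal c * emeasure lborel K \<le> (\<integral>\<^sup>+t. om n t \<partial>\<rho>)" for n
  proof -
    have "ennreal c * emeasure lborel K = (\<integral>\<^sup>+x. ennreal c * indicator K x \<partial>lborel)"
      by (rule nn_integral_cmult_indicator[symmetric]) simp
    also have "\<dots> \<le> (\<integral>\<^sup>+x. (\<integral>\<^sup>+t. q n t x \<partial>\<rho>) \<partial>lborel)"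
    proof (rule nn_integral_mono)
      fix x
      show "ennreal c * indicator K x \<le> (\<integral>\<^sup>+t. q n t x \<partial>\<rho>)"
      proof (cases "x \<in> K")
        case True
        have int: "integrable \<rho> (\<lambda>t. pk n t x)"
        proof (rule integrable_const_bound[of _ "1 / \<epsilon> n"])
          show "AE t in \<rho>. norm (pk n t x) \<le> 1 / \<epsilon> n"
          proof (rule AE_I2)
            fix t
            have "\<epsilon> n * \<epsilon> n \<le> (t - x)\<^sup>2 + (\<epsilon> n)\<^sup>2" by (simp add: power2_eq_square)
            then show "norm (pk n t x) \<le> 1 / \<epsilon> n"
              unfolding pk_def using e0[of n] den[of t x n] by (simp add: field_simps)
          qed
        qed (simp add: pk_def)
        have "c \<le> (\<integral>t. pk n t x \<partial>\<rho>)"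
          unfolding c_def pk_def \<epsilon>_def by (rule poisson_lower_scale) (use True K in auto)
        then have "ennreal c \<le> ennreal (\<integral>t. pk n t x \<partial>\<rho>)" by (rule ennreal_leI)
        also have "\<dots> = (\<integral>\<^sup>+t. ennreal (pk n t x) \<partial>\<rho>)"
          by (rule nn_integral_eq_integral[symmetric, OF int]) (use e0 den in \<open>auto simp: pk_def intro!: AE_I2 divide_nonneg_pos less_imp_le\<close>)
        finally show ?thesis using True by (simp add: q_def)
      qed simp
    qed
    also have "\<dots> = (\<integral>\<^sup>+t. om n t \<partial>\<rho>)"
      unfolding om_def by (rule Fubini'[OF qm])
    finally show ?thesis .
  qed
  obtain R where R: "\<And>x. x \<in> K \<Longrightarrow> \<bar>x\<bar> \<le> R" "R \<ge> 0"
    using compact_imp_bounded[OF K(1)] unfolding bounded_pos by (metis less_imp_le real_norm_def)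
  have om_le: "om n t \<le> ennreal pi" for n t
  proof -
    have "om n t \<le> (\<integral>\<^sup>+x. ennreal (pk n t x) * indicator {-R..R} x \<partial>lborel)"
      unfolding om_def q_def using R by (intro nn_integral_mono mult_left_mono) (auto simp: indicator_def abs_le_iff minus_le_iff)
    also have "\<dots> \<le> ennreal pi" unfolding pk_def by (rule arctan_FTC[OF e0]) (use R in auto)
    finally show ?thesis .
  qed
  have elim: "\<epsilon> \<longlonglongrightarrow> 0"
  proof -
    have "(\<lambda>n. 1 / (4 * M\<^sup>2) * (1 / real (Suc n))) \<longlonglongrightarrow> 1 / (4 * M\<^sup>2) * 0"
      by (intro tendsto_mult_left) (use LIMSEQ_inverse_real_of_nat in \<open>simp add: inverse_eq_divide\<close>)
    then show ?thesis by (simp add: \<epsilon>_def[abs_def])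
  qed
  have om_lim: "(\<lambda>n. om n t) \<longlonglongrightarrow> 0" if t: "t \<notin> K" for t
  proof -
    have "open (- K)" using compact_imp_closed[OF K(1)] by (simp add: open_Compl)
    then obtain s where s: "s > 0" "ball t s \<subseteq> - K" using t by (auto simp: open_contains_ball)
    have le: "om n t \<le> ennreal (\<epsilon> n / s\<^sup>2) * emeasure lborel K" for n
    proof -
      have "om n t \<le> (\<integral>\<^sup>+x. ennreal (\<epsilon> n / s\<^sup>2) * indicator K x \<partial>lborel)"
        unfolding om_def
      proof (rule nn_integral_mono)
        fix x
        show "q n t x \<le> ennreal (\<epsilon> n / s\<^sup>2) * indicator K x"
        proof (cases "x \<in> K")
          case True
          then have "s \<le> \<bar>t - x\<bar>" using s(2) by (force simp: dist_real_def)
          then have "s\<^sup>2 \<le> (t - x)\<^sup>2" using s(1) by (simp add: abs_le_square_iff[symmetric])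
          then have "pk n t x \<le> \<epsilon> n / s\<^sup>2"
            unfolding pk_def using s(1) e0[of n] by (intro divide_left_mono) (auto intro: add_increasing2 mult_pos_pos den)
          then show ?thesis using True by (simp add: q_def ennreal_leI)
        qed (simp add: q_def)
      qed
      then show ?thesis by (subst (asm) nn_integral_cmult_indicator) auto
    qed
    have "(\<lambda>n. ennreal (\<epsilon> n / s\<^sup>2)) \<longlonglongrightarrow> ennreal (0 / s\<^sup>2)"
      using s(1) by (intro tendsto_ennrealI tendsto_divide elim tendsto_const) auto
    then have "(\<lambda>n. emeasure lborel K * ennreal (\<epsilon> n / s\<^sup>2)) \<longlonglongrightarrow> emeasure lborel K * ennreal (0 / s\<^sup>2)"
      using Kfin by (intro ennreal_tendsto_cmult) auto
    then have "(\<lambda>n. ennreal (\<epsilon> n / s\<^sup>2) * emeasure lborel K) \<longlonglongrightarrow> 0" by (simp add: mult.commute)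
    from tendsto_sandwich[OF _ _ tendsto_const this] show ?thesis using le by auto
  qed
  have "(\<lambda>n. \<integral>\<^sup>+t. om n t \<partial>\<rho>) \<longlonglongrightarrow> (\<integral>\<^sup>+t. 0 \<partial>\<rho>)"
  proof (rule nn_integral_dominated_convergence[where w = "\<lambda>_. ennreal pi"])
    show "om n \<in> borel_measurable \<rho>" for n
      unfolding om_def[abs_def] using qm by (rule lborel.borel_measurable_nn_integral)
    show "AE t in \<rho>. om n t \<le> ennreal pi" for n using om_le by simp
    show "(\<integral>\<^sup>+ t. ennreal pi \<partial>\<rho>) < \<infinity>" by (simp add: emeasure_eq_measure ennreal_mult_less_top)
    have "K \<in> null_sets \<rho>" using null by (auto intro: null_setsI)
    then show "AE t in \<rho>. (\<lambda>n. om n t) \<longlonglongrightarrow> 0"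
      by (rule AE_not_in[THEN AE_mp]) (use om_lim in auto)
  qed auto
  then have "ennreal c * emeasure lborel K \<le> (\<integral>\<^sup>+t. 0 \<partial>\<rho>)"
    by (rule tendsto_lowerbound) (use low in auto)
  then show ?thesis using c0 by simp
qed

end

section \<open>The theorem\<close>

context jacobi_measure
begin

lemma bounded_at_null:
  assumes M: "M \<ge> 1" and E: "E \<in> sets borel" "E \<subseteq> bounded_at M" "emeasure lborel E = 0"
  shows "emeasure \<rho> E = 0"
proof -
  have "emeasure \<rho> E = (SUP K\<in>{K. K \<subseteq> E \<and> compact K}. emeasure \<rho> K)"
    by (rule inner_regular) (use E in \<open>auto simp: emeasure_eq_measure\<close>)
  also have "\<dots> \<le> 0"
  proof (rule SUP_least)
    fix K assume "K \<in> {K. K \<subseteq> E \<and> compact K}"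
    then have K: "K \<subseteq> E" "compact K" by auto
    have "emeasure lborel K \<le> emeasure lborel E" by (rule emeasure_mono) (use K E in auto)
    then have "emeasure lborel K = 0" using E by simp
    then show "emeasure \<rho> K \<le> 0"
      using bounded_at_compact_null[OF M K(2)] K E by auto
  qed
  finally show ?thesis by simp
qed

lemma bounded_at_charged:
  assumes M: "M \<ge> 1" and E: "E \<in> sets borel" "E \<subseteq> bounded_at M" "E \<subseteq> {l..u}" "emeasure \<rho> E = 0"
  shows "emeasure lborel E = 0"
proof -
  \<comment> \<open>Inner regularity is used for finite measures, so Lebesgue measure is restricted
    to the interval.\<close>
  define D where "D = density lborel (indicator {l..u :: real})"
  have De: "emeasure D A = emeasure lborel ({l..u} \<inter> A)" if "A \<in> sets borel" for A
    unfolding D_def using that by (subst emeasure_density) (auto simp: indicator_inter_arith[symmetric])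
  have "emeasure D (space D) \<noteq> \<infinity>"
    using De[of UNIV] by (simp add: D_def emeasure_lborel_Icc_eq)
  then have "emeasure D E = (SUP K\<in>{K. K \<subseteq> E \<and> compact K}. emeasure D K)"
    by (intro inner_regular E) (auto simp: D_def)
  also have "\<dots> \<le> 0"
  proof (rule SUP_least)
    fix K assume "K \<in> {K. K \<subseteq> E \<and> compact K}"
    then have K: "K \<subseteq> E" "compact K" by auto
    have Kb: "K \<in> sets borel" using K(2) by (simp add: compact_imp_closed borel_closed)
    have "emeasure \<rho> K \<le> emeasure \<rho> E" by (rule emeasure_mono) (use K E in auto)
    then have "emeasure \<rho> K = 0" using E by simp
    then have "emeasure lborel K = 0" using bounded_at_compact_charged[OF M K(2)] K E by auto
    moreover have "emeasure D K \<le> emeasure lborel K"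
      unfolding De[OF Kb] by (rule emeasure_mono) (use Kb in auto)
    ultimately show "emeasure D K \<le> 0" by simp
  qed
  finally have "emeasure D E = 0" by simp
  then show ?thesis using De[OF E(1)] E(3) by (simp add: Int_absorb1)
qed

end

lemma UN_bounded_at:
  assumes "jacobi_measure \<rho> a b P A"
  shows "(\<Union>m::nat. jacobi_measure.bounded_at a b P (real m + 1)) = {x. Bseq (\<lambda>n. poly (P n) x) \<and> Bseq (second_kind a b x)}"
proof -
  interpret jacobi_measure \<rho> a b P A by fact
  show ?thesis
  proof (intro set_eqI iffI)
    fix x assume "x \<in> (\<Union>m::nat. bounded_at (real m + 1))"
    then obtain m :: nat where "x \<in> bounded_at (real m + 1)" by blast
    then show "x \<in> {x. Bseq (\<lambda>n. poly (P n) x) \<and> Bseq (second_kind a b x)}"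
      unfolding bounded_at_def pp_def qq_def by (auto intro!: BseqI'[where K = "real m + 1"])
  next
    fix x assume "x \<in> {x. Bseq (\<lambda>n. poly (P n) x) \<and> Bseq (second_kind a b x)}"
    then obtain K1 K2 where "\<And>n. \<bar>poly (P n) x\<bar> \<le> K1" "\<And>n. \<bar>second_kind a b x n\<bar> \<le> K2"
      by (auto simp: Bseq_def)
    moreover obtain m :: nat where "max K1 K2 < real m" using reals_Archimedean2 by blast
    ultimately have "\<bar>poly (P n) x\<bar> \<le> real m + 1 \<and> \<bar>second_kind a b x n\<bar> \<le> real m + 1" for n
      by (smt (verit) max.cobounded1 max.cobounded2)
    then show "x \<in> (\<Union>m::nat. bounded_at (real m + 1))"
      unfolding bounded_at_def pp_def qq_def by blast
  qed
qed

theorem theorem1p4: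
  fixes \<rho> \<rho>s :: "real measure" and f :: "real \<Rightarrow> real"
    and a b :: "nat \<Rightarrow> real" and p :: nat and \<beta> :: real
  assumes "real_distribution \<rho>"
    and "nontrivial_measure \<rho>"
    and "\<And>k::nat. integrable \<rho> (\<lambda>x. x ^ k)"
    and "lebesgue_decomposition \<rho> f \<rho>s"
    and "jacobi_coefficients \<rho> a b"
    and "p \<ge> 2"
    and "0 < \<beta>" and "\<beta> < 1 / (real p - 1)"
    and "oscillatory_decay p \<beta> (\<lambda>n. (a n)\<^sup>2 - 1)"
    and "oscillatory_decay p \<beta> b"
  shows "(\<exists>S\<in>sets borel. hausdorff_dim S \<le> ennreal (\<beta> * (real p - 1)) \<and>
            emeasure \<rho>s ({-2<..<2} - S) = 0) \<and>
         (AE x in lborel. x \<in> {-2<..<2} \<longrightarrow> f x > 0)"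
proof -
  interpret \<rho>: real_distribution \<rho> by fact
  obtain P where orth: "orthonormal_polynomials \<rho> P"
    and P_rec: "\<And>n x. x * poly (P n) x = a (n + 1) * poly (P (n + 1)) x + b (n + 1) * poly (P n) x +
             (if n = 0 then 0 else a n * poly (P (n - 1)) x)"
    and a_pos: "\<And>n. n \<ge> 1 \<Longrightarrow> a n > 0"
    using assms(5) unfolding jacobi_coefficients_def by blast
  have p1: "p \<ge> 1" using assms(6) by simp
  have \<sigma>1: "\<beta> * (real p - 1) < 1" using assms(6,8) by (simp add: pos_less_divide_eq)
  have "\<beta> * 1 \<le> \<beta> * (real p - 1)" using assms(6,7) by (intro mult_left_mono) auto
  then have \<beta>1: "\<beta> \<le> 1" using \<sigma>1 by simp
  note bet = assms(7) \<beta>1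
  obtain c1 \<phi>1 \<gamma>1 g1 V1 where o1: "osc_data p \<beta> (\<lambda>n. (a (n + 1))\<^sup>2 - 1) c1 \<phi>1 \<gamma>1 g1 V1"
    by (rule oscillatory_decay_shift[OF assms(9) p1 bet order_refl])
  obtain c2 \<phi>2 \<gamma>2 g2 V2 where o2: "osc_data p \<beta> (\<lambda>n. b (n + 2)) c2 \<phi>2 \<gamma>2 g2 V2"
    by (rule oscillatory_decay_shift[OF assms(10) p1 bet one_le_numeral])
  obtain Amax where a_le: "\<And>n. n \<ge> 1 \<Longrightarrow> a n \<le> Amax"
  proof -
    have "Bseq (\<lambda>n. (a (n + 1))\<^sup>2 - 1)"
      by (rule convergent_imp_Bseq[OF convergentI[OF osc_data_tendsto_0[OF o1 p1 bet]]])
    then obtain K where K: "K > 0" "\<And>n. \<bar>(a (n + 1))\<^sup>2 - 1\<bar> \<le> K" by (auto simp: Bseq_def)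
    have "a n \<le> K + 1" if n: "n \<ge> 1" for n
    proof -
      have "(a n)\<^sup>2 \<le> K + 1" using K(2)[of "n - 1"] n by simp
      also have "\<dots> \<le> (K + 1)\<^sup>2" using K(1) by (simp add: power2_eq_square)
      finally show ?thesis by (rule power2_le_imp_le) (use K in simp)
    qed
    then show thesis by (rule that)
  qed
  interpret jacobi_measure \<rho> a b P Amax
    by unfold_locales (fact assms(3) orth a_pos a_le P_rec)+

  define N where "N = (\<Union>m::nat. bounded_at (real m + 1))"
  have N_eq: "N = {x. Bseq (\<lambda>n. poly (P n) x) \<and> Bseq (second_kind a b x)}"
    unfolding N_def by (rule UN_bounded_at) unfold_locales
  have bm: "bounded_at M \<in> sets borel" for M by (rule borel_closed[OF closed_bounded_at])
  have Nb: "N \<in> sets borel" unfolding N_def using bm by blast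
  \<comment> \<open>Defined by unboundedness and not by resonance, so that it is Borel; the
    resonances enter only through \<open>S_sub\<close>.\<close>
  define S where "S = {-2<..<2} - N"
  have Sb: "S \<in> sets borel" unfolding S_def using Nb by simp

  define c where "c = (\<lambda>(t, l). cmod (if t then c1 l else c2 (l::nat)))"
  define \<phi> where "\<phi> = (\<lambda>(t, l). if t then \<phi>1 l else \<phi>2 (l::nat))"
  have cb: "(\<lambda>x. c x powr \<beta>) summable_on UNIV"
  proof -
    have "(\<lambda>l. cmod (c1 l) powr \<beta>) summable_on UNIV" "(\<lambda>l. cmod (c2 l) powr \<beta>) summable_on UNIV"
      using o1 o2 by (auto simp: osc_data_def)
    then obtain s t where "((\<lambda>l. cmod (c1 l) powr \<beta>) has_sum s) UNIV" "((\<lambda>l. cmod (c2 l) powr \<beta>) has_sum t) UNIV"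
      unfolding summable_on_def by blast
    then have "((\<lambda>x. c x powr \<beta>) has_sum (s + t)) UNIV"
      by (intro has_sum_bool_times) (simp_all add: c_def)
    then show ?thesis by (rule has_sum_imp_summable)
  qed
  define Res where "Res = {\<eta>. 0 < \<eta> \<and> \<eta> < pi \<and> \<not> nonresonant_phase p c \<phi> \<eta>}"
  have S_sub: "S \<subseteq> (\<lambda>\<eta>. 2 * cos \<eta>) ` Res"
  proof
    fix x assume x: "x \<in> S"
    then have x2: "-2 < x" "x < 2" and xN: "x \<notin> N" by (auto simp: S_def)
    define \<eta> where "\<eta> = arccos (x / 2)"
    have eta: "0 < \<eta>" "\<eta> < pi" "x = 2 * cos \<eta>"
      using x2 arccos_lt_bounded[of "x / 2"] by (auto simp: \<eta>_def cos_arccos)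
    have "\<eta> \<in> Res"
    proof (rule ccontr)
      assume "\<eta> \<notin> Res"
      then have good: "nonresonant_phase p c \<phi> \<eta>" using eta by (simp add: Res_def)
      \<comment> \<open>Applied to the orthonormal polynomials and to those of the second kind,
        which together span the solutions.\<close>
      note bnd = bounded_solutions[OF o1 o2 p1 bet eta(1,2) good[unfolded c_def \<phi>_def] a_pos]
      have "Bseq (\<lambda>n. poly (P n) x)"
      proof (rule bnd)
        fix n :: nat assume "n \<ge> 1"
        then show "2 * cos \<eta> * poly (P n) x = a (n + 1) * poly (P (n + 1)) x + b (n + 1) * poly (P n) x + a n * poly (P (n - 1)) x"
          using P_rec[of x n] by (simp add: eta(3)[symmetric])
      qed
      moreover have "Bseq (second_kind a b x)"
      proof (rule bnd)
        fix n :: nat assume "n \<ge> 1"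
        then obtain m where m: "n = Suc m" by (cases n) auto
        show "2 * cos \<eta> * second_kind a b x n = a (n + 1) * second_kind a b x (n + 1) + b (n + 1) * second_kind a b x n + a n * second_kind a b x (n - 1)"
          unfolding eta(3)[symmetric] m using qq_simps(3)[of m x]
          by (simp add: qq_def algebra_simps del: second_kind.simps)
      qed
      ultimately show False using xN by (simp add: N_eq)
    qed
    then show "x \<in> (\<lambda>\<eta>. 2 * cos \<eta>) ` Res" using eta(3) by blast
  qed
  have S_null: "hausdorff_measure s S = 0" if s: "s > \<beta> * (real p - 1)" for s
  proof -
    have "0 \<le> \<beta> * (real p - 1)" using assms(6,7) by simp
    then have s0: "s > 0" using s by linarith
    have "hausdorff_measure s Res = 0"
      unfolding Res_def by (rule resonant_phases_null[OF _ cb bet assms(6) s]) (simp add: c_def split: prod.split)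
    then have "hausdorff_measure s ((\<lambda>\<eta>. 2 * cos \<eta>) ` Res) = 0"
    proof (rule hausdorff_null_Lipschitz_image[OF s0, of 2, rotated])
      fix x y :: real
      have "\<bar>cos x - cos y\<bar> \<le> \<bar>x - y\<bar>"
      proof -
        have "\<bar>cos x - cos y\<bar> = 2 * (\<bar>sin ((x + y) / 2)\<bar> * \<bar>sin ((y - x) / 2)\<bar>)"
          by (simp add: cos_diff_cos abs_mult)
        also have "\<dots> \<le> 2 * (1 * \<bar>(y - x) / 2\<bar>)"
          by (intro mult_left_mono mult_mono abs_sin_x_le_abs_x abs_sin_le_one) auto
        finally show ?thesis by simp
      qed
      moreover have "\<bar>2 * cos x - 2 * cos y\<bar> = 2 * \<bar>cos x - cos y\<bar>"
        using abs_mult[of 2 "cos x - cos y"] by (simp add: right_diff_distrib)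
      ultimately show "dist (2 * cos x) (2 * cos y) \<le> 2 * dist x y" by (simp add: dist_real_def)
    qed simp
    then show ?thesis by (rule hausdorff_null_mono[OF _ S_sub])
  qed
  have dim: "hausdorff_dim S \<le> ennreal (\<beta> * (real p - 1))"
    by (rule hausdorff_dim_le[OF _ S_null]) (use assms(6,7) in auto)
  \<comment> \<open>The midpoint between \<beta>(p-1) and 1 is an exponent above the dimension bound
    and below 1.\<close>
  have S_leb: "emeasure lborel S = 0"
  proof -
    have "0 < (\<beta> * (real p - 1) + 1) / 2" using assms(6,7) by (simp add: add_nonneg_pos)
    then show ?thesis
      using \<sigma>1 by (intro hausdorff_null_imp_lborel_null[OF _ _ Sb S_null, of "(\<beta> * (real p - 1) + 1) / 2"]) auto
  qed

  have fm: "f \<in> borel_measurable borel"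
    and dec: "\<And>A. A \<in> sets borel \<Longrightarrow> emeasure \<rho> A = emeasure (density lborel (\<lambda>x. ennreal (f x))) A + emeasure \<rho>s A"
    using assms(4) unfolding lebesgue_decomposition_def by auto
  have "sets lborel = sets \<rho>s \<and> (\<exists>A\<in>sets lborel. emeasure lborel A = 0 \<and> emeasure \<rho>s (space lborel - A) = 0)"
    using assms(4) unfolding lebesgue_decomposition_def mutually_singular_def by (elim conjE) (intro conjI)
  then obtain T where "sets lborel = sets \<rho>s" "T \<in> sets lborel" "emeasure lborel T = 0" "emeasure \<rho>s (space lborel - T) = 0"
    by blast
  then have T: "T \<in> sets borel" "emeasure lborel T = 0" "emeasure \<rho>s (UNIV - T) = 0" and sets_s: "sets \<rho>s = sets borel"
    by simp_all
  have rs_le: "emeasure \<rho>s A \<le> emeasure \<rho> A" if "A \<in> sets borel" for A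
    using dec[OF that] by simp

  \<comment> \<open>The singular part lives on the Lebesgue null set \<open>T\<close>, and \<rho>
    gives no mass to the null subsets of \<open>bounded_at\<close>.\<close>
  have rsN: "emeasure \<rho>s (bounded_at (real m + 1)) = 0" for m :: nat
  proof -
    let ?B = "bounded_at (real m + 1)"
    have "emeasure \<rho>s ?B \<le> emeasure \<rho>s ((?B \<inter> T) \<union> (UNIV - T))"
      by (rule emeasure_mono) (use bm T sets_s in auto)
    also have "\<dots> \<le> emeasure \<rho>s (?B \<inter> T) + emeasure \<rho>s (UNIV - T)"
      by (rule emeasure_subadditive) (use bm T sets_s in auto)
    also have "emeasure \<rho>s (?B \<inter> T) \<le> emeasure \<rho> (?B \<inter> T)" by (rule rs_le) (use bm T in auto)
    also have "emeasure \<rho> (?B \<inter> T) = 0"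
    proof (rule bounded_at_null[of "real m + 1"])
      have "emeasure lborel (?B \<inter> T) \<le> emeasure lborel T" by (rule emeasure_mono) (use T in auto)
      then show "emeasure lborel (?B \<inter> T) = 0" using T by simp
    qed (use bm T in auto)
    finally show ?thesis using T by simp
  qed
  have sing: "emeasure \<rho>s ({-2<..<2} - S) = 0"
  proof -
    have "emeasure \<rho>s N \<le> (\<Sum>m. emeasure \<rho>s (bounded_at (real m + 1)))"
      unfolding N_def by (rule emeasure_subadditive_countably) (use bm sets_s in auto)
    then have "emeasure \<rho>s N = 0" by (simp add: rsN)
    moreover have "emeasure \<rho>s ({-2<..<2} - S) \<le> emeasure \<rho>s N"
      by (rule emeasure_mono) (use Nb sets_s in \<open>auto simp: S_def\<close>)
    ultimately show ?thesis by simp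
  qed

  \<comment> \<open>On this set the absolutely continuous part vanishes because \<open>f\<close> is
    not positive, and the singular part because \<open>T\<close> is removed. So \<rho> does not
    charge it, and \<open>bounded_at_charged\<close> makes it Lebesgue null.\<close>
  have pos: "emeasure lborel ((bounded_at (real m + 1) \<inter> {-2<..<2} \<inter> {x. f x \<le> 0}) - T) = 0" (is "emeasure lborel (?E m) = 0") for m :: nat
  proof (rule bounded_at_charged[of "real m + 1"])
    have [measurable]: "f \<in> borel_measurable borel" "T \<in> sets borel" "bounded_at (real m + 1) \<in> sets borel" using fm T bm by auto
    show Eb: "?E m \<in> sets borel" by measurable
    show "?E m \<subseteq> {-2..2}" by auto
    have "emeasure \<rho>s (?E m) \<le> emeasure \<rho>s (UNIV - T)" by (rule emeasure_mono) (use T sets_s in auto)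
    then have "emeasure \<rho>s (?E m) = 0" using T by simp
    moreover have "emeasure (density lborel (\<lambda>x. ennreal (f x))) (?E m) = 0"
    proof -
      have "emeasure (density lborel (\<lambda>x. ennreal (f x))) (?E m) = (\<integral>\<^sup>+x. ennreal (f x) * indicator (?E m) x \<partial>lborel)"
        by (rule emeasure_density) (use Eb in auto)
      also have "(\<lambda>x. ennreal (f x) * indicator (?E m) x) = (\<lambda>x. 0)"
        by (auto simp: indicator_def ennreal_neg fun_eq_iff)
      finally show ?thesis by simp
    qed
    ultimately show "emeasure \<rho> (?E m) = 0" using dec[OF Eb] by simp
  qed auto
  have "AE x in lborel. x \<in> {-2<..<2} \<longrightarrow> f x > 0"
  proof -
    have [measurable]: "f \<in> borel_measurable borel" "T \<in> sets borel" "bounded_at M \<in> sets borel" for M using fm T bm by auto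
    have "AE x in lborel. x \<notin> S" by (rule AE_not_in) (use S_leb Sb in \<open>auto intro: null_setsI\<close>)
    moreover have "AE x in lborel. x \<notin> T" by (rule AE_not_in) (use T in \<open>auto intro: null_setsI\<close>)
    moreover have "AE x in lborel. \<forall>m. x \<notin> ?E m"
      unfolding AE_all_countable by (intro allI AE_not_in null_setsI pos) measurable
    ultimately show ?thesis
    proof eventually_elim
      case (elim x)
      show ?case
      proof
        assume x: "x \<in> {-2<..<2}"
        then have "x \<in> N" using elim by (auto simp: S_def)
        then obtain m :: nat where "x \<in> bounded_at (real m + 1)" by (auto simp: N_def)
        then show "0 < f x" using elim x by force
      qed
    qed
  qed
  with Sb dim sing show ?thesis by blast
qed

end
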